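(* Let $q$ be a prime power, $F=\mathbb{F}_q(\!(t^{-1})\!)$, $G=\mathrm{PGL}_3(F)$, $\Gamma=\mathrm{PGL}_3(\mathbb{F}_q[t])$, $\mathcal{B}$ the Bruhat--Tits building of $G$ and $X=\Gamma\backslash\mathcal{B}$. Then the type~1 chamber zeta function \[ Z_\Gamma(u)=\prod_{[\mathbf{p}]}\left(1-w([\mathbf{p}])\,u^{\ell([\mathbf{p}])}\right)^{-1}, \] the product over all primitive type~1 closed admissible gallery classes $[\mathbf{p}]$ in $X$, converges for $|u|$ sufficiently small and \[ Z_{\Gamma}(u)=\frac{(1-q^4u^6)(1-q^2u^3)}{(1-q^3u^6)(1-q^3u^3)}. \] In particular, $Z_\Gamma(u)$ is a rational function of $u$.
   Context: Let $\nu$ be the valuation on $F=\mathbb{F}_q(\!(t^{-1})\!)$ with $\nu(t^{-1})=1$, $\mathcal{O}=\mathbb{F}_q[\![t^{-1}]\!]$, $\pi=t^{-1}$. The building $\mathcal{B}$: vertices are homothety classes $[L]$ of rank-3 $\mathcal{O}$-lattices $L\subset F^3$; three vertices $[L_1],[L_2],[L_3]$ form a chamber if they have representatives with $\pi L_1\subset L_3\subset L_2\subset L_1$. The type of a vertex is $\tau([L])=\nu(\det g)\bmod 3$ where $L=g\mathcal{O}^3$. A pointed chamber is an ordered triple $(v_1,v_2,v_3)$ of the vertices of a chamber; it has type 1 if $\tau(v_2)-\tau(v_1)\equiv\tau(v_3)-\tau(v_2)\equiv 1 \pmod 3$. For type 1 pointed chambers $c=(v_1,v_2,v_3)$, $c'=(v_1',v_2',v_3')$,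 $c'$ is edge-adjacent to $c$ if $v_1'=v_2$ and $v_2'=v_3$; the step $c\to c'$ is tailless if $v_3'\neq v_1$. $\Gamma$ acts on $\mathcal{B}$ preserving types and adjacency; pointed chambers of $X$ are $\Gamma$-orbits of pointed chambers of $\mathcal{B}$, and $c'$ is edge-adjacent to $c$ in $X$ if some lifts are. For edge-adjacent type 1 pointed chambers $c,c'$ of $X$, the weight $w(c,c')$ is the number of type 1 pointed chambers $\tilde c'$ of $\mathcal{B}$ that are edge-adjacent to a fixed lift $\tilde c$ of $c$, project to $c'$, and such that $\tilde c\to\tilde c'$ is tailless (this is independent of the lift). A type 1 gallery of length $n$ in $X$ is a sequence $(c_0,\dots,c_n)$ of type 1 pointed chambers with $c_{j+1}$ edge-adjacent to $c_j$; it is closed if $c_n=c_0$, and admissible if it is the projection of a gallery in $\mathcal{B}$ all of whose steps are tailless. Closed galleries are identified up to cyclic shift $(c_0,\dots,c_n)\mapsto(c_1,\dots,c_n,c_1)$, giving classes $[\mathbf{c}]$ of length $\ell([\mathbf{c}])=n$ and weight $w([\mathbf{c}])=\prod_{j\bmod n}w(c_j,c_{j+1})$. A class is primitive if it is not obtained by traversing a shorter closed gallery $k\ge2$ times. *)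

theory Defs
  imports "HOL-Analysis.Analysis" "HOL-Computational_Algebra.Formal_Laurent_Series"
    "HOL-Number_Theory.Cong"
begin

text \<open>
  The finite field with \<open>q\<close> elements is a type \<open>'k\<close> of sort \<open>{field, finite}\<close> with \<open>CARD('k) = q\<close>.
  The field \<open>F\<close> of Laurent series in \<open>t\<^sup>-\<^sup>1\<close> is \<open>'k fls\<close>, whose variable \<^const>\<open>fls_X\<close> plays the
  role of the uniformiser \<open>\<pi> = t\<^sup>-\<^sup>1\<close>; hence \<open>t\<close> is \<^const>\<open>fls_X_inv\<close>, and the valuation of a
  nonzero series is \<^const>\<open>fls_subdegree\<close>.
\<close>

definition int_ring :: "'k::field fls set" where
  "int_ring = range fps_to_fls"

definition poly_ring_t :: "'k::field fls set" where
  "poly_ring_t = range (\<lambda>p :: 'k poly. poly (map_poly fls_const p) fls_X_inv)"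


subsection \<open>Lattices and vertices\<close>

definition std_lattice :: "('k::field fls ^ 3) set" where
  "std_lattice = {x. \<forall>i. x $ i \<in> int_ring}"

definition is_lattice :: "('k::field fls ^ 3) set \<Rightarrow> bool" where
  "is_lattice L \<longleftrightarrow> (\<exists>g :: 'k fls ^ 3 ^ 3. invertible g \<and> L = (*v) g ` std_lattice)"

definition homothety_class :: "('k::field fls ^ 3) set \<Rightarrow> ('k fls ^ 3) set set" where
  "homothety_class L = {(*s) c ` L | c. c \<noteq> 0}"

definition vertices :: "('k::field fls ^ 3) set set set" where
  "vertices = homothety_class ` {L. is_lattice L}"

text \<open>The description below is unambiguous: if \<open>g \<O>\<^sup>3\<close> and \<open>h \<O>\<^sup>3\<close> are homothetic by \<open>c\<close>,
  then \<open>det h\<close> is \<open>c\<^sup>3 det g\<close> up to a unit of \<open>\<O>\<close>.\<close>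

definition vertex_type :: "('k::field fls ^ 3) set set \<Rightarrow> int" where
  "vertex_type v = (THE m. \<exists>g :: 'k fls ^ 3 ^ 3.
     invertible g \<and> (*v) g ` std_lattice \<in> v \<and> m = fls_subdegree (det g) mod 3)"


subsection \<open>Chambers of the building\<close>

type_synonym 'v triple = "'v \<times> 'v \<times> 'v"

text \<open>The inclusions are strict, so that the three vertices are distinct.\<close>

definition is_chamber :: "('k::field fls ^ 3) set set set \<Rightarrow> bool" where
  "is_chamber C \<longleftrightarrow> (\<exists>L1 L2 L3. is_lattice L1 \<and> is_lattice L2 \<and> is_lattice L3 \<and>
     (*s) fls_X ` L1 \<subset> L3 \<and> L3 \<subset> L2 \<and> L2 \<subset> L1 \<and>
     C = {homothety_class L1, homothety_class L2, homothety_class L3})"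

definition pointed_chambers :: "('k::field fls ^ 3) set set triple set" where
  "pointed_chambers = {(v1, v2, v3). is_chamber {v1, v2, v3}}"

definition type1_chambers :: "('k::field fls ^ 3) set set triple set" where
  "type1_chambers = {(v1, v2, v3). (v1, v2, v3) \<in> pointed_chambers \<and>
     [vertex_type v2 - vertex_type v1 = 1] (mod 3) \<and>
     [vertex_type v3 - vertex_type v2 = 1] (mod 3)}"

fun edge_adjacent :: "'v triple \<Rightarrow> 'v triple \<Rightarrow> bool" where
  "edge_adjacent (v1, v2, v3) (v1', v2', v3') \<longleftrightarrow> v1' = v2 \<and> v2' = v3"

fun tailless :: "'v triple \<Rightarrow> 'v triple \<Rightarrow> bool" where
  "tailless (v1, v2, v3) (v1', v2', v3') \<longleftrightarrow> v3' \<noteq> v1"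


subsection \<open>The projective linear group and its action\<close>

definition GL3 :: "'f::field set \<Rightarrow> ('f ^ 3 ^ 3) set" where
  "GL3 R = {A. (\<forall>i j. A $ i $ j \<in> R) \<and>
     (\<exists>B. (\<forall>i j. B $ i $ j \<in> R) \<and> A ** B = mat 1 \<and> B ** A = mat 1)}"

definition scalar_class :: "'f::field set \<Rightarrow> 'f ^ 3 ^ 3 \<Rightarrow> ('f ^ 3 ^ 3) set" where
  "scalar_class R A = {mat c ** A | c. c \<in> R \<and> (\<exists>d\<in>R. c * d = 1)}"

definition PGL3 :: "'f::field set \<Rightarrow> ('f ^ 3 ^ 3) set set" where
  "PGL3 R = scalar_class R ` GL3 R"

text \<open>For \<open>\<gamma>\<close> the class of \<open>A\<close> and \<open>v\<close> the class of \<open>L\<close>, the set below is exactly the homothety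
  class of \<open>A L\<close>.\<close>

definition pgl_act :: "('f::field ^ 3 ^ 3) set \<Rightarrow> ('f ^ 3) set set \<Rightarrow> ('f ^ 3) set set" where
  "pgl_act \<gamma> v = {(*v) A ` L | A L. A \<in> \<gamma> \<and> L \<in> v}"

definition Gamma :: "('k::field fls ^ 3 ^ 3) set set" where
  "Gamma = PGL3 poly_ring_t"

definition chamber_orbit ::
    "('k::field fls ^ 3) set set triple \<Rightarrow> ('k fls ^ 3) set set triple set" where
  "chamber_orbit c = (case c of (v1, v2, v3) \<Rightarrow>
     {(pgl_act \<gamma> v1, pgl_act \<gamma> v2, pgl_act \<gamma> v3) | \<gamma>. \<gamma> \<in> Gamma})"


subsection \<open>Type 1 chambers and galleries of the quotient\<close>

definition X_type1_chambers :: "('k::field fls ^ 3) set set triple set set" where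
  "X_type1_chambers = chamber_orbit ` type1_chambers"

definition X_edge_adjacent :: "'v triple set \<Rightarrow> 'v triple set \<Rightarrow> bool" where
  "X_edge_adjacent c c' \<longleftrightarrow> (\<exists>d\<in>c. \<exists>d'\<in>c'. edge_adjacent d d')"

definition step_weight ::
    "('k::field fls ^ 3) set set triple set \<Rightarrow> ('k fls ^ 3) set set triple set \<Rightarrow> nat" where
  "step_weight c c' = (let d = (SOME d. d \<in> c) in
     card {d' \<in> type1_chambers. edge_adjacent d d' \<and> chamber_orbit d' = c' \<and> tailless d d'})"

text \<open>A gallery \<open>(c\<^sub>0, \<dots>, c\<^sub>n)\<close> of length \<open>n\<close> is a list with \<open>n + 1\<close> entries, so a closed gallery
  repeats its first entry at the end.  Closed galleries have length at least one.\<close>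

definition gallery_length :: "'c list \<Rightarrow> nat" where
  "gallery_length cs = length cs - 1"

definition tailless_gallery :: "('k::field fls ^ 3) set set triple list \<Rightarrow> bool" where
  "tailless_gallery ds \<longleftrightarrow> ds \<noteq> [] \<and> set ds \<subseteq> type1_chambers \<and>
     (\<forall>j < gallery_length ds.
        edge_adjacent (ds ! j) (ds ! Suc j) \<and> tailless (ds ! j) (ds ! Suc j))"

definition X_gallery :: "('k::field fls ^ 3) set set triple set list \<Rightarrow> bool" where
  "X_gallery cs \<longleftrightarrow> cs \<noteq> [] \<and> set cs \<subseteq> X_type1_chambers \<and>
     (\<forall>j < gallery_length cs. X_edge_adjacent (cs ! j) (cs ! Suc j))"

definition closed_gallery :: "('k::field fls ^ 3) set set triple set list \<Rightarrow> bool" where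
  "closed_gallery cs \<longleftrightarrow> X_gallery cs \<and> gallery_length cs \<ge> 1 \<and> last cs = hd cs"

definition admissible :: "('k::field fls ^ 3) set set triple set list \<Rightarrow> bool" where
  "admissible cs \<longleftrightarrow> (\<exists>ds. tailless_gallery ds \<and> map chamber_orbit ds = cs)"

definition gallery_weight :: "('k::field fls ^ 3) set set triple set list \<Rightarrow> nat" where
  "gallery_weight cs = (\<Prod>j < gallery_length cs. step_weight (cs ! j) (cs ! Suc j))"

definition cyclic_shift :: "'c list \<Rightarrow> 'c list" where
  "cyclic_shift cs = tl cs @ [cs ! 1]"

definition gallery_class :: "'c list \<Rightarrow> 'c list set" where
  "gallery_class cs = {(cyclic_shift ^^ m) cs | m. True}"

definition traverse :: "nat \<Rightarrow> 'c list \<Rightarrow> 'c list" where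
  "traverse k cs = hd cs # concat (replicate k (tl cs))"

definition primitive_class :: "('k::field fls ^ 3) set set triple set list set \<Rightarrow> bool" where
  "primitive_class P \<longleftrightarrow> \<not> (\<exists>cs k. closed_gallery cs \<and> k \<ge> 2 \<and> traverse k cs \<in> P)"

definition prime_classes :: "('k::field fls ^ 3) set set triple set list set set" where
  "prime_classes = {P. primitive_class P \<and>
     (\<exists>cs. closed_gallery cs \<and> admissible cs \<and> P = gallery_class cs)}"

text \<open>Length and weight are constant on a class, so any representative will do.\<close>

definition class_length :: "'c list set \<Rightarrow> nat" where
  "class_length P = gallery_length (SOME cs. cs \<in> P)"

definition class_weight :: "('k::field fls ^ 3) set set triple set list set \<Rightarrow> nat" where
  "class_weight P = gallery_weight (SOME cs. cs \<in> P)"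


subsection \<open>The chamber zeta function\<close>

text \<open>Products over an index set without preferred order: the finite partial products converge along
  the directed set of finite subsets, as for \<^const>\<open>has_sum\<close>.  As for \<^const>\<open>raw_has_prod\<close>, a
  convergent product has a nonzero limit.\<close>

definition has_unordered_prod :: "('i \<Rightarrow> complex) \<Rightarrow> 'i set \<Rightarrow> complex \<Rightarrow> bool" where
  "has_unordered_prod f I z \<longleftrightarrow> (prod f \<longlongrightarrow> z) (finite_subsets_at_top I) \<and> z \<noteq> 0"

definition zeta_factor ::
    "complex \<Rightarrow> ('k::field fls ^ 3) set set triple set list set \<Rightarrow> complex" where
  "zeta_factor u P = inverse (1 - of_nat (class_weight P) * u ^ class_length P)"

text \<open>The type argument selects the base field. The zeta function is meaningful only where the
  product converges.\<close>

definition zeta_converges :: "'k::field itself \<Rightarrow> complex \<Rightarrow> bool" where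
  "zeta_converges _ u \<longleftrightarrow> (\<exists>z. has_unordered_prod (zeta_factor u)
     (prime_classes :: ('k fls ^ 3) set set triple set list set set) z)"

definition chamber_zeta :: "'k::field itself \<Rightarrow> complex \<Rightarrow> complex" where
  "chamber_zeta _ u = (THE z. has_unordered_prod (zeta_factor u)
     (prime_classes :: ('k fls ^ 3) set set triple set list set set) z)"

end

theory Submission
  imports Defs "HOL-Complex_Analysis.Complex_Analysis"
begin

text \<open>A type 1 pointed chamber is a lattice chain \<open>\<dots> \<supset> M 0 \<supset> M 1 \<supset> M 2 \<supset> M 3 = \<pi> M 0 \<supset> \<dots>\<close>
up to a shift by a multiple of 3, and passing to an edge-adjacent chamber replaces one lattice of the shifted
chain. Polynomial vectors of maximal level give every chain a basis that is simultaneously adapted to the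
polynomial lattice and to the chain (Grothendieck splitting), so the orbits of pointed chambers are indexed
by \<open>\<int>\<^sup>2\<close> and the weights can be read off. The logarithm of the Euler product is the sum over closed
walks in this weighted graph of weight times \<open>u\<^sup>\<ell> / \<ell>\<close>, that is \<open>- log det (1 - K)\<close> for the step
kernel \<open>K\<close>. Eliminating blocks of vertices by return-word decompositions, for positive \<open>u\<close> where all
sums have nonnegative terms, reduces \<open>K\<close> to a kernel of rank one, whose determinant is the inverse of the
claimed value; complex \<open>u\<close> follows by analytic continuation.\<close>


section \<open>Laurent series\<close>

text \<open>The quotient graph is infinite, so \<open>K\<close> is an infinite matrix without a
  ready-made determinant or inverse of \<open>1 - K\<close>. Everything is therefore phrased through
  sums of walk weights in \<open>ennreal\<close>, where rearrangement is free and divergence is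
  harmless until the final evaluation. The algebraic tool is the walk form of det (1 - X - Y) = det
  (1 - X) det (1 - Y Z) with Z the inverse of 1 - X. It pays off because \<open>X\<close> can be
  chosen acyclic, with determinant 1, three times: walks inside the positive quadrant, walks from
  strip to strip outside it, and a strictly triangular kernel. What then remains has rank one, since
  a walk that has reached the corner of its strip remembers its start only through a scalar factor.
  A tailless step has \<open>q\<close> continuations. The sign of the first coordinate decides
  whether polynomial shears identify all of them or single out one against \<open>q - 1\<close>;
  this is the origin of the three weights u, (q - 1) u and q u.\<close>

abbreviation \<nu> :: "'k::field fls \<Rightarrow> int" where "\<nu> \<equiv> fls_subdegree"
definition \<pi>p :: "int \<Rightarrow> 'k::field fls" where "\<pi>p n = fls_X powi n"

lemma val_mult: "c \<noteq> 0 \<Longrightarrow> d \<noteq> 0 \<Longrightarrow> \<nu> (c * d) = \<nu> c + \<nu> (d :: 'k::field fls)"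
  by simp

lemma val_inverse: "c \<noteq> 0 \<Longrightarrow> \<nu> (inverse c) = - \<nu> (c :: 'k::field fls)"
  using val_mult[of c "inverse c"] by simp

lemma val_pow [simp]: "\<nu> (\<pi>p n :: 'k::field fls) = n"
  using fls_subdegree_power_int[of "fls_X :: 'k fls" n] unfolding \<pi>p_def fls_X_subdegree by linarith

lemma pow_nz [simp]: "(\<pi>p n :: 'k::field fls) \<noteq> 0"
  using val_pow[of n] by (auto simp: \<pi>p_def)

lemma pow_add: "(\<pi>p (m + n) :: 'k::field fls) = \<pi>p m * \<pi>p n"
  unfolding \<pi>p_def by (rule power_int_add) auto

lemma pow_0 [simp]: "\<pi>p 0 = 1" and pow_1 [simp]: "\<pi>p 1 = fls_X"
  by (auto simp: \<pi>p_def power_int_def)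

lemma val_add_ge: "c \<noteq> 0 \<Longrightarrow> d \<noteq> 0 \<Longrightarrow> c + d \<noteq> 0 \<Longrightarrow> n \<le> \<nu> c \<Longrightarrow> n \<le> \<nu> d \<Longrightarrow> n \<le> \<nu> (c + d :: 'k::field fls)"
  using fls_plus_subdegree[of c d] by simp

lemma int_ring_iff: "c \<in> int_ring \<longleftrightarrow> c = 0 \<or> 0 \<le> \<nu> (c :: 'k::field fls)"
proof
  assume "c \<in> int_ring"
  then show "c = 0 \<or> 0 \<le> \<nu> c"
    unfolding int_ring_def by (auto simp: fls_subdegree_fls_to_fps_gt0)
next
  assume "c = 0 \<or> 0 \<le> \<nu> c"
  then have "0 \<le> \<nu> c" by auto
  then have "c = fps_to_fls (fls_regpart c)" by simp
  then show "c \<in> int_ring" unfolding int_ring_def by blast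
qed

text \<open>The convention \<open>fls_subdegree 0 = 0\<close> lets the case \<open>c = 0\<close>
  disappear from the criterion.\<close>

lemma int_ring_iff': "c \<in> int_ring \<longleftrightarrow> 0 \<le> \<nu> (c :: 'k::field fls)"
  by (auto simp: int_ring_iff)

lemma int_ring_add: "c \<in> int_ring \<Longrightarrow> d \<in> int_ring \<Longrightarrow> c + d \<in> (int_ring :: 'k::field fls set)"
  unfolding int_ring_def by (auto simp flip: fps_to_fls_plus)

lemma int_ring_diff: "c \<in> int_ring \<Longrightarrow> d \<in> int_ring \<Longrightarrow> c - d \<in> (int_ring :: 'k::field fls set)"
  unfolding int_ring_def by (auto simp flip: fps_to_fls_minus)

lemma int_ring_mult: "c \<in> int_ring \<Longrightarrow> d \<in> int_ring \<Longrightarrow> c * d \<in> (int_ring :: 'k::field fls set)"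
  unfolding int_ring_iff by (cases "c = 0"; cases "d = 0") (auto simp: val_mult)

lemma int_ring_0 [simp]: "0 \<in> (int_ring :: 'k::field fls set)"
  and int_ring_1 [simp]: "1 \<in> (int_ring :: 'k::field fls set)"
  unfolding int_ring_iff by auto

lemma residue_split:
  assumes "0 \<le> \<nu> (c :: 'k::field fls)"
  obtains d where "c = fls_const (fls_nth c 0) + d" "d = 0 \<or> 1 \<le> \<nu> d"
proof -
  have "c - fls_const (fls_nth c 0) = 0 \<or> 1 \<le> \<nu> (c - fls_const (fls_nth c 0))"
  proof (cases "c - fls_const (fls_nth c 0) = 0")
    case False
    then have "1 \<le> \<nu> (c - fls_const (fls_nth c 0))"
      using assms by (intro fls_subdegree_geI) (auto simp: fls_eq0_below_subdegree)
    then show ?thesis by simp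
  qed simp
  then show ?thesis by (intro that[of "c - fls_const (fls_nth c 0)"]) auto
qed

text \<open>Describes the image of \<open>map_poly fls_const\<close> through coefficients, so that
  closure of \<open>poly_ring_t\<close> under sums and products is read off from coefficients
  instead of from homomorphism laws for \<open>map_poly\<close>.\<close>

definition const_poly :: "'k::field fls poly \<Rightarrow> bool" where
  "const_poly p \<longleftrightarrow> (\<forall>i. coeff p i \<in> range fls_const)"

lemma const_poly_iff: "const_poly p \<longleftrightarrow> (\<exists>r :: 'k::field poly. p = map_poly fls_const r)"
proof
  assume p: "const_poly p"
  have "map_poly fls_const (map_poly (\<lambda>c. fls_nth c 0) p) = p"
  proof (rule poly_eqI)
    fix n
    obtain b where "coeff p n = fls_const b" using p unfolding const_poly_def by blast
    then show "coeff (map_poly fls_const (map_poly (\<lambda>c. fls_nth c 0) p)) n = coeff p n"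
      by (simp add: coeff_map_poly)
  qed
  then show "\<exists>r. p = map_poly fls_const r" by metis
qed (auto simp: const_poly_def coeff_map_poly)

lemma poly_ring_t_iff: "c \<in> poly_ring_t \<longleftrightarrow> (\<exists>p. const_poly p \<and> c = poly p (fls_X_inv :: 'k::field fls))"
  unfolding poly_ring_t_def const_poly_iff by blast

lemma const_range: "x \<in> range fls_const \<Longrightarrow> y \<in> range fls_const \<Longrightarrow> x + y \<in> range (fls_const :: 'k::field \<Rightarrow> _)"
  "x \<in> range fls_const \<Longrightarrow> y \<in> range fls_const \<Longrightarrow> x * y \<in> range (fls_const :: 'k::field \<Rightarrow> _)"
  "0 \<in> range (fls_const :: 'k::field \<Rightarrow> _)"
  by (auto simp: fls_plus_const image_iff intro: exI[of _ "0::'k"])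

lemma const_range_sum: "(\<And>i. i \<in> A \<Longrightarrow> f i \<in> range fls_const) \<Longrightarrow> sum f A \<in> range (fls_const :: 'k::field \<Rightarrow> _)"
  by (induction A rule: infinite_finite_induct) (auto intro!: const_range simp del: rangeI)

lemma poly_ring_add: "c \<in> poly_ring_t \<Longrightarrow> d \<in> poly_ring_t \<Longrightarrow> c + d \<in> (poly_ring_t :: 'k::field fls set)"
  unfolding poly_ring_t_iff
proof safe
  fix p r :: "'k fls poly" assume "const_poly p" "const_poly r"
  then show "\<exists>s. const_poly s \<and> poly p fls_X_inv + poly r fls_X_inv = poly s fls_X_inv"
    by (intro exI[of _ "p + r"]) (auto simp: const_poly_def intro: const_range)
qed

lemma poly_ring_mult: "c \<in> poly_ring_t \<Longrightarrow> d \<in> poly_ring_t \<Longrightarrow> c * d \<in> (poly_ring_t :: 'k::field fls set)"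
  unfolding poly_ring_t_iff
proof safe
  fix p r :: "'k fls poly" assume "const_poly p" "const_poly r"
  then show "\<exists>s. const_poly s \<and> poly p fls_X_inv * poly r fls_X_inv = poly s fls_X_inv"
    by (intro exI[of _ "p * r"])
      (auto simp: const_poly_def coeff_mult simp del: rangeI intro!: const_range const_range_sum)
qed

lemma poly_ring_const [simp]: "fls_const c \<in> poly_ring_t"
  unfolding poly_ring_t_iff
  by (intro exI[of _ "[:fls_const c:]"]) (auto simp: const_poly_def coeff_pCons split: nat.split intro: const_range)

lemma poly_ring_0 [simp]: "0 \<in> (poly_ring_t :: 'k::field fls set)"
  and poly_ring_1 [simp]: "1 \<in> (poly_ring_t :: 'k::field fls set)"
  using poly_ring_const[of "0::'k"] poly_ring_const[of "1::'k"] by simp_all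

lemma poly_ring_uminus:
  assumes "c \<in> (poly_ring_t :: 'k::field fls set)"
  shows "- c \<in> poly_ring_t"
proof -
  have "fls_const (- 1 :: 'k) * c \<in> poly_ring_t"
    using assms by (intro poly_ring_mult poly_ring_const)
  then show ?thesis by (simp only: fls_const_uminus fls_const_1 mult_minus1)
qed

lemma poly_ring_diff: "c \<in> poly_ring_t \<Longrightarrow> d \<in> poly_ring_t \<Longrightarrow> c - d \<in> (poly_ring_t :: 'k::field fls set)"
  using poly_ring_add[of c "- d"] poly_ring_uminus[of d] by (simp only: add_uminus_conv_diff)

lemma poly_ring_X_inv [simp]: "fls_X_inv \<in> (poly_ring_t :: 'k::field fls set)"
  unfolding poly_ring_t_def by (rule image_eqI[of _ _ "[:0, 1:]"]) (simp_all add: map_poly_pCons)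

lemma poly_ring_power: "c \<in> poly_ring_t \<Longrightarrow> c ^ m \<in> (poly_ring_t :: 'k::field fls set)"
  by (induction m) (auto intro: poly_ring_mult)

lemma poly_ring_pow: "n \<le> 0 \<Longrightarrow> \<pi>p n \<in> (poly_ring_t :: 'k::field fls set)"
  by (auto simp: \<pi>p_def power_int_def fls_inverse_X simp del: fls_inverse_X_power fls_X_inv_power_conv_shift_1 intro!: poly_ring_power)

text \<open>Horner evaluation at \<open>fls_X_inv\<close> shifts coefficients only towards negative
  degrees, so no positive power of the uniformiser ever appears. This discreteness of the
  polynomials in \<open>F\<close> later bounds the levels of polynomial vectors.\<close>

lemma poly_ring_val:
  assumes "c \<in> (poly_ring_t :: 'k::field fls set)" "c \<noteq> 0"
  shows "\<nu> c \<le> 0"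
proof -
  have *: "\<forall>n>0. fls_nth (poly p fls_X_inv) n = 0" if "const_poly p" for p :: "'k fls poly"
    using that
  proof (induction p)
    case (pCons a p)
    have "\<exists>b. coeff (pCons a p) i = fls_const b" for i
      using pCons.prems unfolding const_poly_def by blast
    from this[of 0] obtain b where "coeff (pCons a p) 0 = fls_const b" by blast
    then have b: "a = fls_const b" by (simp only: coeff_pCons_0)
    have "coeff p i \<in> range fls_const" for i
    proof -
      have "coeff (pCons a p) (Suc i) \<in> range fls_const" using pCons.prems unfolding const_poly_def by blast
      then show ?thesis by (simp only: coeff_pCons_Suc)
    qed
    then have "const_poly p" unfolding const_poly_def by blast
    then have IH: "\<forall>n>0. fls_nth (poly p fls_X_inv) n = 0" by (rule pCons.IH)
    show ?case
    proof (intro allI impI)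
      fix n :: int assume "n > 0"
      then show "fls_nth (poly (pCons a p) fls_X_inv) n = 0"
        unfolding b poly_pCons fls_plus_nth fls_X_inv_times_conv_shift(1) fls_shift_nth fls_const_nth
        using IH by simp
    qed
  qed simp
  then have "\<forall>n>0. fls_nth c n = 0" using assms by (auto simp: poly_ring_t_iff)
  moreover have "fls_nth c (\<nu> c) \<noteq> 0" using assms by simp
  ultimately show ?thesis by (meson not_le)
qed

text \<open>The finitely many terms of nonpositive order are split off one at a time. This is the
  division step used to reduce coordinates modulo polynomials.\<close>

lemma poly_split:
  obtains p r where "(c :: 'k::field fls) = p + r" "p \<in> poly_ring_t" "r = 0 \<or> 1 \<le> \<nu> r"
proof -
  have "\<exists>p r. c = p + r \<and> p \<in> poly_ring_t \<and> (r = 0 \<or> 1 \<le> \<nu> r)" if "1 - int m \<le> \<nu> c" for m and c :: "'k fls"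
    using that
  proof (induction m arbitrary: c)
    case 0
    then show ?case by (intro exI[of _ 0] exI[of _ c]) auto
  next
    case (Suc m)
    \<comment> \<open>The term of order \<open>- int m\<close>, the lowest that the induction
      hypothesis for \<open>Suc m\<close> allows; the constant term goes last, at
      \<open>m = 0\<close>.\<close>
    define a where "a = fls_const (fls_nth c (- int m)) * \<pi>p (- int m)"
    have a: "a = fls_shift (int m) (fls_const (fls_nth c (- int m)))"
      unfolding a_def \<pi>p_def by (simp add: fls_X_power_int fls_shifted_times_simps)
    have "1 - int m \<le> \<nu> (c - a)" if "c - a \<noteq> 0"
    proof (rule fls_subdegree_geI[OF that])
      fix k assume "k < 1 - int m"
      then consider "k = - int m" | "k < - int m" by linarith
      then show "fls_nth (c - a) k = 0"
        by cases (use Suc.prems in \<open>auto simp: a fls_eq0_below_subdegree\<close>)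
    qed
    then consider "c - a = 0" | "1 - int m \<le> \<nu> (c - a)" by blast
    then obtain p r where "c - a = p + r" "p \<in> poly_ring_t" "r = 0 \<or> 1 \<le> \<nu> r"
    proof cases
      case 2 then show ?thesis using Suc.IH that by blast
    qed (use that[of 0 0] in auto)
    moreover have "a \<in> poly_ring_t" unfolding a_def by (intro poly_ring_mult poly_ring_pow) auto
    ultimately have "c = (p + a) + r" "p + a \<in> poly_ring_t" "r = 0 \<or> 1 \<le> \<nu> r"
      by (auto simp: diff_eq_eq ac_simps intro: poly_ring_add)
    then show ?case by blast
  qed
  moreover have "1 - int (nat (1 - \<nu> c)) \<le> \<nu> c" by simp
  ultimately show ?thesis using that by blast
qed

section \<open>Lattice chains and their normal form\<close>

definition cols :: "'f::field ^ 3 \<Rightarrow> 'f ^ 3 \<Rightarrow> 'f ^ 3 \<Rightarrow> 'f ^ 3 ^ 3" where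
  "cols a b c = (\<chi> i j. if j = 1 then a $ i else if j = 2 then b $ i else c $ i)"

definition comb :: "'f::field ^ 3 \<Rightarrow> 'f ^ 3 \<Rightarrow> 'f ^ 3 \<Rightarrow> 'f \<Rightarrow> 'f \<Rightarrow> 'f \<Rightarrow> 'f ^ 3" where
  "comb a b c x y z = x *s a + y *s b + z *s c"

lemma cols_mult: "cols a b c *v v = comb a b c (v $ 1) (v $ 2) (v $ 3)"
  by (simp add: vec_eq_iff matrix_vector_mult_def cols_def comb_def sum_3 mult.commute)

text \<open>The largest index whose lattice contains \<open>v\<close>, meaningful for nonzero
  \<open>v\<close>. A chain amounts to an integer-valued ultrametric norm in which the uniformiser
  counts 3.\<close>

definition lev :: "(int \<Rightarrow> ('k::field fls ^ 3) set) \<Rightarrow> 'k fls ^ 3 \<Rightarrow> int" where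
  "lev M v = (THE n. v \<in> M n \<and> v \<notin> M (n + 1))"

text \<open>\<open>scale_mem\<close> carries two facts at once: units preserve each
  \<open>M n\<close>, and the uniformiser moves the index by 3, which is the periodicity of the
  chain. That every \<open>M n\<close> is a lattice of rank 3 is a consequence, drawn in
  \<open>chain_lattice\<close>.\<close>

locale lattice_chain =
  fixes M :: "int \<Rightarrow> ('k::field fls ^ 3) set"
  assumes zero_mem [simp]: "0 \<in> M n"
    and add_mem: "v \<in> M n \<Longrightarrow> w \<in> M n \<Longrightarrow> v + w \<in> M n"
    and scale_mem: "c \<noteq> 0 \<Longrightarrow> c *s v \<in> M (n + 3 * \<nu> c) \<longleftrightarrow> v \<in> M n"
    and strict: "M (n + 1) \<subset> M n"
    and exhaust: "\<exists>n. v \<in> M n"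
    and separated: "v \<noteq> 0 \<Longrightarrow> \<exists>n. v \<notin> M n"
begin

lemma antimono: "m \<le> n \<Longrightarrow> M n \<subseteq> M m"
proof (induction n rule: int_ge_induct)
  case (step i) then show ?case using strict[of i] by auto
qed simp

lemma strict_antimono: "m < n \<Longrightarrow> M n \<subset> M m"
  using antimono[of "m + 1" n] strict[of m] by auto

lemma subset_iff: "M m \<subset> M n \<longleftrightarrow> n < m"
  using strict_antimono[of n m] antimono[of m n] by (meson not_le psubset_eq subset_not_subset_eq)

lemma inj: "M m = M n \<longleftrightarrow> m = n"
  using strict_antimono[of n m] strict_antimono[of m n] by (metis linorder_neqE psubset_eq)

lemma lev_ex1: "v \<noteq> 0 \<Longrightarrow> \<exists>!n. v \<in> M n \<and> v \<notin> M (n + 1)"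
proof -
  assume "v \<noteq> 0"
  then obtain b where b: "v \<notin> M b" using separated by blast
  obtain a where a: "v \<in> M a" using exhaust by blast
  have "a < b" using a b antimono[of b a] by force
  define k where "k = (LEAST k. v \<notin> M (a + int k))"
  have "v \<notin> M (a + int (nat (b - a)))" using b \<open>a < b\<close> by simp
  then have k: "v \<notin> M (a + int k)" unfolding k_def by (rule LeastI)
  then have "k \<noteq> 0" using a by (metis add.right_neutral of_nat_0)
  then obtain j where j: "k = Suc j" by (cases k) auto
  then have "v \<in> M (a + int j)" using not_less_Least[of j "\<lambda>k. v \<notin> M (a + int k)"] by (auto simp: k_def)
  then have ex: "v \<in> M (a + int j) \<and> v \<notin> M (a + int j + 1)" using k j by (auto simp: ac_simps)
  show ?thesis
  proof (rule ex1I[of _ "a + int j"], rule ex)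
    fix n assume n: "v \<in> M n \<and> v \<notin> M (n + 1)"
    show "n = a + int j"
      using n ex antimono[of "n + 1" "a + int j"] antimono[of "a + int j + 1" n] by (meson not_le subsetD zless_imp_add1_zle order.antisym)
  qed
qed

lemma mem_iff: "v \<noteq> 0 \<Longrightarrow> v \<in> M n \<longleftrightarrow> n \<le> lev M v"
proof -
  assume "v \<noteq> 0"
  from theI'[OF lev_ex1[OF this]] have *: "v \<in> M (lev M v)" "v \<notin> M (lev M v + 1)"
    unfolding lev_def by auto
  show ?thesis
    using * antimono[of n "lev M v"] antimono[of "lev M v + 1" n] by (meson not_le subsetD zless_imp_add1_zle)
qed

lemma lev_eqI: "v \<in> M n \<Longrightarrow> v \<notin> M (n + 1) \<Longrightarrow> lev M v = n"
  using mem_iff[of v n] mem_iff[of v "n + 1"] zero_mem[of "n + 1"] by (cases "v = 0") auto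

lemma lev_scale: "c \<noteq> 0 \<Longrightarrow> v \<noteq> 0 \<Longrightarrow> lev M (c *s v) = lev M v + 3 * \<nu> c"
  by (rule lev_eqI) (use scale_mem[of c v "lev M v"] scale_mem[of c v "lev M v + 1"] mem_iff[of v] in \<open>auto simp: ac_simps\<close>)

lemma scale_mem_iff: "c \<noteq> 0 \<Longrightarrow> v \<noteq> 0 \<Longrightarrow> c *s v \<in> M n \<longleftrightarrow> n \<le> lev M v + 3 * \<nu> c"
  using mem_iff[of "c *s v" n] lev_scale[of c v] by simp

lemma scale_mem_int: "0 \<le> \<nu> c \<Longrightarrow> v \<in> M n \<Longrightarrow> c *s v \<in> M n"
  using scale_mem_iff[of c v n] mem_iff[of v n] by (cases "c = 0"; cases "v = 0") auto

lemma uminus_mem: "v \<in> M n \<Longrightarrow> - v \<in> M n"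
  using scale_mem_int[of "- 1" v n] by (simp add: vector_sneg_minus1[symmetric])

lemma diff_mem: "v \<in> M n \<Longrightarrow> w \<in> M n \<Longrightarrow> v - w \<in> M n"
  using add_mem[of v n "- w"] uminus_mem[of w n] by simp

lemma add_mem_iff: "w \<in> M n \<Longrightarrow> v + w \<in> M n \<longleftrightarrow> v \<in> M n"
  using add_mem[of v n w] diff_mem[of "v + w" n w] by auto

lemma lev_add:
  assumes "v \<noteq> 0" "w \<noteq> 0" "lev M v < lev M w"
  shows "v + w \<noteq> 0" "lev M (v + w) = lev M v"
proof -
  have w: "w \<in> M (lev M v)" "w \<in> M (lev M v + 1)" using assms by (auto simp: mem_iff)
  have *: "v + w \<in> M (lev M v)" "v + w \<notin> M (lev M v + 1)"
    using assms w by (auto simp: add_mem_iff mem_iff)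
  then show "v + w \<noteq> 0" using zero_mem by metis
  show "lev M (v + w) = lev M v" using * by (rule lev_eqI)
qed

lemma lev_add':
  assumes "v \<noteq> 0" "w \<noteq> 0" "lev M w < lev M v"
  shows "v + w \<noteq> 0" "lev M (v + w) = lev M w"
  using lev_add[of w v] assms by (auto simp: add.commute)

text \<open>Vectors of different levels cannot cancel, so the sum is no deeper in the chain than its
  shallowest summand.\<close>

lemma sum2_mem:
  assumes "v = 0 \<or> w = 0 \<or> lev M v \<noteq> lev M w"
  shows "v + w \<in> M n \<longleftrightarrow> v \<in> M n \<and> w \<in> M n"
proof (cases "v = 0 \<or> w = 0")
  case False
  then show ?thesis using assms lev_add[of v w] lev_add'[of v w]
    by (cases "lev M v < lev M w") (auto simp: mem_iff)
qed auto

lemma sum3_mem: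
  assumes "u = 0 \<or> v = 0 \<or> lev M u \<noteq> lev M v" "u = 0 \<or> w = 0 \<or> lev M u \<noteq> lev M w"
    "v = 0 \<or> w = 0 \<or> lev M v \<noteq> lev M w"
  shows "u + v + w \<in> M n \<longleftrightarrow> u \<in> M n \<and> v \<in> M n \<and> w \<in> M n"
proof (cases "u = 0 \<or> v = 0")
  case True
  then consider "u = 0" | "v = 0" by blast
  then show ?thesis
  proof cases
    case 1 then show ?thesis using sum2_mem[OF assms(3), of n] by simp
  next
    case 2 then show ?thesis using sum2_mem[OF assms(2), of n] by simp
  qed
next
  case False
  then have "lev M (u + v) = lev M u \<or> lev M (u + v) = lev M v"
    using assms(1) lev_add(2)[of u v] lev_add'(2)[of u v] by (cases "lev M u < lev M v") auto
  then have "u + v = 0 \<or> w = 0 \<or> lev M (u + v) \<noteq> lev M w" using assms(2,3) False by auto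
  then show ?thesis using sum2_mem[of "u + v" w n] sum2_mem[OF assms(1), of n] by (simp only: conj_assoc)
qed

end

section \<open>Bases adapted to a chain\<close>

definition frame :: "(int \<Rightarrow> ('k::field fls ^ 3) set) \<Rightarrow> 'k fls ^ 3 \<Rightarrow> 'k fls ^ 3 \<Rightarrow> 'k fls ^ 3 \<Rightarrow> bool" where
  "frame M a b c \<longleftrightarrow> a \<noteq> 0 \<and> b \<noteq> 0 \<and> c \<noteq> 0 \<and>
     lev M a mod 3 = 1 \<and> lev M b mod 3 = 2 \<and> lev M c mod 3 = 0"

definition fbasis :: "'f::field ^ 3 \<Rightarrow> 'f ^ 3 \<Rightarrow> 'f ^ 3 \<Rightarrow> bool" where
  "fbasis a b c \<longleftrightarrow> (\<forall>v. \<exists>x y z. v = comb a b c x y z) \<and>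
     (\<forall>x y z. comb a b c x y z = 0 \<longrightarrow> x = 0 \<and> y = 0 \<and> z = 0)"

lemma comb_diff: "comb a b c x y z - comb a b c x' y' z' = comb a b c (x - x') (y - y') (z - z')"
  by (simp add: comb_def vec_eq_iff algebra_simps)

lemma comb_add: "comb a b c x y z + comb a b c x' y' z' = comb a b c (x + x') (y + y') (z + z')"
  by (simp add: comb_def vec_eq_iff algebra_simps)

lemma comb_scale: "d *s comb a b c x y z = comb a b c (d * x) (d * y) (d * z)"
  by (simp add: comb_def vec_eq_iff algebra_simps)

lemma comb_unit [simp]: "comb a b c 1 0 0 = a" "comb a b c 0 1 0 = b" "comb a b c 0 0 1 = c" "comb a b c 0 0 0 = 0"
  by (simp_all add: comb_def)

lemma fbasis_eq: "fbasis a b c \<Longrightarrow> comb a b c x y z = comb a b c x' y' z' \<longleftrightarrow> x = x' \<and> y = y' \<and> z = z'"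
proof -
  assume "fbasis a b c"
  then have "comb a b c (x - x') (y - y') (z - z') = 0 \<Longrightarrow> x - x' = 0 \<and> y - y' = 0 \<and> z - z' = 0"
    unfolding fbasis_def by blast
  moreover have "comb a b c x y z = comb a b c x' y' z' \<longleftrightarrow> comb a b c (x - x') (y - y') (z - z') = 0"
    by (simp only: comb_diff[of a b c x y z x' y' z', symmetric] right_minus_eq)
  ultimately have "comb a b c x y z = comb a b c x' y' z' \<Longrightarrow> x = x' \<and> y = y' \<and> z = z'"
    by (simp only: right_minus_eq)
  then show ?thesis by metis
qed

text \<open>An injective square matrix has a left inverse, which is also a right inverse; this
  supplies the spanning half.\<close>

lemma fbasisI:
  assumes ind: "\<And>x y z. comb a b c x y z = 0 \<Longrightarrow> x = 0 \<and> y = 0 \<and> z = 0"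
  shows "fbasis a b c"
proof -
  have "v = 0" if "cols a b c *v v = 0" for v
    using ind[of "v $ 1" "v $ 2" "v $ 3"] that unfolding cols_mult vec_eq_iff[of v 0] forall_3 by simp
  then have "\<forall>v. cols a b c *v v = 0 \<longrightarrow> v = 0" by blast
  then obtain B where "B ** cols a b c = mat 1"
    using matrix_left_invertible_ker[of "cols a b c"] by auto
  then have "cols a b c ** B = mat 1" using matrix_left_right_inverse by blast
  then have "cols a b c *v (B *v v) = v" for v by (simp add: matrix_vector_mul_assoc)
  then have "\<exists>x y z. v = comb a b c x y z" for v by (metis cols_mult)
  then show ?thesis using ind unfolding fbasis_def by blast
qed

lemma fbasis_invertible: "fbasis a b c \<Longrightarrow> invertible (cols a b c)"
  unfolding invertible_left_inverse matrix_left_invertible_ker fbasis_def cols_mult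
  by (subst (2) vec_eq_iff) (simp add: forall_3)

lemma fbasis_ex: "fbasis a b c \<Longrightarrow> \<exists>x y z. v = comb a b c x y z"
  unfolding fbasis_def by blast

context lattice_chain begin

text \<open>Scaling moves a level by a multiple of 3, so multiples of the three frame vectors have
  levels in different residue classes and cannot cancel.\<close>

lemma frame_mem:
  assumes "frame M a b c"
  shows "comb a b c x y z \<in> M n \<longleftrightarrow> x *s a \<in> M n \<and> y *s b \<in> M n \<and> z *s c \<in> M n"
proof -
  have *: "u *s v = 0 \<or> u' *s v' = 0 \<or> lev M (u *s v) \<noteq> lev M (u' *s v')"
    if "v \<noteq> 0" "v' \<noteq> 0" "lev M v mod 3 \<noteq> lev M v' mod 3" for u u' v v'
  proof (cases "u = 0 \<or> u' = 0")
    case False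
    then have "lev M (u *s v) mod 3 = lev M v mod 3" "lev M (u' *s v') mod 3 = lev M v' mod 3"
      using that by (simp_all add: lev_scale)
    then show ?thesis using that by metis
  qed auto
  show ?thesis unfolding comb_def
    by (intro sum3_mem *) (use assms in \<open>simp_all add: frame_def\<close>)
qed

lemma frame_mem':
  assumes "frame M a b c"
  shows "comb a b c x y z \<in> M n \<longleftrightarrow> (x = 0 \<or> n \<le> lev M a + 3 * \<nu> x) \<and>
    (y = 0 \<or> n \<le> lev M b + 3 * \<nu> y) \<and> (z = 0 \<or> n \<le> lev M c + 3 * \<nu> z)"
proof -
  have *: "d *s v \<in> M n \<longleftrightarrow> d = 0 \<or> n \<le> lev M v + 3 * \<nu> d" if "v \<noteq> 0" for d v
    using that by (cases "d = 0") (auto simp: scale_mem_iff)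
  have "a \<noteq> 0" "b \<noteq> 0" "c \<noteq> 0" using assms unfolding frame_def by simp_all
  then show ?thesis unfolding frame_mem[OF assms] by (simp only: * not_False_eq_True)
qed

text \<open>A linear relation puts each of its terms into every \<open>M n\<close>, and only 0 lies
  in all of them.\<close>

lemma frame_basis:
  assumes "frame M a b c"
  shows "fbasis a b c"
proof (rule fbasisI)
  fix x y z assume "comb a b c x y z = 0"
  then have *: "x *s a \<in> M n" "y *s b \<in> M n" "z *s c \<in> M n" for n
    using frame_mem[OF assms, of x y z n] by auto
  have "x *s a = 0" "y *s b = 0" "z *s c = 0" using * separated by blast+
  then show "x = 0 \<and> y = 0 \<and> z = 0" using assms unfolding frame_def by simp_all
qed

lemma frame_lev:
  assumes "frame M a b c" and "comb a b c x y z \<noteq> 0"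
  shows "(x \<noteq> 0 \<and> lev M (comb a b c x y z) = lev M a + 3 * \<nu> x) \<or>
    (y \<noteq> 0 \<and> lev M (comb a b c x y z) = lev M b + 3 * \<nu> y) \<or>
    (z \<noteq> 0 \<and> lev M (comb a b c x y z) = lev M c + 3 * \<nu> z)"
proof -
  let ?l = "lev M (comb a b c x y z)"
  have 1: "comb a b c x y z \<in> M ?l" and 2: "comb a b c x y z \<notin> M (?l + 1)"
    using mem_iff[OF assms(2)] by auto
  show ?thesis
    using 1 2 unfolding frame_mem'[OF assms(1), of x y z] by linarith
qed

lemma ex_lev: "\<exists>v. v \<noteq> 0 \<and> lev M v = n"
proof -
  obtain v where v: "v \<in> M n" "v \<notin> M (n + 1)" using strict[of n] by blast
  then have "v \<noteq> 0" using zero_mem by metis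
  then show ?thesis using lev_eqI[OF v] by blast
qed

lemma ex_frame:
  assumes "n1 mod 3 = 1" "n2 mod 3 = 2" "n3 mod 3 = 0"
  shows "\<exists>a b c. frame M a b c \<and> lev M a = n1 \<and> lev M b = n2 \<and> lev M c = n3"
proof -
  obtain a b c where "a \<noteq> 0" "lev M a = n1" "b \<noteq> 0" "lev M b = n2" "c \<noteq> 0" "lev M c = n3"
    using ex_lev by metis
  then show ?thesis using assms unfolding frame_def by metis
qed

lemma mem_shift3: "v \<in> M (n + 3 * k) \<longleftrightarrow> \<pi>p (- k) *s v \<in> M n"
  using scale_mem[of "\<pi>p (- k)" v "n + 3 * k"] by simp

lemma image_scale: "c \<noteq> 0 \<Longrightarrow> (*s) c ` M n = M (n + 3 * \<nu> c)"
proof (intro equalityI subsetI)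
  assume c: "c \<noteq> 0"
  fix v assume v: "v \<in> M (n + 3 * \<nu> c)"
  have "v = c *s (inverse c *s v)" using c by (simp add: vec_eq_iff)
  then show "v \<in> (*s) c ` M n" using v c scale_mem[of c "inverse c *s v" n] by (metis image_eqI)
qed (auto simp: scale_mem)

end

text \<open>\<open>frame_mem'\<close> expresses membership through coordinates and the three levels
  alone, so these data determine the chain.\<close>

lemma chain_eqI:
  assumes "lattice_chain M" "lattice_chain M'" "frame M a b c"
    "lev M' a = lev M a" "lev M' b = lev M b" "lev M' c = lev M c"
  shows "M = M'"
proof -
  interpret M: lattice_chain M by fact
  interpret M': lattice_chain M' by fact
  have f': "frame M' a b c" using assms unfolding frame_def by simp_all
  show ?thesis
  proof (intro ext set_eqI)
    fix n v
    obtain x y z where v: "v = comb a b c x y z" using fbasis_ex[OF M.frame_basis[OF assms(3)]] by blast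
    show "v \<in> M n \<longleftrightarrow> v \<in> M' n"
      unfolding v M.frame_mem'[OF assms(3)] M'.frame_mem'[OF f'] assms(4-6) ..
  qed
qed

section \<open>Chains with prescribed levels on a basis\<close>

definition fchain :: "'k::field fls ^ 3 \<Rightarrow> 'k fls ^ 3 \<Rightarrow> 'k fls ^ 3 \<Rightarrow> int \<Rightarrow> int \<Rightarrow> int \<Rightarrow> int \<Rightarrow> ('k fls ^ 3) set" where
  "fchain a b c n1 n2 n3 n = {comb a b c x y z | x y z.
     (x = 0 \<or> n \<le> n1 + 3 * \<nu> x) \<and> (y = 0 \<or> n \<le> n2 + 3 * \<nu> y) \<and> (z = 0 \<or> n \<le> n3 + 3 * \<nu> z)}"

lemma fchain_mem:
  assumes "fbasis a b c"
  shows "comb a b c x y z \<in> fchain a b c n1 n2 n3 n \<longleftrightarrow>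
    (x = 0 \<or> n \<le> n1 + 3 * \<nu> x) \<and> (y = 0 \<or> n \<le> n2 + 3 * \<nu> y) \<and> (z = 0 \<or> n \<le> n3 + 3 * \<nu> z)"
  unfolding fchain_def using fbasis_eq[OF assms] by auto

lemma fchain_chain:
  assumes fb: "fbasis a b c" and r: "n1 mod 3 = 1" "n2 mod 3 = 2" "n3 mod 3 = 0"
  shows "lattice_chain (fchain a b c n1 n2 n3)"
proof (rule lattice_chain.intro)
  let ?M = "fchain a b c n1 n2 n3"
  note mem = fchain_mem[OF fb, of _ _ _ n1 n2 n3]
  fix n v w and d :: "'a fls"
  show "0 \<in> ?M n" using mem[of 0 0 0 n] by simp
  show "v + w \<in> ?M n" if "v \<in> ?M n" "w \<in> ?M n"
  proof -
    obtain x y z x' y' z' where *: "v = comb a b c x y z" "w = comb a b c x' y' z'"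
      using fbasis_ex[OF fb] by metis
    have add: "x + x' = 0 \<or> n \<le> k + 3 * \<nu> (x + x')"
      if "x = 0 \<or> n \<le> k + 3 * \<nu> x" "x' = 0 \<or> n \<le> k + 3 * \<nu> x'" for x x' :: "'a fls" and k
      using that fls_plus_subdegree[of x x'] by (cases "x = 0"; cases "x' = 0"; cases "x + x' = 0") auto
    show ?thesis using that unfolding * comb_add mem by (intro conjI add) auto
  qed
  show "d *s v \<in> ?M (n + 3 * \<nu> d) \<longleftrightarrow> v \<in> ?M n" if "d \<noteq> 0"
  proof -
    obtain x y z where *: "v = comb a b c x y z" using fbasis_ex[OF fb] by metis
    have sc: "(d * x = 0 \<or> n + 3 * \<nu> d \<le> k + 3 * \<nu> (d * x)) \<longleftrightarrow> (x = 0 \<or> n \<le> k + 3 * \<nu> x)" for x k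
      using that by (cases "x = 0") auto
    show ?thesis unfolding * comb_scale mem sc ..
  qed
  show "?M (n + 1) \<subset> ?M n"
  proof
    show "?M (n + 1) \<subseteq> ?M n" 
    proof
      fix v assume v: "v \<in> ?M (n + 1)"
      obtain x y z where *: "v = comb a b c x y z" using fbasis_ex[OF fb] by metis
      show "v \<in> ?M n" using v unfolding * mem by auto
    qed
    \<comment> \<open>The three residues exhaust all classes modulo 3, so some basis vector times a
      power of the uniformiser has level exactly \<open>n\<close>.\<close>
    consider k where "n = n1 + 3 * k" | k where "n = n2 + 3 * k" | k where "n = n3 + 3 * k"
    proof -
      have "n mod 3 = 1 \<or> n mod 3 = 2 \<or> n mod 3 = 0" by presburger
      moreover have "n = m + 3 * ((n - m) div 3)" if "n mod 3 = m mod 3" for m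
        using that by presburger
      ultimately show ?thesis using that r by metis
    qed
    then show "?M (n + 1) \<noteq> ?M n"
    proof cases
      case 1 then have "comb a b c (\<pi>p k) 0 0 \<in> ?M n" "comb a b c (\<pi>p k) 0 0 \<notin> ?M (n + 1)" unfolding mem by auto
      then show ?thesis by auto
    next
      case 2 then have "comb a b c 0 (\<pi>p k) 0 \<in> ?M n" "comb a b c 0 (\<pi>p k) 0 \<notin> ?M (n + 1)" unfolding mem by auto
      then show ?thesis by auto
    next
      case 3 then have "comb a b c 0 0 (\<pi>p k) \<in> ?M n" "comb a b c 0 0 (\<pi>p k) \<notin> ?M (n + 1)" unfolding mem by auto
      then show ?thesis by auto
    qed
  qed
  obtain x y z where v: "v = comb a b c x y z" using fbasis_ex[OF fb] by metis
  show "\<exists>n. v \<in> ?M n"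
    unfolding v mem by (rule exI[of _ "min (n1 + 3 * \<nu> x) (min (n2 + 3 * \<nu> y) (n3 + 3 * \<nu> z))"]) auto
  show "\<exists>n. v \<notin> ?M n" if "v \<noteq> 0"
  proof -
    have "x \<noteq> 0 \<or> y \<noteq> 0 \<or> z \<noteq> 0" using that v by auto
    then show ?thesis
      unfolding v mem
      by (intro exI[of _ "max (n1 + 3 * \<nu> x) (max (n2 + 3 * \<nu> y) (n3 + 3 * \<nu> z)) + 1"]) auto
  qed
qed

lemma fchain_frame:
  assumes fb: "fbasis a b c" and r: "n1 mod 3 = 1" "n2 mod 3 = 2" "n3 mod 3 = 0"
  defines "M \<equiv> fchain a b c n1 n2 n3"
  shows "frame M a b c" "lev M a = n1" "lev M b = n2" "lev M c = n3"
proof -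
  interpret lattice_chain M unfolding M_def by (rule fchain_chain) fact+
  note mem = fchain_mem[OF fb, of _ _ _ n1 n2 n3]
  show *: "lev M a = n1" "lev M b = n2" "lev M c = n3"
    using mem[of 1 0 0] mem[of 0 1 0] mem[of 0 0 1] by (intro lev_eqI; simp add: M_def)+
  have "a \<noteq> 0" "b \<noteq> 0" "c \<noteq> 0"
    using fb comb_unit[of a b c] unfolding fbasis_def by (metis zero_neq_one)+
  then show "frame M a b c" using * r by (auto simp: frame_def)
qed

section \<open>The polynomial lattice and its splitting bases\<close>

definition P3 :: "('k::field fls ^ 3) set" where
  "P3 = {v. \<forall>i. v $ i \<in> poly_ring_t}"

lemma P3_add: "v \<in> P3 \<Longrightarrow> w \<in> P3 \<Longrightarrow> v + w \<in> P3"
  by (simp add: P3_def poly_ring_add)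

lemma P3_diff: "v \<in> P3 \<Longrightarrow> w \<in> P3 \<Longrightarrow> v - w \<in> P3"
  by (simp add: P3_def poly_ring_diff)

lemma P3_scale: "c \<in> poly_ring_t \<Longrightarrow> v \<in> P3 \<Longrightarrow> c *s v \<in> P3"
  by (simp add: P3_def poly_ring_mult)

lemma P3_comb:
  "\<lbrakk>a \<in> P3; b \<in> P3; c \<in> P3; x \<in> poly_ring_t; y \<in> poly_ring_t; z \<in> poly_ring_t\<rbrakk> \<Longrightarrow> comb a b c x y z \<in> P3"
  unfolding comb_def by (intro P3_add P3_scale)

text \<open>Only generation is asked for: it yields a right inverse over the ring, which for square
  matrices is two-sided. \<open>pbasis_GL3\<close> uses this to place the column matrix in the
  general linear group.\<close>

definition pbasis :: "'k::field fls ^ 3 \<Rightarrow> 'k fls ^ 3 \<Rightarrow> 'k fls ^ 3 \<Rightarrow> bool" where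
  "pbasis a b c \<longleftrightarrow> a \<in> P3 \<and> b \<in> P3 \<and> c \<in> P3 \<and>
     (\<forall>v\<in>P3. \<exists>x\<in>poly_ring_t. \<exists>y\<in>poly_ring_t. \<exists>z\<in>poly_ring_t. v = comb a b c x y z)"

lemma comb_axis: "comb (axis 1 1) (axis 2 1) (axis 3 1) (v $ 1) (v $ 2) (v $ 3) = (v :: 'f::field ^ 3)"
  by (simp add: comb_def vec_eq_iff forall_3 axis_def)

lemma pbasis_rot: "pbasis a b c \<Longrightarrow> pbasis b c a"
proof -
  have "comb a b c x y z = comb b c a y z x" for x y z by (simp add: comb_def)
  then show "pbasis a b c \<Longrightarrow> pbasis b c a" unfolding pbasis_def by metis
qed

lemma pbasis_swap: "pbasis a b c \<Longrightarrow> pbasis a c b"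
proof -
  have "comb a b c x y z = comb a c b x z y" for x y z by (simp add: comb_def)
  then show "pbasis a b c \<Longrightarrow> pbasis a c b" unfolding pbasis_def by metis
qed

lemma pbasis_add:
  assumes "pbasis a b c" "d \<in> poly_ring_t"
  shows "pbasis a b (c + d *s b)"
  unfolding pbasis_def
proof (intro conjI ballI)
  show "a \<in> P3" "b \<in> P3" "c + d *s b \<in> P3"
    using assms by (auto simp: pbasis_def intro: P3_add P3_scale)
  fix v :: "'a fls ^ 3" assume "v \<in> P3"
  then obtain x y z where *: "x \<in> poly_ring_t" "y \<in> poly_ring_t" "z \<in> poly_ring_t" "v = comb a b c x y z"
    using assms(1) unfolding pbasis_def by blast
  have "v = comb a b (c + d *s b) x (y - z * d) z"
    unfolding *(4) by (simp add: comb_def vec_eq_iff algebra_simps)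
  moreover have "y - z * d \<in> poly_ring_t" using * assms(2) by (intro poly_ring_diff poly_ring_mult)
  ultimately show "\<exists>x\<in>poly_ring_t. \<exists>y\<in>poly_ring_t. \<exists>z\<in>poly_ring_t. v = comb a b (c + d *s b) x y z"
    using * by blast
qed

lemma pbasis_GL3:
  assumes "pbasis a b c"
  shows "cols a b c \<in> GL3 poly_ring_t"
proof -
  have ax: "axis i 1 \<in> P3" for i by (auto simp: P3_def axis_def)
  have "\<exists>w\<in>P3. v = cols a b c *v w" if v: "v \<in> P3" for v
  proof -
    obtain x y z where *: "x \<in> poly_ring_t" "y \<in> poly_ring_t" "z \<in> poly_ring_t" "v = comb a b c x y z"
      using assms v unfolding pbasis_def by blast
    have "vector [x, y, z] \<in> P3" using * by (simp add: P3_def forall_3)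
    moreover have "v = cols a b c *v vector [x, y, z]" using * by (simp add: cols_mult)
    ultimately show ?thesis by blast
  qed
  then have "\<forall>i. \<exists>w. w \<in> P3 \<and> axis i 1 = cols a b c *v w" using ax by blast
  then obtain w where w: "\<And>i. w i \<in> P3" "\<And>i. axis i 1 = cols a b c *v w i" by metis
  define B where "B = (\<chi> i j. w j $ i)"
  have "(cols a b c ** B) $ i $ j = (cols a b c *v w j) $ i" for i j
    by (simp add: B_def matrix_matrix_mult_def matrix_vector_mult_def)
  then have 1: "cols a b c ** B = mat 1"
    unfolding w(2)[symmetric] by (simp add: vec_eq_iff axis_def mat_def)
  then have 2: "B ** cols a b c = mat 1" using matrix_left_right_inverse by blast
  have "cols a b c $ i $ j \<in> poly_ring_t" for i j
    using assms by (auto simp: cols_def pbasis_def P3_def)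
  moreover have "B $ i $ j \<in> poly_ring_t" for i j using w(1) by (auto simp: B_def P3_def)
  ultimately show ?thesis using 1 2 unfolding GL3_def by blast
qed

text \<open>The residues are listed in the order 1, 2, 0 because a tailless step replaces the
  lattices whose index is divisible by 3, so that the vector \<open>c\<close> of that residue comes
  last.\<close>

definition pframe :: "(int \<Rightarrow> ('k::field fls ^ 3) set) \<Rightarrow> 'k fls ^ 3 \<Rightarrow> 'k fls ^ 3 \<Rightarrow> 'k fls ^ 3 \<Rightarrow> bool" where
  "pframe M a b c \<longleftrightarrow> frame M a b c \<and> pbasis a b c"

context lattice_chain begin

text \<open>A vector deep in the chain has coordinates of positive valuation, which a nonzero
  polynomial vector cannot have.\<close>

lemma P3_lev_bounded: "\<exists>K. \<forall>v\<in>P3. v \<noteq> 0 \<longrightarrow> lev M v \<le> K"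
proof -
  obtain a b c where f: "frame M a b c" and l: "lev M a = 1" "lev M b = 2" "lev M c = 0"
    using ex_frame[of 1 2 0] by auto
  \<comment> \<open>A common lower bound for the valuations of all entries of the frame; frame
    coordinates of valuation at least \<open>1 - m\<close> then produce entries of valuation at
    least 1.\<close>
  have "\<exists>m. \<forall>i. m \<le> \<nu> (a $ i) \<and> m \<le> \<nu> (b $ i) \<and> m \<le> \<nu> (c $ i)"
    by (rule exI[of _ "Min ((\<lambda>i. \<nu> (a $ i)) ` UNIV \<union> (\<lambda>i. \<nu> (b $ i)) ` UNIV \<union> (\<lambda>i. \<nu> (c $ i)) ` UNIV)"])
      (auto intro!: Min_le)
  then obtain m where m: "\<And>i. m \<le> \<nu> (a $ i)" "\<And>i. m \<le> \<nu> (b $ i)" "\<And>i. m \<le> \<nu> (c $ i)" by blast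
  define big where "big k = {d :: 'k fls. d = 0 \<or> k \<le> \<nu> d}" for k
  have big_add: "d + e \<in> big k" if "d \<in> big k" "e \<in> big k" for d e k
    using that val_add_ge[of d e k] by (cases "d = 0"; cases "e = 0") (auto simp: big_def)
  have big_mult: "d * e \<in> big (k + m)" if "d \<in> big k" "m \<le> \<nu> e" for d e k
    using that by (cases "d = 0"; cases "e = 0") (auto simp: big_def)
  have "lev M v \<le> 3 * (1 - m) + 2" if v: "v \<in> P3" "v \<noteq> 0" for v
  proof (rule ccontr)
    assume "\<not> lev M v \<le> 3 * (1 - m) + 2"
    then have mem: "v \<in> M (3 * (1 - m) + 2)" using v(2) by (simp add: mem_iff)
    obtain x y z where *: "v = comb a b c x y z" using fbasis_ex[OF frame_basis[OF f]] by blast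
    have xyz: "x \<in> big (1 - m)" "y \<in> big (1 - m)" "z \<in> big (1 - m)"
      using mem unfolding * frame_mem'[OF f] l by (auto simp: big_def)
    have vb: "v $ i \<in> big (1 - m + m)" for i
      unfolding * comb_def vector_add_component vector_smult_component
      by (intro big_add big_mult xyz m)
    then have "v $ i = 0" for i
    proof -
      have "v $ i = 0 \<or> 1 \<le> \<nu> (v $ i)" using vb[of i] by (simp add: big_def)
      moreover have "v $ i \<noteq> 0 \<Longrightarrow> \<nu> (v $ i) \<le> 0" using v(1) by (intro poly_ring_val) (auto simp: P3_def)
      ultimately show ?thesis by linarith
    qed
    then show False using v(2) by (simp add: vec_eq_iff)
  qed
  then show ?thesis by blast
qed

text \<open>A vector of sufficiently low level keeps its level when its coordinates are reduced to
  their polynomial parts.\<close>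

lemma ex_P3_residue: "\<exists>v\<in>P3. v \<noteq> 0 \<and> lev M v mod 3 = r mod 3"
proof -
  define e where "e i = (axis i 1 :: 'k fls ^ 3)" for i :: 3
  define K where "K = min (lev M (e 1)) (min (lev M (e 2)) (lev M (e 3)))"
  have e0: "e i \<noteq> 0" for i by (simp add: e_def axis_eq_0_iff)
  have eK: "e 1 \<in> M K" "e 2 \<in> M K" "e 3 \<in> M K" using e0 by (auto simp: mem_iff K_def)
  \<comment> \<open>The standard lattice is contained in \<open>M K\<close>. The chosen level is
    congruent to \<open>r\<close> and at most \<open>K - 3\<close>, hence strictly below everything
    subtracted afterwards.\<close>
  obtain v where v: "v \<noteq> 0" "lev M v = r + 3 * ((K - 3 - r) div 3)" using ex_lev by blast
  have "\<forall>i. \<exists>p s. v $ i = p + s \<and> p \<in> poly_ring_t \<and> (s = 0 \<or> 1 \<le> \<nu> s)"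
    using poly_split by metis
  then obtain p s where ps: "\<And>i. v $ i = p i + s i" "\<And>i. p i \<in> poly_ring_t" "\<And>i. s i = 0 \<or> 1 \<le> \<nu> (s i)"
    by metis
  define w where "w = (\<chi> i. s i)"
  have "0 \<le> \<nu> (s i)" for i using ps(3)[of i] by auto
  then have "comb (e 1) (e 2) (e 3) (w $ 1) (w $ 2) (w $ 3) \<in> M K"
    using eK unfolding comb_def by (intro add_mem scale_mem_int) (auto simp: w_def)
  then have w: "w \<in> M K" unfolding e_def comb_axis .
  define u where "u = v - w"
  have "u \<in> P3" by (auto simp: u_def w_def P3_def ps)
  moreover have "lev M v + 1 \<le> K" unfolding v(2) by presburger
  then have "w \<in> M (lev M v)" "w \<in> M (lev M v + 1)"
    using w antimono[of "lev M v + 1" K] antimono[of "lev M v" K] by auto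
  then have *: "u \<in> M (lev M v)" "u \<notin> M (lev M v + 1)"
    using add_mem_iff[of w "lev M v" u] add_mem_iff[of w "lev M v + 1" u] mem_iff[OF v(1)]
    unfolding u_def diff_add_cancel by simp_all
  then have "lev M u = lev M v" by (rule lev_eqI)
  moreover have "u \<noteq> 0" using * zero_mem by metis
  moreover have "lev M v mod 3 = r mod 3" unfolding v(2) by simp
  ultimately show ?thesis by metis
qed

lemma ex_P3_max:
  "\<exists>v\<in>P3. v \<noteq> 0 \<and> lev M v mod 3 = r mod 3 \<and>
     (\<forall>w\<in>P3. w \<noteq> 0 \<longrightarrow> lev M w mod 3 = r mod 3 \<longrightarrow> lev M w \<le> lev M v)"
proof -
  obtain K where K: "\<And>v. v \<in> P3 \<Longrightarrow> v \<noteq> 0 \<Longrightarrow> lev M v \<le> K" using P3_lev_bounded by blast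
  define Q where "Q v \<longleftrightarrow> v \<in> P3 \<and> v \<noteq> 0 \<and> lev M v mod 3 = r mod 3" for v
  obtain v0 where "Q v0" using ex_P3_residue[of r] by (auto simp: Q_def)
  from ex_has_least_nat[of Q, OF this, of "\<lambda>v. nat (K - lev M v)"]
  obtain v where "Q v" "\<And>w. Q w \<Longrightarrow> nat (K - lev M v) \<le> nat (K - lev M w)" by blast
  moreover from this(1) have "lev M v \<le> K" using K by (simp add: Q_def)
  moreover have "lev M w \<le> K" if "Q w" for w using K that by (simp add: Q_def)
  ultimately have "Q v" "\<And>w. Q w \<Longrightarrow> lev M w \<le> lev M v" by fastforce+
  then show ?thesis unfolding Q_def by blast
qed

text \<open>Grothendieck splitting: in each residue class modulo 3 take a polynomial vector of maximal
  level.  Reducing coefficients modulo polynomials leaves a polynomial vector all of whose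
  coefficients have positive valuation, which would exceed one of the maxima.\<close>

lemma ex_pframe: "\<exists>a b c. pframe M a b c"
proof -
  obtain a where a': "a \<in> P3" "a \<noteq> 0 \<and> lev M a mod 3 = 1 mod 3 \<and>
      (\<forall>w\<in>P3. w \<noteq> 0 \<longrightarrow> lev M w mod 3 = 1 mod 3 \<longrightarrow> lev M w \<le> lev M a)"
    using ex_P3_max[of 1] by (rule bexE)
  have a: "a \<in> P3" "a \<noteq> 0" "lev M a mod 3 = 1"
      "\<And>w. w \<in> P3 \<Longrightarrow> w \<noteq> 0 \<Longrightarrow> lev M w mod 3 = 1 \<Longrightarrow> lev M w \<le> lev M a"
    using a' by simp_all
  obtain b where b': "b \<in> P3" "b \<noteq> 0 \<and> lev M b mod 3 = 2 mod 3 \<and>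
      (\<forall>w\<in>P3. w \<noteq> 0 \<longrightarrow> lev M w mod 3 = 2 mod 3 \<longrightarrow> lev M w \<le> lev M b)"
    using ex_P3_max[of 2] by (rule bexE)
  have b: "b \<in> P3" "b \<noteq> 0" "lev M b mod 3 = 2"
      "\<And>w. w \<in> P3 \<Longrightarrow> w \<noteq> 0 \<Longrightarrow> lev M w mod 3 = 2 \<Longrightarrow> lev M w \<le> lev M b"
    using b' by simp_all
  obtain c where c': "c \<in> P3" "c \<noteq> 0 \<and> lev M c mod 3 = 0 mod 3 \<and>
      (\<forall>w\<in>P3. w \<noteq> 0 \<longrightarrow> lev M w mod 3 = 0 mod 3 \<longrightarrow> lev M w \<le> lev M c)"
    using ex_P3_max[of 0] by (rule bexE)
  have c: "c \<in> P3" "c \<noteq> 0" "lev M c mod 3 = 0"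
      "\<And>w. w \<in> P3 \<Longrightarrow> w \<noteq> 0 \<Longrightarrow> lev M w mod 3 = 0 \<Longrightarrow> lev M w \<le> lev M c"
    using c' by simp_all
  have f: "frame M a b c" using a b c unfolding frame_def by blast
  have "pbasis a b c" unfolding pbasis_def
  proof (intro conjI ballI)
    fix v :: "'k fls ^ 3" assume v: "v \<in> P3"
    obtain x y z where *: "v = comb a b c x y z" using fbasis_ex[OF frame_basis[OF f]] by blast
    obtain px rx where x: "x = px + rx" "px \<in> poly_ring_t" "rx = 0 \<or> 1 \<le> \<nu> rx" by (rule poly_split)
    obtain py ry where y: "y = py + ry" "py \<in> poly_ring_t" "ry = 0 \<or> 1 \<le> \<nu> ry" by (rule poly_split)
    obtain pz rz where z: "z = pz + rz" "pz \<in> poly_ring_t" "rz = 0 \<or> 1 \<le> \<nu> rz" by (rule poly_split)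
    define u where "u = comb a b c rx ry rz"
    have v_eq: "v = comb a b c px py pz + u" unfolding * u_def comb_add x(1) y(1) z(1) ..
    have "u = v - comb a b c px py pz" unfolding v_eq by simp
    then have u: "u \<in> P3" using P3_diff[OF v P3_comb[OF a(1) b(1) c(1) x(2) y(2) z(2)]] by simp
    have "u = 0"
    proof (rule ccontr)
      assume "u \<noteq> 0"
      with frame_lev[OF f, of rx ry rz]
      consider "rx \<noteq> 0" "lev M u = lev M a + 3 * \<nu> rx" | "ry \<noteq> 0" "lev M u = lev M b + 3 * \<nu> ry"
        | "rz \<noteq> 0" "lev M u = lev M c + 3 * \<nu> rz" unfolding u_def by blast
      then show False
      proof cases
        case 1
        then have "lev M u mod 3 = 1" using a by simp
        then show False using a(4)[OF u \<open>u \<noteq> 0\<close>] 1 x(3) by simp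
      next
        case 2
        then have "lev M u mod 3 = 2" using b by simp
        then show False using b(4)[OF u \<open>u \<noteq> 0\<close>] 2 y(3) by simp
      next
        case 3
        then have "lev M u mod 3 = lev M c mod 3" by (simp only: mod_mult_self2)
        then show False using c(3) c(4)[OF u \<open>u \<noteq> 0\<close>] 3 z(3) by simp
      qed
    qed
    then show "\<exists>x\<in>poly_ring_t. \<exists>y\<in>poly_ring_t. \<exists>z\<in>poly_ring_t. v = comb a b c x y z"
      using v_eq x(2) y(2) z(2) by (metis add.right_neutral)
  qed fact+
  then show ?thesis using f unfolding pframe_def by blast
qed

text \<open>Polynomial coefficients have valuation at most 0, so a polynomial combination cannot
  exceed the basis vector that determines its level. Hence the levels of any splitting basis are the
  maxima of their residue classes and depend on \<open>M\<close> alone.\<close>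

lemma pframe_max:
  assumes "pframe M a b c" "v \<in> P3" "v \<noteq> 0"
  shows "lev M v mod 3 = 1 \<Longrightarrow> lev M v \<le> lev M a"
    "lev M v mod 3 = 2 \<Longrightarrow> lev M v \<le> lev M b"
    "lev M v mod 3 = 0 \<Longrightarrow> lev M v \<le> lev M c"
proof -
  have f: "frame M a b c" and r: "lev M a mod 3 = 1" "lev M b mod 3 = 2" "lev M c mod 3 = 0"
    using assms unfolding pframe_def frame_def by blast+
  obtain x y z where *: "x \<in> poly_ring_t" "y \<in> poly_ring_t" "z \<in> poly_ring_t" "v = comb a b c x y z"
    using assms unfolding pframe_def pbasis_def by blast
  have val: "d \<noteq> 0 \<Longrightarrow> d \<in> poly_ring_t \<Longrightarrow> \<nu> d \<le> 0" for d :: "'k fls" using poly_ring_val by blast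
  from frame_lev[OF f, of x y z] assms(3)
  consider "x \<noteq> 0" "lev M v = lev M a + 3 * \<nu> x" | "y \<noteq> 0" "lev M v = lev M b + 3 * \<nu> y"
    | "z \<noteq> 0" "lev M v = lev M c + 3 * \<nu> z" unfolding *(4)[symmetric] by blast
  then have "(lev M v mod 3 = 1 \<and> lev M v \<le> lev M a) \<or> (lev M v mod 3 = 2 \<and> lev M v \<le> lev M b) \<or>
    (lev M v mod 3 = 0 \<and> lev M v \<le> lev M c)"
  proof cases
    case 1 then show ?thesis using val[OF 1(1) *(1)] r(1) by (simp only: mod_mult_self2) simp
  next
    case 2 then show ?thesis using val[OF 2(1) *(2)] r(2) by (simp only: mod_mult_self2) simp
  next
    case 3 then show ?thesis using val[OF 3(1) *(3)] r(3) by (simp only: mod_mult_self2) simp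
  qed
  then show "lev M v mod 3 = 1 \<Longrightarrow> lev M v \<le> lev M a"
    "lev M v mod 3 = 2 \<Longrightarrow> lev M v \<le> lev M b"
    "lev M v mod 3 = 0 \<Longrightarrow> lev M v \<le> lev M c" by presburger+
qed

lemma pframe_unique:
  assumes "pframe M a b c" "pframe M a' b' c'"
  shows "lev M a = lev M a'" "lev M b = lev M b'" "lev M c = lev M c'"
proof -
  have u: "a \<in> P3" "b \<in> P3" "c \<in> P3" "a' \<in> P3" "b' \<in> P3" "c' \<in> P3"
    "a \<noteq> 0" "b \<noteq> 0" "c \<noteq> 0" "a' \<noteq> 0" "b' \<noteq> 0" "c' \<noteq> 0"
    using assms unfolding pframe_def frame_def pbasis_def by blast+
  have r: "lev M a mod 3 = 1" "lev M b mod 3 = 2" "lev M c mod 3 = 0"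
    "lev M a' mod 3 = 1" "lev M b' mod 3 = 2" "lev M c' mod 3 = 0"
    using assms unfolding pframe_def frame_def by blast+
  show "lev M a = lev M a'" using pframe_max(1)[OF assms(1) u(4) u(10) r(4)] pframe_max(1)[OF assms(2) u(1) u(7) r(1)] by (rule order.antisym[rotated])
  show "lev M b = lev M b'" using pframe_max(2)[OF assms(1) u(5) u(11) r(5)] pframe_max(2)[OF assms(2) u(2) u(8) r(2)] by (rule order.antisym[rotated])
  show "lev M c = lev M c'" using pframe_max(3)[OF assms(1) u(6) u(12) r(6)] pframe_max(3)[OF assms(2) u(3) u(9) r(3)] by (rule order.antisym[rotated])
qed

end

section \<open>Group action and index shift\<close>

definition act :: "'k::field fls ^ 3 ^ 3 \<Rightarrow> (int \<Rightarrow> ('k fls ^ 3) set) \<Rightarrow> int \<Rightarrow> ('k fls ^ 3) set" where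
  "act A M = (\<lambda>n. (*v) A ` M n)"

text \<open>A shift by 3 is a homothety and invisible to vertices; a shift by 1 passes to the next
  vertex as base point, which is the re-pointing half of an edge-adjacent step.\<close>

definition shift :: "int \<Rightarrow> (int \<Rightarrow> 'v set) \<Rightarrow> int \<Rightarrow> 'v set" where
  "shift k M = (\<lambda>n. M (n + k))"

lemma shift_chain: "lattice_chain M \<Longrightarrow> lattice_chain (shift k M)"
proof -
  assume "lattice_chain M"
  then interpret lattice_chain M .
  show ?thesis
  proof (rule lattice_chain.intro)
    fix n v w and c :: "'a fls"
    show "0 \<in> shift k M n" by (simp add: shift_def)
    show "v \<in> shift k M n \<Longrightarrow> w \<in> shift k M n \<Longrightarrow> v + w \<in> shift k M n" by (simp add: shift_def add_mem)
    show "c \<noteq> 0 \<Longrightarrow> (c *s v \<in> shift k M (n + 3 * \<nu> c)) = (v \<in> shift k M n)"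
      using scale_mem[of c v "n + k"] by (simp add: shift_def ac_simps)
    show "shift k M (n + 1) \<subset> shift k M n" using strict[of "n + k"] by (simp add: shift_def ac_simps)
    show "\<exists>n. v \<in> shift k M n" using exhaust[of v] unfolding shift_def by (metis diff_add_cancel)
    show "v \<noteq> 0 \<Longrightarrow> \<exists>n. v \<notin> shift k M n" using separated[of v] unfolding shift_def by (metis diff_add_cancel)
  qed
qed

lemma lev_shift:
  assumes "lattice_chain M" "v \<noteq> 0"
  shows "lev (shift k M) v = lev M v - k"
proof -
  interpret lattice_chain M by fact
  interpret s: lattice_chain "shift k M" by (rule shift_chain) fact
  show ?thesis by (rule s.lev_eqI) (simp_all add: shift_def mem_iff[OF assms(2)])
qed

lemma act_mem:
  assumes "A ** B = mat 1" "B ** A = mat 1"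
  shows "w \<in> act A M n \<longleftrightarrow> B *v w \<in> M n"
proof
  assume "w \<in> act A M n"
  then show "B *v w \<in> M n" using assms(2) by (auto simp: act_def matrix_vector_mul_assoc)
next
  assume "B *v w \<in> M n"
  moreover have "w = A *v (B *v w)" using assms(1) by (simp add: matrix_vector_mul_assoc)
  ultimately show "w \<in> act A M n" unfolding act_def by (rule rev_image_eqI)
qed

lemma act_chain:
  assumes "lattice_chain M" "A ** B = mat 1" "B ** A = mat 1"
  shows "lattice_chain (act A M)"
proof -
  interpret lattice_chain M by fact
  note mem = act_mem[OF assms(2,3), of _ M]
  show ?thesis
  proof (rule lattice_chain.intro)
    fix n v w and c :: "'a fls"
    show "0 \<in> act A M n" by (simp add: mem)
    show "v \<in> act A M n \<Longrightarrow> w \<in> act A M n \<Longrightarrow> v + w \<in> act A M n"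
      by (simp add: mem add_mem matrix_vector_right_distrib)
    show "c \<noteq> 0 \<Longrightarrow> (c *s v \<in> act A M (n + 3 * \<nu> c)) = (v \<in> act A M n)"
      using scale_mem[of c "B *v v" n] by (simp add: mem vec.scale)
    show "act A M (n + 1) \<subset> act A M n"
    proof -
      have "inj ((*v) A)" using assms(3) by (metis matrix_left_invertible_injective)
      then show ?thesis unfolding act_def using strict[of n] by (simp add: image_strict_mono inj_on_subset)
    qed
    show "\<exists>n. v \<in> act A M n" using exhaust by (simp add: mem)
    have "B *v v = 0 \<Longrightarrow> v = 0" using assms(2) by (metis matrix_left_invertible_ker)
    then show "v \<noteq> 0 \<Longrightarrow> \<exists>n. v \<notin> act A M n" using separated[of "B *v v"] by (auto simp: mem)
  qed
qed

lemma lev_act: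
  assumes "lattice_chain M" "A ** B = mat 1" "B ** A = mat 1" "v \<noteq> 0"
  shows "lev (act A M) (A *v v) = lev M v" "A *v v \<noteq> 0"
proof -
  interpret lattice_chain M by fact
  interpret a: lattice_chain "act A M" by (rule act_chain) fact+
  have [simp]: "B *v (A *v v) = v" using assms by (simp add: matrix_vector_mul_assoc)
  show "lev (act A M) (A *v v) = lev M v"
    by (rule a.lev_eqI) (simp_all add: act_mem[OF assms(2,3)] mem_iff[OF assms(4)])
  show "A *v v \<noteq> 0" using \<open>B *v (A *v v) = v\<close> assms(4) by (metis matrix_vector_mult_0_right)
qed

lemma GL3E:
  assumes "A \<in> GL3 R"
  obtains B where "B \<in> GL3 R" "A ** B = mat 1" "B ** A = mat 1"
  using assms unfolding GL3_def by blast

lemma GL3_P3: "A \<in> GL3 poly_ring_t \<Longrightarrow> v \<in> P3 \<Longrightarrow> A *v v \<in> P3"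
  unfolding GL3_def P3_def matrix_vector_mult_def
  by (simp add: sum_3 poly_ring_add poly_ring_mult)

lemma comb_act: "A *v comb a b c x y z = comb (A *v a) (A *v b) (A *v c) x y z"
  by (simp add: comb_def matrix_vector_right_distrib vec.scale)

lemma pbasis_act:
  assumes "A \<in> GL3 poly_ring_t" "pbasis a b c"
  shows "pbasis (A *v a) (A *v b) (A *v c)"
  unfolding pbasis_def
proof (intro conjI ballI)
  obtain B where B: "B \<in> GL3 poly_ring_t" "A ** B = mat 1" using assms(1) by (rule GL3E)
  fix v :: "'a fls ^ 3" assume "v \<in> P3"
  then obtain x y z where *: "x \<in> poly_ring_t" "y \<in> poly_ring_t" "z \<in> poly_ring_t" "B *v v = comb a b c x y z"
    using GL3_P3[OF B(1)] assms(2) unfolding pbasis_def by blast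
  have "v = A *v (B *v v)" using B(2) by (simp add: matrix_vector_mul_assoc)
  then have "v = comb (A *v a) (A *v b) (A *v c) x y z" unfolding *(4) comb_act .
  then show "\<exists>x\<in>poly_ring_t. \<exists>y\<in>poly_ring_t. \<exists>z\<in>poly_ring_t. v = comb (A *v a) (A *v b) (A *v c) x y z"
    using * by blast
qed (use assms in \<open>auto simp: pbasis_def intro: GL3_P3\<close>)

lemma pframe_act:
  assumes "lattice_chain M" "A \<in> GL3 poly_ring_t" "pframe M a b c"
  shows "pframe (act A M) (A *v a) (A *v b) (A *v c)"
    "lev (act A M) (A *v a) = lev M a" "lev (act A M) (A *v b) = lev M b" "lev (act A M) (A *v c) = lev M c"
proof -
  obtain B where B: "A ** B = mat 1" "B ** A = mat 1" using assms(2) by (rule GL3E)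
  have nz: "a \<noteq> 0" "b \<noteq> 0" "c \<noteq> 0" using assms(3) unfolding pframe_def frame_def by blast+
  note l = lev_act[OF assms(1) B]
  show *: "lev (act A M) (A *v a) = lev M a" "lev (act A M) (A *v b) = lev M b" "lev (act A M) (A *v c) = lev M c"
    using l nz by blast+
  have "pbasis (A *v a) (A *v b) (A *v c)" using assms unfolding pframe_def by (intro pbasis_act) blast+
  then show "pframe (act A M) (A *v a) (A *v b) (A *v c)"
    using assms(3) l(2) nz unfolding pframe_def frame_def * by blast
qed

section \<open>A complete invariant of chains\<close>

definition levels :: "(int \<Rightarrow> ('k::field fls ^ 3) set) \<Rightarrow> int \<times> int \<times> int" where
  "levels M = (SOME t. \<exists>a b c. pframe M a b c \<and> t = (lev M a, lev M b, lev M c))"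

text \<open>For levels \<open>3 * x + 1\<close>, \<open>3 * y + 2\<close>, \<open>3 * z\<close> the
  value is \<open>(z - y, x - y)\<close>; the added constants cancel the residues. Differences are
  taken because a common multiple of 3 is a homothety. The first entry is positive exactly when the
  third level exceeds the second, which is the case distinction in \<open>wt\<close>.\<close>

definition st :: "(int \<Rightarrow> ('k::field fls ^ 3) set) \<Rightarrow> int \<times> int" where
  "st M = (case levels M of (n1, n2, n3) \<Rightarrow> ((n3 - n2 + 2) div 3, (n1 - n2 + 1) div 3))"

lemma levels_eq:
  assumes "lattice_chain M" "pframe M a b c"
  shows "levels M = (lev M a, lev M b, lev M c)"
proof -
  interpret lattice_chain M by fact
  have "\<exists>a' b' c'. pframe M a' b' c' \<and> levels M = (lev M a', lev M b', lev M c')"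
    unfolding levels_def by (rule someI_ex) (use assms in blast)
  then show ?thesis using pframe_unique[OF assms(2)] by (metis (no_types))
qed

lemma pframe_mod: "pframe M a b c \<Longrightarrow> lev M a mod 3 = 1 \<and> lev M b mod 3 = 2 \<and> lev M c mod 3 = 0"
  unfolding pframe_def frame_def by blast

lemma pframe_nz: "pframe M a b c \<Longrightarrow> a \<noteq> 0 \<and> b \<noteq> 0 \<and> c \<noteq> 0"
  unfolding pframe_def frame_def by blast

lemma st_eq:
  "lattice_chain M \<Longrightarrow> pframe M a b c \<Longrightarrow>
     st M = ((lev M c - lev M b + 2) div 3, (lev M a - lev M b + 1) div 3)"
  by (simp add: st_def levels_eq)

lemma st_act: "lattice_chain M \<Longrightarrow> A \<in> GL3 poly_ring_t \<Longrightarrow> st (act A M) = st M"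
proof -
  assume M: "lattice_chain M" and A: "A \<in> GL3 poly_ring_t"
  obtain B where B: "A ** B = mat 1" "B ** A = mat 1" using A by (rule GL3E)
  obtain a b c where f: "pframe M a b c" using lattice_chain.ex_pframe[OF M] by blast
  show ?thesis
    using st_eq[OF act_chain[OF M B] pframe_act(1)[OF M A f]] st_eq[OF M f] pframe_act(2-)[OF M A f] by simp
qed

lemma pframe_shift3:
  assumes M: "lattice_chain M" and f: "pframe M a b c"
  shows "pframe (shift (3 * k) M) a b c"
proof -
  have "(n - 3 * k) mod 3 = n mod 3" for n :: int by presburger
  then show ?thesis
    using f pframe_nz[OF f] pframe_mod[OF f]
    unfolding pframe_def frame_def by (simp only: lev_shift[OF M] simp_thms)
qed

lemma st_shift3: "lattice_chain M \<Longrightarrow> st (shift (3 * k) M) = st M"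
proof -
  assume M: "lattice_chain M"
  obtain a b c where f: "pframe M a b c" using lattice_chain.ex_pframe[OF M] by blast
  show ?thesis
    using st_eq[OF shift_chain[OF M] pframe_shift3[OF M f], of k] st_eq[OF M f] pframe_nz[OF f]
    by (simp add: lev_shift M)
qed

text \<open>Lowering all levels by 1 turns the residues 1, 2, 0 into 0, 1, 2, so the basis has to be
  rotated.\<close>

lemma pframe_shift1: "lattice_chain M \<Longrightarrow> pframe M a b c \<Longrightarrow> pframe (shift 1 M) b c a"
proof -
  assume M: "lattice_chain M" and f: "pframe M a b c"
  have "(n - 1) mod 3 = 0" if "n mod 3 = 1" for n :: int using that by presburger
  moreover have "(n - 1) mod 3 = 1" if "n mod 3 = 2" for n :: int using that by presburger
  moreover have "(n - 1) mod 3 = 2" if "n mod 3 = 0" for n :: int using that by presburger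
  ultimately show ?thesis
    using f pframe_nz[OF f] pframe_mod[OF f] pbasis_rot[of a b c]
    unfolding pframe_def frame_def by (simp only: lev_shift[OF M] simp_thms)
qed

lemma st_shift1:
  assumes M: "lattice_chain M" and f: "pframe M a b c"
  shows "st (shift 1 M) = ((lev M a - lev M c + 2) div 3, (lev M b - lev M c + 1) div 3)"
  using st_eq[OF shift_chain[OF M] pframe_shift1[OF M f]] pframe_nz[OF f] by (simp add: lev_shift M)

lemma residues_decode:
  fixes n1 n2 n3 m1 m2 m3 k :: int
  assumes "n1 mod 3 = 1" "n2 mod 3 = 2" "n3 mod 3 = 0" "m1 mod 3 = 1" "m2 mod 3 = 2" "m3 mod 3 = 0"
    and "(n3 - n2 + 2) div 3 = (m3 - m2 + 2) div 3" "(n1 - n2 + 1) div 3 = (m1 - m2 + 1) div 3"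
    and "m1 = n1 + 3 * k"
  shows "m2 = n2 + 3 * k" "m3 = n3 + 3 * k"
proof -
  define a b c a' b' c' where abc: "a = n1 div 3" "b = n2 div 3" "c = n3 div 3" "a' = m1 div 3" "b' = m2 div 3" "c' = m3 div 3"
  have n: "n1 = 3 * a + 1" "n2 = 3 * b + 2" "n3 = 3 * c" "m1 = 3 * a' + 1" "m2 = 3 * b' + 2" "m3 = 3 * c'"
    using mult_div_mod_eq[of 3 n1] mult_div_mod_eq[of 3 n2] mult_div_mod_eq[of 3 n3]
      mult_div_mod_eq[of 3 m1] mult_div_mod_eq[of 3 m2] mult_div_mod_eq[of 3 m3] assms(1-6)
    unfolding abc by linarith+
  have "n3 - n2 + 2 = 3 * (c - b)" "n1 - n2 + 1 = 3 * (a - b)"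
    "m3 - m2 + 2 = 3 * (c' - b')" "m1 - m2 + 1 = 3 * (a' - b')"
    unfolding n by (simp_all add: algebra_simps)
  then have "3 * (c - b) div 3 = 3 * (c' - b') div 3" "3 * (a - b) div 3 = 3 * (a' - b') div 3"
    using assms(7,8) by metis+
  then have "c - b = c' - b'" "a - b = a' - b'" by (simp_all only: nonzero_mult_div_cancel_left zero_neq_numeral[symmetric] not_False_eq_True)
  then show "m2 = n2 + 3 * k" "m3 = n3 + 3 * k" using assms(9) unfolding n by linarith+
qed

text \<open>The matrix taking one polynomial splitting basis to another is invertible over the
  polynomials. Equal invariants make the three levels differ by one common multiple of 3, so this
  matrix carries one chain to a shift of the other.\<close>

lemma st_eq_imp:
  assumes M: "lattice_chain M" and M': "lattice_chain M'" and st: "st M = st M'"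
  shows "\<exists>A\<in>GL3 poly_ring_t. \<exists>k. act A M = shift (3 * k) M'"
proof -
  obtain a b c where f: "pframe M a b c" using lattice_chain.ex_pframe[OF M] by blast
  obtain a' b' c' where f': "pframe M' a' b' c'" using lattice_chain.ex_pframe[OF M'] by blast
  obtain C where C: "C \<in> GL3 poly_ring_t" "cols a b c ** C = mat 1" "C ** cols a b c = mat 1"
    using f pbasis_GL3 GL3E unfolding pframe_def by metis
  have C': "cols a' b' c' \<in> GL3 poly_ring_t" using f' pbasis_GL3 unfolding pframe_def by metis
  obtain D where D: "D \<in> GL3 poly_ring_t" "cols a' b' c' ** D = mat 1" "D ** cols a' b' c' = mat 1"
    using C' by (rule GL3E)
  define A where "A = cols a' b' c' ** C"
  define B where "B = cols a b c ** D"
  have entry: "(U ** V) $ i $ j \<in> poly_ring_t" if "U \<in> GL3 poly_ring_t" "V \<in> GL3 poly_ring_t"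
    for U V :: "'a fls ^ 3 ^ 3" and i j
    using that by (simp add: GL3_def matrix_matrix_mult_def sum_3 poly_ring_add poly_ring_mult)
  have AB: "A ** B = mat 1" "B ** A = mat 1"
    unfolding A_def B_def using C D
    by (metis matrix_mul_assoc matrix_mul_rid)+
  have abc: "cols a b c \<in> GL3 poly_ring_t" using f pbasis_GL3 unfolding pframe_def by metis
  have "\<forall>i j. A $ i $ j \<in> poly_ring_t" "\<forall>i j. B $ i $ j \<in> poly_ring_t"
    using entry[OF C' C(1)] entry[OF abc D(1)] unfolding A_def B_def by blast+
  then have A: "A \<in> GL3 poly_ring_t" using AB unfolding GL3_def by blast
  have colsv: "cols a b c *v axis 1 1 = a" "cols a b c *v axis 2 1 = b" "cols a b c *v axis 3 1 = c" for a b c :: "'a fls ^ 3"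
    by (simp_all add: cols_mult comb_def axis_def)
  have Av: "A *v a = a'" "A *v b = b'" "A *v c = c'"
  proof -
    have "A ** cols a b c = cols a' b' c'"
      unfolding A_def matrix_mul_assoc[symmetric] C(3) by (rule matrix_mul_rid)
    then have "A *v (cols a b c *v v) = cols a' b' c' *v v" for v by (simp add: matrix_vector_mul_assoc)
    from this[of "axis 1 1"] this[of "axis 2 1"] this[of "axis 3 1"]
    show "A *v a = a'" "A *v b = b'" "A *v c = c'" unfolding colsv by blast+
  qed
  define k where "k = (lev M' a' - lev M a) div 3"
  note m = pframe_mod[OF f] pframe_mod[OF f']
  have k: "lev M' a' = lev M a + 3 * k" unfolding k_def using conjunct1[OF m(1)] conjunct1[OF m(2)] by presburger
  have "(lev M c - lev M b + 2) div 3 = (lev M' c' - lev M' b' + 2) div 3"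
    "(lev M a - lev M b + 1) div 3 = (lev M' a' - lev M' b' + 1) div 3"
    using st st_eq[OF M f] st_eq[OF M' f'] by simp_all
  then have k': "lev M' b' = lev M b + 3 * k" "lev M' c' = lev M c + 3 * k"
    using residues_decode[of "lev M a" "lev M b" "lev M c" "lev M' a'" "lev M' b'" "lev M' c'" k] m k by blast+
  have "act A M = shift (3 * k) M'"
  proof (rule chain_eqI)
    show "lattice_chain (act A M)" by (rule act_chain[OF M AB])
    show "lattice_chain (shift (3 * k) M')" by (rule shift_chain[OF M'])
    note p = pframe_act[OF M A f]
    show "frame (act A M) a' b' c'" using p(1) unfolding Av pframe_def by blast
    show "lev (shift (3 * k) M') a' = lev (act A M) a'" "lev (shift (3 * k) M') b' = lev (act A M) b'"
      "lev (shift (3 * k) M') c' = lev (act A M) c'"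
      using p(2-4) pframe_nz[OF f'] unfolding Av by (simp_all add: lev_shift[OF M'] k k')
  qed
  then show ?thesis using A by blast
qed

lemma pbasis_axis: "pbasis (axis 1 1) (axis 2 1) (axis 3 1)"
  unfolding pbasis_def
proof (intro conjI ballI)
  fix v :: "'a fls ^ 3" assume "v \<in> P3"
  then have "v $ i \<in> poly_ring_t" for i by (simp add: P3_def)
  then show "\<exists>x\<in>poly_ring_t. \<exists>y\<in>poly_ring_t. \<exists>z\<in>poly_ring_t. v = comb (axis 1 1) (axis 2 1) (axis 3 1) x y z"
    using comb_axis[of v, symmetric] by blast
qed (auto simp: P3_def axis_def)

lemma fbasis_axis: "fbasis (axis 1 1) (axis 2 1) (axis 3 (1 :: 'f::field))"
proof (rule fbasisI)
  fix x y z :: 'f assume *: "comb (axis 1 1) (axis 2 1) (axis 3 1) x y z = 0"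
  show "x = 0 \<and> y = 0 \<and> z = 0"
    using arg_cong[OF *, of "\<lambda>v :: 'f ^ 3. v $ 1"] arg_cong[OF *, of "\<lambda>v :: 'f ^ 3. v $ 2"] arg_cong[OF *, of "\<lambda>v :: 'f ^ 3. v $ 3"]
    by (simp add: comb_def axis_def)
qed

lemma st_surj: "\<exists>M :: int \<Rightarrow> ('k::field fls ^ 3) set. lattice_chain M \<and> st M = (p, r)"
proof -
  define M :: "int \<Rightarrow> ('k fls ^ 3) set" where
    "M = fchain (axis 1 1) (axis 2 1) (axis 3 1) (3 * r + 1) 2 (3 * p)"
  have m: "(3 * r + 1) mod 3 = 1" "(2::int) mod 3 = 2" "(3 * p) mod 3 = 0" by presburger+
  have M: "lattice_chain M" unfolding M_def by (rule fchain_chain[OF fbasis_axis m])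
  note f = fchain_frame[OF fbasis_axis m, where 'a = 'k, folded M_def]
  have "pframe M (axis 1 1) (axis 2 1) (axis 3 1)" using f(1) pbasis_axis unfolding pframe_def by blast
  from st_eq[OF M this] have "st M = (p, r)" unfolding f by simp
  then show ?thesis using M by blast
qed

text \<open>A tailless step keeps the second and third lattice of the chamber and replaces
  \<open>M 3\<close>. As \<open>M 3\<close> is homothetic to \<open>M 0\<close>, the inequality says
  that the new vertex is not the old first one. The base point moves on only with the later
  \<open>shift 1\<close>.\<close>

definition nbrs :: "(int \<Rightarrow> ('k::field fls ^ 3) set) \<Rightarrow> (int \<Rightarrow> ('k fls ^ 3) set) set" where
  "nbrs M = {M'. lattice_chain M' \<and> M' 1 = M 1 \<and> M' 2 = M 2 \<and> M' 3 \<noteq> M 3}"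

text \<open>Read off from \<open>nb_st\<close>: for \<open>0 < p\<close> all \<open>q\<close>
  neighbours lie in one orbit; otherwise one of them is singled out and the other
  \<open>q - 1\<close> share an orbit. The two targets are then distinct, since
  \<open>p - 1 < 1 - p\<close>.\<close>

definition wt :: "nat \<Rightarrow> int \<times> int \<Rightarrow> int \<times> int \<Rightarrow> nat" where
  "wt q y z = (case y of (p, r) \<Rightarrow>
     if 0 < p then (if z = (r, p - 1) then q else 0)
     else if z = (r, p - 1) then 1
     else if z = (r - p + 1, 1 - p) then q - 1 else 0)"

lemma chain_agree_mod3:
  assumes "lattice_chain M" "lattice_chain M'" "M' m = M m" "n mod 3 = m mod 3"
  shows "M' n = M n"
proof -
  interpret M: lattice_chain M by fact
  interpret M': lattice_chain M' by fact
  define k where "k = (n - m) div 3"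
  have n: "n = m + 3 * k" using assms(4) unfolding k_def by presburger
  show ?thesis unfolding n
    by (intro set_eqI) (simp only: M.mem_shift3 M'.mem_shift3 assms(3))
qed

section \<open>Tailless neighbours in coordinates\<close>

locale pframed_chain = lattice_chain M for M :: "int \<Rightarrow> ('k::field fls ^ 3) set" +
  fixes a b c :: "'k fls ^ 3"
  assumes pf: "pframe M a b c"
begin

text \<open>Put \<open>B = lev M c\<close>. The quotient of \<open>M (B - 1)\<close> by
  \<open>M (B + 1)\<close> is a plane over the residue field, spanned by \<open>c\<close> and by
  \<open>f\<close>, the multiple of \<open>b\<close> at level \<open>B - 1\<close>. There
  \<open>M B\<close> is the line of \<open>c\<close>; the other \<open>q\<close> lines are those of
  the vectors \<open>g s\<close>, and \<open>nb s\<close> is the chain with such a line in place of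
  \<open>M B\<close>.\<close>

definition j :: int where "j = (lev M c - 1 - lev M b) div 3"
definition f :: "'k fls ^ 3" where "f = \<pi>p j *s b"
definition g :: "'k \<Rightarrow> 'k fls ^ 3" where "g s = f + fls_const s *s c"
definition nb :: "'k \<Rightarrow> int \<Rightarrow> ('k fls ^ 3) set" where
  "nb s = fchain a c (g s) (lev M a) (lev M c - 1) (lev M c)"

lemma nz: "a \<noteq> 0" "b \<noteq> 0" "c \<noteq> 0"
  using pframe_nz[OF pf] by auto

lemma res: "lev M a mod 3 = 1" "lev M b mod 3 = 2" "lev M c mod 3 = 0"
  using pframe_mod[OF pf] by auto

lemma j: "lev M c - 1 = lev M b + 3 * j"
proof -
  have "m - 1 = n + 3 * ((m - 1 - n) div 3)" if "m mod 3 = 0" "n mod 3 = 2" for m n :: int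
    using that by presburger
  from this[OF res(3) res(2)] show ?thesis unfolding j_def .
qed

lemma f_lev: "f \<noteq> 0" "lev M f = lev M c - 1"
  using nz(2) j by (auto simp: f_def lev_scale)

lemma g_lev: "g s \<noteq> 0" "lev M (g s) = lev M c - 1"
proof -
  have "g s \<noteq> 0 \<and> lev M (g s) = lev M c - 1"
  proof (cases "s = 0")
    case True
    then show ?thesis using f_lev by (simp add: g_def)
  next
    case False
    then have s: "fls_const s \<noteq> 0" by simp
    then have "fls_const s *s c \<noteq> 0" using nz(3) by simp
    moreover have "lev M (fls_const s *s c) = lev M c" using lev_scale[OF s nz(3)] by simp
    ultimately show ?thesis using lev_add[of f "fls_const s *s c"] f_lev by (simp add: g_def)
  qed
  then show "g s \<noteq> 0" "lev M (g s) = lev M c - 1" by auto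
qed

lemma res': "(lev M c - 1) mod 3 = 2"
proof -
  have "(m - 1) mod 3 = 2" if "m mod 3 = 0" for m :: int using that by presburger
  from this[OF res(3)] show ?thesis .
qed

lemma frame_f: "frame M a f c"
  using nz res res' f_lev unfolding frame_def by simp

lemma frame_g: "frame M a (g s) c"
  using nz res res' g_lev unfolding frame_def by simp

lemma fbasis_swap: "fbasis x y z \<Longrightarrow> fbasis x z y"
proof -
  have "comb x y z u v w = comb x z y u w v" for u v w by (simp add: comb_def)
  then show "fbasis x y z \<Longrightarrow> fbasis x z y" unfolding fbasis_def by metis
qed

lemma fb: "fbasis a c (g s)"
  by (rule fbasis_swap[OF frame_basis[OF frame_g]])

lemma nb_chain: "lattice_chain (nb s)"
  unfolding nb_def by (rule fchain_chain[OF fb res(1) res' res(3)])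

lemma nb_frame: "frame (nb s) a c (g s)" and nb_lev: "lev (nb s) a = lev M a"
  "lev (nb s) c = lev M c - 1" "lev (nb s) (g s) = lev M c"
  using fchain_frame[OF fb res(1) res' res(3), of s] unfolding nb_def by blast+

text \<open>The levels of \<open>c\<close> and \<open>g s\<close> are exchanged between
  \<open>lev M c\<close> and \<open>lev M c - 1\<close>, and only an index congruent to
  \<open>lev M c\<close>, that is to 0, can tell these apart.\<close>

lemma nb_same:
  assumes k: "k mod 3 \<noteq> 0"
  shows "nb s k = M k"
proof (rule set_eqI)
  fix v
  obtain x y z where v: "v = comb a (g s) c x y z" using fbasis_ex[OF frame_basis[OF frame_g]] by blast
  have v': "v = comb a c (g s) x z y" unfolding v by (simp add: comb_def)
  have ar: "k \<le> m + 3 * t \<longleftrightarrow> k \<le> m - 1 + 3 * t" if "m mod 3 = 0" for m t using k that by presburger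
  show "v \<in> nb s k \<longleftrightarrow> v \<in> M k"
    unfolding v' nb_def fchain_mem[OF fb]
    unfolding v'[symmetric] v frame_mem'[OF frame_g] g_lev ar[OF res(3)] by blast
qed

lemma nb_not_mem: "c \<notin> nb s (lev M c)"
  using lattice_chain.mem_iff[OF nb_chain nz(3), of s "lev M c"] by (simp add: nb_lev)

lemma nb_nbrs: "nb s \<in> nbrs M"
proof -
  have "nb s 3 \<noteq> M 3"
  proof
    assume "nb s 3 = M 3"
    then have "nb s (lev M c) = M (lev M c)"
      by (rule chain_agree_mod3[OF lattice_chain_axioms nb_chain]) (use res in simp)
    then show False using nb_not_mem[of s] mem_iff[OF nz(3)] by auto
  qed
  then show ?thesis unfolding nbrs_def using nb_chain nb_same[of 1 s] nb_same[of 2 s] by simp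
qed

text \<open>If two slopes gave the same chain, a nonzero constant multiple of \<open>c\<close> would
  reach the level from which \<open>c\<close> has been displaced.\<close>

lemma nb_inj: "inj nb"
proof (rule injI, rule ccontr)
  fix s s' assume eq: "nb s = nb s'" and ne: "s \<noteq> s'"
  interpret n: lattice_chain "nb s" by (rule nb_chain)
  have "g s \<in> nb s (lev M c)" "g s' \<in> nb s (lev M c)"
    using n.mem_iff[of "g s" "lev M c"] n.mem_iff[of "g s'" "lev M c"] g_lev(1) nb_lev(3)[of s] nb_lev(3)[of s'] eq by auto
  then have "g s - g s' \<in> nb s (lev M c)" by (rule n.diff_mem)
  moreover have "g s - g s' = fls_const (s - s') *s c"
    by (simp add: g_def vec_eq_iff algebra_simps flip: fls_minus_const)
  moreover have "fls_const (s - s') \<noteq> 0" using ne by simp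
  ultimately have "lev M c \<le> lev (nb s) c + 3 * \<nu> (fls_const (s - s'))"
    using n.scale_mem_iff[of "fls_const (s - s')" c "lev M c"] nz(3) by simp
  then show False unfolding nb_lev by simp
qed

text \<open>Modulo \<open>M (?B + 1)\<close> the lattice \<open>M' ?B\<close> is a line in the plane
  of \<open>f\<close> and \<open>c\<close>, different from the line of \<open>c\<close>. Normalising
  the coefficient of \<open>f\<close> to 1 leaves the slope \<open>s\<close>.\<close>

lemma nbrs_complete:
  assumes M': "M' \<in> nbrs M"
  shows "\<exists>s. M' = nb s"
proof -
  let ?B = "lev M c"
  have ch: "lattice_chain M'" and ne: "M' 3 \<noteq> M 3" using M' unfolding nbrs_def by blast+
  interpret n: lattice_chain M' by fact
  have same: "M' k = M k" if "k mod 3 \<noteq> 0" for k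
  proof -
    have M12: "M' 1 = M 1" "M' 2 = M 2" using M' unfolding nbrs_def by blast+
    from that consider "k mod 3 = 1" | "k mod 3 = 2" by linarith
    then show ?thesis
    proof cases
      case 1 then show ?thesis by (intro chain_agree_mod3[OF lattice_chain_axioms ch M12(1)]) simp
    next
      case 2 then show ?thesis by (intro chain_agree_mod3[OF lattice_chain_axioms ch M12(2)]) simp
    qed
  qed
  have mods: "?B mod 3 = 0" "(?B - 1) mod 3 \<noteq> 0" "(?B + 1) mod 3 \<noteq> 0"
    "lev M a mod 3 \<noteq> 0" "(lev M a + 1) mod 3 \<noteq> 0" 
  proof -
    have 1: "(m - 1) mod 3 \<noteq> 0" "(m + 1) mod 3 \<noteq> 0" if "m mod 3 = 0" for m :: int using that by presburger+
    have 2: "m mod 3 \<noteq> 0" "(m + 1) mod 3 \<noteq> 0" if "m mod 3 = 1" for m :: int using that by presburger+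
    show "?B mod 3 = 0" "(?B - 1) mod 3 \<noteq> 0" "(?B + 1) mod 3 \<noteq> 0"
      "lev M a mod 3 \<noteq> 0" "(lev M a + 1) mod 3 \<noteq> 0" by (fact res(3) 1[OF res(3)] 2[OF res(1)])+
  qed
  have Bm: "M' (?B - 1) = M (?B - 1)" and Bp: "M' (?B + 1) = M (?B + 1)" by (fact same[OF mods(2)] same[OF mods(3)])+
  have sub: "M (?B + 1) \<subseteq> M' ?B" using n.antimono[of ?B "?B + 1"] Bp by simp
  have la: "lev M' a = lev M a"
    by (rule n.lev_eqI) (simp_all add: same[OF mods(4)] same[OF mods(5)] mem_iff[OF nz(1)])
  have upto: "lev M' v = ?B - 1" if "v \<in> M (?B - 1)" "v \<notin> M' ?B" for v
    by (rule n.lev_eqI) (use that Bm in simp_all)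
  \<comment> \<open>Multiples of \<open>a\<close> have level 1 modulo 3, so from level
    \<open>?B - 1\<close> on they are already at level \<open>?B + 1\<close>.\<close>
  have split: "x *s a \<in> M (?B + 1) \<and> 0 \<le> \<nu> y \<and> 0 \<le> \<nu> z"
    if "comb a f c x y z \<in> M (?B - 1)" for x y z
  proof -
    have "(x = 0 \<or> ?B - 1 \<le> lev M a + 3 * \<nu> x)" "y = 0 \<or> ?B - 1 \<le> ?B - 1 + 3 * \<nu> y"
      "z = 0 \<or> ?B - 1 \<le> ?B + 3 * \<nu> z"
      using that unfolding frame_mem'[OF frame_f] f_lev by blast+
    moreover have up: "m + 1 \<le> n + 3 * t" if "m mod 3 = 0" "n mod 3 = 1" "m - 1 \<le> n + 3 * t" for m n t :: int
      using that by presburger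
    moreover have "x = 0 \<or> ?B + 1 \<le> lev M a + 3 * \<nu> x" using calculation(1) up[OF res(3,1)] by blast
    ultimately show ?thesis
      using scale_mem_iff[of x a "?B + 1"] nz(1) by (cases "x = 0"; cases "y = 0"; cases "z = 0") auto
  qed
  \<comment> \<open>If \<open>c\<close> were still at level \<open>?B\<close>, then either
    \<open>f\<close> would reach that level too and \<open>M' (?B - 1)\<close> would collapse into
    \<open>M' ?B\<close>, or all frame levels would be unchanged and \<open>M'\<close> would equal
    \<open>M\<close>.\<close>
  have cB: "c \<notin> M' ?B"
  proof
    assume c: "c \<in> M' ?B"
    have lc: "lev M' c = ?B" by (rule n.lev_eqI[OF c]) (use Bp mem_iff[OF nz(3)] in simp)
    show False
    proof (cases "f \<in> M' ?B")
      case True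
      have "M (?B - 1) \<subseteq> M' ?B"
      proof
        fix v assume v: "v \<in> M (?B - 1)"
        obtain x y z where *: "v = comb a f c x y z" using fbasis_ex[OF frame_basis[OF frame_f]] by blast
        from split[of x y z] v have "x *s a \<in> M' ?B" "0 \<le> \<nu> y" "0 \<le> \<nu> z" using sub unfolding * by blast+
        then show "v \<in> M' ?B" unfolding * comb_def
          by (intro n.add_mem n.scale_mem_int[OF _ True] n.scale_mem_int[OF _ c])
      qed
      then show False using n.strict[of "?B - 1"] Bm by auto
    next
      case False
      have "f \<in> M (?B - 1)" using f_lev by (simp add: mem_iff)
      then have "lev M' f = ?B - 1" using False by (rule upto)
      then have "M = M'"
        by (intro chain_eqI[OF lattice_chain_axioms ch frame_f]) (simp_all add: la lc f_lev)
      then show False using ne by simp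
    qed
  qed
  have lc: "lev M' c = ?B - 1" by (rule upto[OF _ cB]) (use mem_iff[OF nz(3)] in simp)
  obtain w where w: "w \<noteq> 0" "lev M' w = ?B" using n.ex_lev by blast
  then have wm: "w \<in> M' ?B" "w \<notin> M' (?B + 1)" by (simp_all add: n.mem_iff)
  obtain x y z where wxyz: "w = comb a f c x y z" using fbasis_ex[OF frame_basis[OF frame_f]] by blast
  have "w \<in> M (?B - 1)" using wm(1) n.antimono[of "?B - 1" ?B] Bm by auto
  then have xyz: "x *s a \<in> M (?B + 1)" "0 \<le> \<nu> y" "0 \<le> \<nu> z" using split unfolding wxyz by blast+
  \<comment> \<open>Replacing coefficients by their constant terms changes \<open>w\<close> only
    inside \<open>M (?B + 1)\<close>, which both chains share.\<close>
  obtain y' where y': "y = fls_const (fls_nth y 0) + y'" "y' = 0 \<or> 1 \<le> \<nu> y'" using xyz(2) by (rule residue_split)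
  obtain z' where z': "z = fls_const (fls_nth z 0) + z'" "z' = 0 \<or> 1 \<le> \<nu> z'" using xyz(3) by (rule residue_split)
  define \<alpha> \<beta> where "\<alpha> = fls_nth y 0" and "\<beta> = fls_nth z 0"
  define h where "h = fls_const \<alpha> *s f + fls_const \<beta> *s c"
  have "w = h + comb a f c x y' z'"
    unfolding wxyz h_def \<alpha>_def \<beta>_def by (subst y'(1), subst z'(1)) (simp add: comb_def vec_eq_iff algebra_simps)
  moreover have e: "comb a f c x y' z' \<in> M (?B + 1)"
  proof -
    have "y' *s f \<in> M (?B + 1)" using y'(2) scale_mem_iff[of y' f "?B + 1"] f_lev by (cases "y' = 0") auto
    moreover have "z' *s c \<in> M (?B + 1)" using z'(2) scale_mem_iff[of z' c "?B + 1"] nz(3) by (cases "z' = 0") auto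
    ultimately show ?thesis unfolding comb_def using xyz(1) by (intro add_mem)
  qed
  ultimately have h: "h \<in> M' ?B" "h \<notin> M' (?B + 1)"
    using wm n.add_mem_iff[of "comb a f c x y' z'" ?B h] n.add_mem_iff[of "comb a f c x y' z'" "?B + 1" h] sub Bp by auto
  have "\<alpha> \<noteq> 0"
  proof
    assume "\<alpha> = 0"
    then have hc: "h = fls_const \<beta> *s c" by (simp add: h_def)
    then have "\<beta> \<noteq> 0" using h(2) by auto
    then have "?B \<le> lev M' c"
      using h(1) n.scale_mem_iff[of "fls_const \<beta>" c ?B] nz(3) unfolding hc by simp
    then show False using lc by simp
  qed
  define s where "s = \<beta> / \<alpha>"
  have "fls_const (inverse \<alpha>) *s h = g s"
  proof -
    have "fls_const (inverse \<alpha>) * fls_const \<alpha> = 1" "fls_const (inverse \<alpha>) * fls_const \<beta> = fls_const s"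
      using \<open>\<alpha> \<noteq> 0\<close> by (simp_all add: s_def field_simps)
    then show ?thesis
      by (simp add: h_def g_def vec.scale_right_distrib)
  qed
  then have gm: "g s \<in> M' ?B" using n.scale_mem_int[OF _ h(1), of "fls_const (inverse \<alpha>)"] by simp
  have lg: "lev M' (g s) = ?B"
    by (rule n.lev_eqI[OF gm]) (use Bp mem_iff[OF g_lev(1), of s "?B + 1"] g_lev(2)[of s] in simp)
  have "nb s = M'"
    by (rule chain_eqI[OF nb_chain ch nb_frame]) (simp_all only: la lc lg nb_lev)
  then show ?thesis by blast
qed

lemma nbrs_eq: "nbrs M = range nb"
  using nbrs_complete nb_nbrs by blast

text \<open>A splitting basis of \<open>nb s\<close> arises from \<open>a\<close>, \<open>b\<close>,
  \<open>c\<close> by at most one elementary operation, whose coefficient is a constant times a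
  power of the uniformiser. That coefficient has to be a polynomial, so the sign of
  \<open>j = p - 1\<close> decides whether \<open>b\<close> can be corrected by \<open>c\<close> or
  \<open>c\<close> by \<open>b\<close>.\<close>

lemma nb_st:
  fixes p r :: int
  assumes "st M = (p, r)"
  shows "0 < p \<Longrightarrow> st (shift 1 (nb s)) = (r, p - 1)"
    "\<not> 0 < p \<Longrightarrow> s = 0 \<Longrightarrow> st (shift 1 (nb s)) = (r, p - 1)"
    "\<not> 0 < p \<Longrightarrow> s \<noteq> 0 \<Longrightarrow> st (shift 1 (nb s)) = (r - p + 1, 1 - p)"
proof -
  interpret n: lattice_chain "nb s" by (rule nb_chain)
  have pb: "pbasis a b c" using pf unfolding pframe_def by blast
  have pr: "p = (lev M c - lev M b + 2) div 3" "r = (lev M a - lev M b + 1) div 3"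
    using st_eq[OF lattice_chain_axioms pf] assms by simp_all
  have "(lev M a - lev M b + 1) mod 3 = 0"
  proof -
    have "(m - n + 1) mod 3 = 0" if "m mod 3 = 1" "n mod 3 = 2" for m n :: int using that by presburger
    from this[OF res(1) res(2)] show ?thesis .
  qed
  then have la: "lev M a = lev M b + 3 * r - 1"
    using mult_div_mod_eq[of 3 "lev M a - lev M b + 1"] unfolding pr by linarith
  have "lev M c - lev M b + 2 = 3 * (j + 1)" using j by simp
  then have pj: "p = j + 1" unfolding pr by simp
  then have lc: "lev M c = lev M b + 3 * p - 2" using j by simp
  have r2: "(lev M b + 1) mod 3 = 0"
  proof -
    have "(n + 1) mod 3 = 0" if "n mod 3 = 2" for n :: int using that by presburger
    from this[OF res(2)] show ?thesis .
  qed
  have val: "st (shift 1 (nb s)) = ((lev (nb s) u - lev (nb s) w + 2) div 3, (lev (nb s) v - lev (nb s) w + 1) div 3)"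
    if "pframe (nb s) u v w" for u v w by (rule st_shift1[OF nb_chain that])
  have d3: "3 * k div 3 = k" for k :: int by simp
  have f_eq: "b = \<pi>p (- j) *s f"
    unfolding f_def vector_smult_assoc by (simp flip: pow_add)
  \<comment> \<open>The vector \<open>c\<close> drops to residue 2 and \<open>w\<close>, a corrected
    \<open>b\<close> raised by one level, takes over residue 0.\<close>
  have straight: "st (shift 1 (nb s)) = (r, p - 1)"
    if w: "pbasis a c w" "w \<noteq> 0" "lev (nb s) w = lev M b + 1" for w
  proof -
    have "pframe (nb s) a c w"
      unfolding pframe_def frame_def using nz w nb_lev res res' r2 by simp
    from val[OF this] have "st (shift 1 (nb s)) = (3 * r div 3, 3 * (p - 1) div 3)"
      unfolding nb_lev w(3) la lc by (simp add: algebra_simps)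
    then show ?thesis unfolding d3 .
  qed
  \<comment> \<open>Here \<open>j\<close> is nonnegative, so for every \<open>s\<close> the rescaled
    \<open>g s\<close> is \<open>b\<close> plus a polynomial multiple of \<open>c\<close>.\<close>
  show "st (shift 1 (nb s)) = (r, p - 1)" if "0 < p"
  proof (rule straight)
    have eq: "\<pi>p (- j) *s g s = b + (\<pi>p (- j) * fls_const s) *s c"
      unfolding g_def by (subst (2) f_eq) (simp add: vec.scale_right_distrib)
    have "\<pi>p (- j) * fls_const s \<in> poly_ring_t"
      using that pj by (intro poly_ring_mult poly_ring_pow poly_ring_const) simp
    then show "pbasis a c (\<pi>p (- j) *s g s)"
      unfolding eq by (rule pbasis_add[OF pbasis_swap[OF pb]])
    show "\<pi>p (- j) *s g s \<noteq> 0" using g_lev(1) by simp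
    show "lev (nb s) (\<pi>p (- j) *s g s) = lev M b + 1"
      unfolding n.lev_scale[OF pow_nz g_lev(1)] nb_lev val_pow using lc pj by simp
  qed
  \<comment> \<open>For \<open>s = 0\<close> the vector \<open>g s\<close> is a multiple of
    \<open>b\<close> itself, and no correction occurs.\<close>
  show "st (shift 1 (nb s)) = (r, p - 1)" if "\<not> 0 < p" "s = 0"
  proof (rule straight)
    show "pbasis a c b" by (rule pbasis_swap[OF pb])
    show "b \<noteq> 0" by (rule nz)
    have "f = g s" using that by (simp add: g_def)
    then have "lev (nb s) b = lev (nb s) (\<pi>p (- j) *s g s)" using f_eq by simp
    then show "lev (nb s) b = lev M b + 1"
      unfolding n.lev_scale[OF pow_nz g_lev(1)] nb_lev val_pow using lc pj by simp
  qed
  \<comment> \<open>Now \<open>j\<close> is negative: dividing \<open>g s\<close> by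
    \<open>s\<close> gives \<open>c\<close> plus a polynomial multiple of \<open>b\<close>, which
    replaces \<open>c\<close>. The level of \<open>b\<close> is unchanged because \<open>f\<close>
    is a sum of vectors of different levels in \<open>nb s\<close>, the lower being that of
    \<open>c\<close>.\<close>
  show "st (shift 1 (nb s)) = (r - p + 1, 1 - p)" if "\<not> 0 < p" "s \<noteq> 0"
  proof -
    define w where "w = c + (fls_const (inverse s) * \<pi>p j) *s b"
    have cs: "fls_const (inverse s) * fls_const s = 1" using that by simp
    have w: "w = fls_const (inverse s) *s g s"
      unfolding w_def g_def f_def by (simp add: vec.scale_right_distrib cs del: fls_const_mult_const)
    have lw: "lev (nb s) w = lev M c" "w \<noteq> 0"
      using n.lev_scale[OF _ g_lev(1), of "fls_const (inverse s)" s] g_lev(1)[of s] that unfolding w nb_lev by auto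
    have sc: "fls_const (- s) *s c \<noteq> 0" "lev (nb s) (fls_const (- s) *s c) = lev M c - 1"
      using n.lev_scale[OF _ nz(3), of "fls_const (- s)"] nz(3) that nb_lev(2) by auto
    have feq: "f = fls_const (- s) *s c + g s" unfolding g_def by (simp add: vec_eq_iff)
    have "lev (nb s) f = lev M c - 1"
      using n.lev_add(2)[OF sc(1) g_lev(1)[of s]] sc nb_lev(3) unfolding feq by simp
    then have lb: "lev (nb s) b = lev M b"
      using n.lev_scale[OF pow_nz f_lev(1), of "- j"] lc pj unfolding f_eq[symmetric] by simp
    have "fls_const (inverse s) * \<pi>p j \<in> poly_ring_t"
      using that pj by (intro poly_ring_mult poly_ring_pow poly_ring_const) simp
    then have "pbasis a b w" unfolding w_def by (rule pbasis_add[OF pb])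
    then have "pframe (nb s) a b w"
      unfolding pframe_def frame_def using nz lw lb nb_lev res by simp
    from val[OF this] have "st (shift 1 (nb s)) = (3 * (r - p + 1) div 3, 3 * (1 - p) div 3)"
      unfolding nb_lev lw lb la lc by (simp add: algebra_simps)
    then show ?thesis unfolding d3 .
  qed
qed

lemma card_nbrs:
  assumes "finite (UNIV :: 'k set)"
  shows "card {M' \<in> nbrs M. st (shift 1 M') = z} = wt (card (UNIV :: 'k set)) (st M) z"
proof -
  obtain p r where pr: "st M = (p, r)" by fastforce
  have "{M' \<in> nbrs M. st (shift 1 M') = z} = nb ` {s. st (shift 1 (nb s)) = z}"
    unfolding nbrs_eq by blast
  then have "card {M' \<in> nbrs M. st (shift 1 M') = z} = card {s. st (shift 1 (nb s)) = z}"
    by (simp only: card_image[OF inj_on_subset[OF nb_inj subset_UNIV]])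
  also have "\<dots> = wt (card (UNIV :: 'k set)) (st M) z"
  proof (cases "0 < p")
    case True
    then show ?thesis using nb_st(1)[OF pr] by (auto simp: wt_def pr)
  next
    case False
    then have "{s. st (shift 1 (nb s)) = z} = {s. (if s = 0 then (r, p - 1) else (r - p + 1, 1 - p)) = z}"
      using nb_st(2,3)[OF pr False] by (intro Collect_cong) auto
    moreover have "(r, p - 1) \<noteq> (r - p + 1, 1 - p)" using False by auto
    ultimately have "{s. st (shift 1 (nb s)) = z} =
      (if z = (r, p - 1) then {0} else if z = (r - p + 1, 1 - p) then UNIV - {0} else {})"
      by auto
    then show ?thesis using False assms by (simp add: wt_def pr card_Diff_singleton)
  qed
  finally show ?thesis .
qed

end

section \<open>Chambers and their orbits\<close>

lemma std_lattice_iff: "v \<in> std_lattice \<longleftrightarrow> (\<forall>i. 0 \<le> \<nu> (v $ i))"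
  by (simp add: std_lattice_def int_ring_iff')

lemma det_cols_scale:
  "det (cols (x *s a) (y *s b) (z *s c)) = x * y * z * det (cols a b c)"
  by (simp add: det_3 cols_def algebra_simps)

lemma fbasis_scale:
  assumes "fbasis a b c" "x \<noteq> 0" "y \<noteq> 0" "z \<noteq> 0"
  shows "fbasis (x *s a) (y *s b) (z *s c)"
proof (rule fbasisI)
  fix u v w assume "comb (x *s a) (y *s b) (z *s c) u v w = 0"
  then have "comb a b c (u * x) (v * y) (w * z) = 0" by (simp add: comb_def vector_smult_assoc)
  then have "u * x = 0 \<and> v * y = 0 \<and> w * z = 0" using assms(1) unfolding fbasis_def by blast
  then show "u = 0 \<and> v = 0 \<and> w = 0" using assms(2-4) by simp
qed

text \<open>Each frame vector is scaled until it just lies in \<open>M k\<close>. Since the levels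
  meet every residue class, raising \<open>k\<close> by 1 raises exactly one exponent, so the
  valuation of the determinant grows with slope 1.\<close>

lemma chain_lattice:
  assumes "lattice_chain M"
  shows "\<exists>e. \<forall>k. \<exists>g. invertible g \<and> M k = (*v) g ` std_lattice \<and> \<nu> (det g) = e + k"
proof -
  interpret lattice_chain M by fact
  obtain a b c where f: "frame M a b c" and l: "lev M a = 1" "lev M b = 2" "lev M c = 0"
    using ex_frame[of 1 2 0] by auto
  note fb = frame_basis[OF f]
  have dnz: "det (cols a b c) \<noteq> 0" using fbasis_invertible[OF fb] invertible_det_nz by blast
  have "\<exists>g. invertible g \<and> M k = (*v) g ` std_lattice \<and> \<nu> (det g) = \<nu> (det (cols a b c)) + k" for k
  proof -
    \<comment> \<open>The least exponents that bring the vectors of levels 1, 2, 0 to level at least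
      \<open>k\<close>, written as rounded-up quotients; their sum is \<open>k\<close>.\<close>
    define x y z where "x = - ((1 - k) div 3)" and "y = - ((2 - k) div 3)" and "z = - ((0 - k) div 3)"
    define g where "g = cols (\<pi>p x *s a) (\<pi>p y *s b) (\<pi>p z *s c)"
    have fb': "fbasis (\<pi>p x *s a) (\<pi>p y *s b) (\<pi>p z *s c)" by (rule fbasis_scale[OF fb]) simp_all
    have inv: "invertible g" unfolding g_def by (rule fbasis_invertible[OF fb'])
    have ar: "k \<le> n + 3 * (- ((n - k) div 3) + t) \<longleftrightarrow> 0 \<le> t" for n t :: int by presburger
    have scal: "(u * \<pi>p s = 0 \<or> k \<le> n + 3 * \<nu> (u * \<pi>p s)) \<longleftrightarrow> 0 \<le> \<nu> u"
      if "s = - ((n - k) div 3)" for u :: "'a fls" and s n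
    proof (cases "u = 0")
      case False
      then show ?thesis using ar[of n "\<nu> u"] that by (simp add: val_mult add.commute)
    qed simp
    have mem: "g *v v \<in> M k \<longleftrightarrow> v \<in> std_lattice" for v
    proof -
      have "g *v v = comb a b c (v $ 1 * \<pi>p x) (v $ 2 * \<pi>p y) (v $ 3 * \<pi>p z)"
        unfolding g_def cols_mult by (simp add: comb_def vector_smult_assoc)
      then show ?thesis
        unfolding std_lattice_iff forall_3
        by (simp only: frame_mem'[OF f] l scal[OF x_def] scal[OF y_def] scal[OF z_def])
    qed
    have "M k = (*v) g ` std_lattice"
    proof (intro equalityI subsetI)
      fix v assume v: "v \<in> M k"
      obtain B where "g ** B = mat 1" using inv unfolding invertible_def by blast
      then have "v = g *v (B *v v)" by (simp add: matrix_vector_mul_assoc)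
      then show "v \<in> (*v) g ` std_lattice" using mem v by (metis image_eqI)
    qed (use mem in auto)
    moreover have "\<nu> (det g) = \<nu> (det (cols a b c)) + k"
    proof -
      have "\<nu> (det g) = x + y + z + \<nu> (det (cols a b c))"
        unfolding g_def det_cols_scale using dnz by (simp add: val_mult)
      moreover have "x + y + z = k" unfolding x_def y_def z_def by presburger
      ultimately show ?thesis by simp
    qed
    ultimately show ?thesis using inv by blast
  qed
  then show ?thesis by blast
qed

lemma det_int_ring: "(\<And>i j. (A :: 'k::field fls ^ 3 ^ 3) $ i $ j \<in> int_ring) \<Longrightarrow> det A \<in> int_ring"
  unfolding det_3 by (intro int_ring_add int_ring_diff int_ring_mult)

text \<open>A basis of the smaller lattice has integral coordinates in the larger one, so the
  quotient of the determinants is integral.\<close>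

lemma lattice_det_le:
  fixes g h :: "'k::field fls ^ 3 ^ 3"
  assumes "invertible g" "invertible h" "(*v) h ` std_lattice \<subseteq> (*v) g ` std_lattice"
  shows "\<nu> (det g) \<le> \<nu> (det h)"
proof -
  obtain B where B: "B ** g = mat 1" using assms(1) unfolding invertible_def by blast
  have "(B ** h) $ i $ j \<in> int_ring" for i j
  proof -
    have "axis j 1 \<in> (std_lattice :: ('k fls ^ 3) set)" by (simp add: std_lattice_def axis_def)
    then have "h *v axis j 1 \<in> (*v) g ` std_lattice" using assms(3) by (meson imageI subsetD)
    then obtain v where v: "h *v axis j 1 = g *v v" "v \<in> std_lattice" by (rule imageE)
    have "(B ** h) *v axis j 1 = (B ** g) *v v"
      using v(1) by (simp only: matrix_vector_mul_assoc[symmetric])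
    then have "(B ** h) *v axis j 1 = v" unfolding B by simp
    moreover have "((B ** h) *v axis j 1) $ i = (B ** h) $ i $ j"
      by (simp add: matrix_vector_mult_def axis_def if_distrib[of "\<lambda>x. _ * x"] cong: if_cong)
    ultimately have "(B ** h) $ i $ j = v $ i" by simp
    then show ?thesis using v(2) by (simp add: std_lattice_def)
  qed
  then have "0 \<le> \<nu> (det (B ** h))" using det_int_ring[of "B ** h"] by (simp add: int_ring_iff')
  moreover have dBg: "det B * det g = 1" using det_mul[of B g] by (simp only: B det_I)
  then have nz: "det B \<noteq> 0" "det g \<noteq> 0" by auto
  then have "\<nu> (det B) + \<nu> (det g) = 0"
    using val_mult[of "det B" "det g"] unfolding dBg by simp
  moreover have "\<nu> (det (B ** h)) = \<nu> (det B) + \<nu> (det h)"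
    unfolding det_mul by (rule val_mult) (use nz assms(2) invertible_det_nz in blast)+
  ultimately show ?thesis by linarith
qed

lemma homothety_self: "L \<in> homothety_class (L :: ('k::field fls ^ 3) set)"
  unfolding homothety_class_def by (rule CollectI, rule exI[of _ 1]) simp

lemma homothety_eqI:
  assumes "(c :: 'k::field fls) \<noteq> 0"
  shows "homothety_class ((*s) c ` L) = homothety_class L"
proof -
  have 1: "(*s) d ` (*s) c ` L = (*s) (d * c) ` L" for d c :: "'k fls"
    by (simp add: image_image vector_smult_assoc)
  show ?thesis unfolding homothety_class_def 1
  proof (intro equalityI subsetI)
    fix K assume "K \<in> {(*s) d ` L |d. d \<noteq> 0}"
    then obtain d where d: "K = (*s) d ` L" "d \<noteq> 0" by blast
    have "d * inverse c * c = d" using left_inverse[OF assms] by (simp only: mult.assoc mult_1_right)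
    then have "K = (*s) (d * inverse c * c) ` L" "d * inverse c \<noteq> 0" using d assms by (simp_all only: mult_eq_0_iff inverse_nonzero_iff_nonzero) simp
    then show "K \<in> {(*s) (d * c) ` L |d. d \<noteq> 0}" by blast
  qed (use assms in auto)
qed

lemma homothety_eqD:
  assumes "homothety_class L = homothety_class (L' :: ('k::field fls ^ 3) set)"
  shows "\<exists>c. c \<noteq> 0 \<and> L' = (*s) c ` L"
proof -
  have "L' \<in> homothety_class L" using homothety_self[of L'] assms by simp
  then show ?thesis unfolding homothety_class_def by blast
qed

text \<open>The \<open>THE\<close> in \<open>vertex_type\<close> is settled by determinants:
  matrices of the same lattice have determinants of equal valuation, and a homothety by
  \<open>c\<close> adds \<open>3 * \<nu> c\<close>.\<close>

lemma vertex_type_eq: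
  fixes g :: "'k::field fls ^ 3 ^ 3"
  assumes g: "invertible g"
  shows "vertex_type (homothety_class ((*v) g ` std_lattice)) = \<nu> (det g) mod 3"
  unfolding vertex_type_def
proof (rule the_equality)
  show "\<exists>h. invertible h \<and> (*v) h ` std_lattice \<in> homothety_class ((*v) g ` std_lattice) \<and>
      \<nu> (det g) mod 3 = \<nu> (det h) mod 3"
    using g homothety_self by blast
  fix m
  assume "\<exists>h. invertible h \<and> (*v) h ` std_lattice \<in> homothety_class ((*v) g ` std_lattice) \<and> m = \<nu> (det h) mod 3"
  then obtain h c where h: "invertible h" "m = \<nu> (det h) mod 3" "c \<noteq> 0"
    "(*v) h ` std_lattice = (*s) c ` (*v) g ` std_lattice"
    unfolding homothety_class_def by blast
  define g' where "g' = mat c ** g"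
  have mc: "mat c *v v = c *s v" for v :: "'k fls ^ 3"
    by (simp add: vec_eq_iff forall_3 matrix_vector_mult_def mat_def sum_3)
  have dc: "det (mat c :: 'k fls ^ 3 ^ 3) = c * c * c"
    by (simp add: det_3 mat_def)
  have dg: "det g \<noteq> 0" using g invertible_det_nz by blast
  have det: "det g' = c * c * c * det g" unfolding g'_def det_mul dc ..
  then have inv: "invertible g'" using dg h(3) unfolding invertible_det_nz by simp
  have "(*v) h ` std_lattice = (*v) g' ` std_lattice"
    unfolding h(4) image_image g'_def by (simp add: matrix_vector_mul_assoc[symmetric] mc)
  then have "\<nu> (det h) = \<nu> (det g')"
    using lattice_det_le[OF h(1) inv] lattice_det_le[OF inv h(1)] by simp
  also have "\<dots> = \<nu> (det g) + 3 * \<nu> c" unfolding det using dg h(3) by (simp add: val_mult)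
  finally show "m = \<nu> (det g) mod 3" unfolding h(2) by simp
qed

lemma vertex_type_chain:
  assumes "lattice_chain M"
  shows "\<exists>e. \<forall>k. vertex_type (homothety_class (M k)) = (e + k) mod 3"
  using chain_lattice[OF assms] vertex_type_eq by metis

lemma is_lattice_chain: "lattice_chain M \<Longrightarrow> is_lattice (M k)"
  using chain_lattice[of M] unfolding is_lattice_def by metis

lemma lattice_props:
  assumes "is_lattice (L :: ('k::field fls ^ 3) set)"
  shows "0 \<in> L" "v \<in> L \<Longrightarrow> w \<in> L \<Longrightarrow> v + w \<in> L" "0 \<le> \<nu> c \<Longrightarrow> v \<in> L \<Longrightarrow> c *s v \<in> L"
    "\<exists>m. \<pi>p m *s v \<in> L" "v \<noteq> 0 \<Longrightarrow> \<exists>m. \<pi>p m *s v \<notin> L"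
proof -
  obtain g where g: "invertible g" "L = (*v) g ` std_lattice" using assms unfolding is_lattice_def by blast
  obtain B where B: "g ** B = mat 1" "B ** g = mat 1" using g(1) unfolding invertible_def by blast
  have mem: "v \<in> L \<longleftrightarrow> (\<forall>i. (B *v v) $ i \<in> int_ring)" for v
  proof
    assume "v \<in> L"
    then show "\<forall>i. (B *v v) $ i \<in> int_ring"
      unfolding g(2) using B(2) by (auto simp: matrix_vector_mul_assoc std_lattice_def)
  next
    assume "\<forall>i. (B *v v) $ i \<in> int_ring"
    then have "B *v v \<in> std_lattice" by (simp add: std_lattice_def)
    moreover have "v = g *v (B *v v)" using B(1) by (simp add: matrix_vector_mul_assoc)
    ultimately show "v \<in> L" unfolding g(2) by (rule rev_image_eqI)
  qed
  show "0 \<in> L" by (simp add: mem)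
  show "v \<in> L \<Longrightarrow> w \<in> L \<Longrightarrow> v + w \<in> L"
    by (simp add: mem matrix_vector_right_distrib int_ring_add)
  show "0 \<le> \<nu> c \<Longrightarrow> v \<in> L \<Longrightarrow> c *s v \<in> L"
    unfolding mem vec.scale vector_smult_component by (intro allI int_ring_mult) (simp_all add: int_ring_iff')
  have sc: "\<pi>p m *s v \<in> L \<longleftrightarrow> (\<forall>i. (B *v v) $ i = 0 \<or> 0 \<le> m + \<nu> ((B *v v) $ i))" for m
    unfolding mem vec.scale vector_smult_component int_ring_iff
    using val_mult[OF pow_nz, of _ m] by (metis mult_eq_0_iff pow_nz val_pow)
  show "\<exists>m. \<pi>p m *s v \<in> L"
    unfolding sc forall_3
    by (rule exI[of _ "\<bar>\<nu> ((B *v v) $ 1)\<bar> + \<bar>\<nu> ((B *v v) $ 2)\<bar> + \<bar>\<nu> ((B *v v) $ 3)\<bar>"]) linarith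
  show "\<exists>m. \<pi>p m *s v \<notin> L" if "v \<noteq> 0"
  proof -
    have "B *v v \<noteq> 0" using B(1) that by (metis matrix_vector_mul_assoc matrix_vector_mul_lid matrix_vector_mult_0_right)
    then obtain i where "(B *v v) $ i \<noteq> 0" by (auto simp: vec_eq_iff)
    then have "\<pi>p (- \<nu> ((B *v v) $ i) - 1) *s v \<notin> L" unfolding sc by (intro notI) (drule spec[of _ i], simp)
    then show ?thesis by blast
  qed
qed

text \<open>The lattices are continued periodically: index \<open>k\<close> gets the lattice of
  \<open>k mod 3\<close>, scaled by the power \<open>k div 3\<close> of the uniformiser. Strictness
  across a period is the inclusion of the scaled \<open>L1\<close> in \<open>L3\<close>.\<close>

lemma chain_of_lattices:
  fixes L1 L2 L3 :: "('k::field fls ^ 3) set"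
  assumes L: "is_lattice L1" "is_lattice L2" "is_lattice L3"
    and incl: "(*s) fls_X ` L1 \<subset> L3" "L3 \<subset> L2" "L2 \<subset> L1"
  shows "\<exists>M. lattice_chain M \<and> M 0 = L1 \<and> M 1 = L2 \<and> M 2 = L3"
proof -
  define R where "R k = (if k = 0 then L1 else if k = 1 then L2 else L3)" for k :: int
  define M where "M k = {v. \<pi>p (- (k div 3)) *s v \<in> R (k mod 3)}" for k
  have lat: "is_lattice (R k)" for k using L by (simp add: R_def)
  note R = lattice_props[OF lat]
  have M012: "M 0 = L1" "M 1 = L2" "M 2 = L3" by (simp_all add: M_def R_def)
  have shift: "v \<in> M (n + 3 * m) \<longleftrightarrow> \<pi>p (- m) *s v \<in> M n" for v n m
    by (simp add: M_def vector_smult_assoc pow_add[symmetric] add.commute)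
  have M3: "M 3 = (*s) fls_X ` L1"
  proof -
    have "\<pi>p 1 *s (\<pi>p (- 1) *s v) = v" "\<pi>p (- 1) *s (\<pi>p 1 *s v) = v" for v :: "'k fls ^ 3"
      unfolding vector_smult_assoc pow_add[symmetric] by simp_all
    moreover have "v \<in> M 3 \<longleftrightarrow> \<pi>p (- 1) *s v \<in> L1" for v using shift[of v 0 1] M012(1) by simp
    ultimately have "M 3 = (*s) (\<pi>p 1) ` L1"
      by (intro equalityI subsetI) (metis image_eqI, metis imageE)
    then show ?thesis by simp
  qed
  have unit: "e *s v \<in> M n \<longleftrightarrow> v \<in> M n" if e: "\<nu> e = 0" "e \<noteq> 0" for e v n
  proof -
    have comm: "\<pi>p m *s (e *s v) = e *s (\<pi>p m *s v)" for m and v :: "'k fls ^ 3" and e :: "'k fls"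
      by (simp add: vector_smult_assoc mult.commute)
    have fwd: "v \<in> M n \<Longrightarrow> e *s v \<in> M n" if "\<nu> e = 0" for e v
      unfolding M_def mem_Collect_eq comm using that by (elim R(3)[rotated]) simp
    have "inverse e *s (e *s v) = v" using left_inverse[OF e(2)] by (simp only: vector_smult_assoc vector_smult_lid)
    moreover have "\<nu> (inverse e) = 0" using val_inverse[OF e(2)] e(1) by simp
    ultimately show ?thesis using fwd[of e v] fwd[of "inverse e" "e *s v"] e(1) by auto
  qed
  have "lattice_chain M"
  proof (rule lattice_chain.intro)
    fix n v w and c :: "'k fls"
    show "0 \<in> M n" by (simp add: M_def R(1))
    show "v \<in> M n \<Longrightarrow> w \<in> M n \<Longrightarrow> v + w \<in> M n" by (simp add: M_def vec.scale_right_distrib R(2))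
    show "(c *s v \<in> M (n + 3 * \<nu> c)) = (v \<in> M n)" if c: "c \<noteq> 0"
    proof -
      have "\<nu> (\<pi>p (- \<nu> c) * c) = 0" "\<pi>p (- \<nu> c) * c \<noteq> 0" using c by (simp_all add: val_mult)
      then show ?thesis unfolding shift vector_smult_assoc by (rule unit)
    qed
    have sub: "M (n mod 3 + 1) \<subset> M (n mod 3)"
    proof -
      have "n mod 3 = 0 \<or> n mod 3 = 1 \<or> n mod 3 = 2" by presburger
      then show ?thesis using incl M012 M3 by (elim disjE) simp_all
    qed
    have mem: "v \<in> M n \<longleftrightarrow> \<pi>p (- (n div 3)) *s v \<in> M (n mod 3)"
      "v \<in> M (n + 1) \<longleftrightarrow> \<pi>p (- (n div 3)) *s v \<in> M (n mod 3 + 1)" for v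
      using shift[of v "n mod 3" "n div 3"] shift[of v "n mod 3 + 1" "n div 3"] by (simp_all add: algebra_simps)
    obtain w where w: "w \<in> M (n mod 3)" "w \<notin> M (n mod 3 + 1)" using sub by blast
    have w': "\<pi>p (- (n div 3)) *s (\<pi>p (n div 3) *s w) = w"
      unfolding vector_smult_assoc pow_add[symmetric] by simp
    show "M (n + 1) \<subset> M n"
    proof (rule psubsetI)
      show "M (n + 1) \<subseteq> M n" using mem sub by blast
      have "\<pi>p (n div 3) *s w \<in> M n" "\<pi>p (n div 3) *s w \<notin> M (n + 1)" unfolding mem w' using w by simp_all
      then show "M (n + 1) \<noteq> M n" by metis
    qed
    obtain m where "\<pi>p m *s v \<in> R 0" using R(4) by blast
    then have "v \<in> M (0 + 3 * (- m))" unfolding shift by (simp add: M012 R_def)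
    then show "\<exists>n. v \<in> M n" by blast
    show "\<exists>n. v \<notin> M n" if "v \<noteq> 0"
    proof -
      obtain m where "\<pi>p m *s v \<notin> R 0" using R(5) \<open>v \<noteq> 0\<close> by blast
      then have "v \<notin> M (0 + 3 * (- m))" unfolding shift by (simp add: M012 R_def)
      then show ?thesis by blast
    qed
  qed
  then show ?thesis using M012 by blast
qed

section \<open>Pointed chambers as chains up to period\<close>

definition chamber :: "(int \<Rightarrow> ('k::field fls ^ 3) set) \<Rightarrow> ('k fls ^ 3) set set triple" where
  "chamber M = (homothety_class (M 0), homothety_class (M 1), homothety_class (M 2))"

lemma homothety_chain3:
  assumes "lattice_chain M"
  shows "homothety_class (M (k + 3 * m)) = homothety_class (M k)"
  using lattice_chain.image_scale[OF assms, of "\<pi>p m" k] homothety_eqI[of "\<pi>p m" "M k"] by simp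

lemma homothety_chainD:
  assumes "lattice_chain M" "homothety_class (M k) = homothety_class L"
  shows "\<exists>m. L = M (k + 3 * m)"
  using homothety_eqD[OF assms(2)] lattice_chain.image_scale[OF assms(1)] by metis

text \<open>Lattices homothetic to \<open>M (n + 1)\<close> are three indices apart in the chain,
  and only one of them lies strictly between \<open>M (n + 3)\<close> and
  \<open>M n\<close>.\<close>

lemma chain_sandwich:
  assumes M: "lattice_chain M" and M': "lattice_chain M'" and eq: "M' m = M n"
    and cls: "homothety_class (M' (m + 1)) = homothety_class (M (n + 1))"
  shows "M' (m + 1) = M (n + 1)"
proof -
  interpret M: lattice_chain M by fact
  interpret M': lattice_chain M' by fact
  obtain i where i: "M' (m + 1) = M (n + 1 + 3 * i)" using homothety_chainD[OF M cls[symmetric]] by blast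
  have "M' (m + 3) = M (n + 3)"
    using M.image_scale[of "\<pi>p 1" n] M'.image_scale[of "\<pi>p 1" m] eq by simp
  moreover have "M' (m + 3) \<subset> M' (m + 1)" "M' (m + 1) \<subset> M' m" by (simp_all add: M'.subset_iff)
  ultimately have "n + 1 + 3 * i < n + 3" "n < n + 1 + 3 * i" using eq i by (simp_all add: M.subset_iff)
  then have "i = 0" by presburger
  then show ?thesis using i by simp
qed

lemma chamber_shift3: "lattice_chain M \<Longrightarrow> chamber (shift (3 * k) M) = chamber M"
  using homothety_chain3[of M 0 k] homothety_chain3[of M 1 k] homothety_chain3[of M 2 k]
  by (simp add: chamber_def shift_def)

lemma chains_eqI:
  assumes M: "lattice_chain M" and M': "lattice_chain M'"
    and eq: "M' m = M m" "M' (m + 1) = M (m + 1)" "M' (m + 2) = M (m + 2)"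
  shows "M' = M"
proof
  fix n
  have e: "(m + (n - m) mod 3) mod 3 = n mod 3" by (simp add: mod_add_right_eq)
  have "k mod 3 = 0 \<or> k mod 3 = 1 \<or> k mod 3 = 2" for k :: int by presburger
  from this[of "n - m"] e
  consider "n mod 3 = m mod 3" | "n mod 3 = (m + 1) mod 3" | "n mod 3 = (m + 2) mod 3" by fastforce
  then show "M' n = M n"
  proof cases
    case 1 then show ?thesis by (rule chain_agree_mod3[OF M M' eq(1)])
  next
    case 2 then show ?thesis by (rule chain_agree_mod3[OF M M' eq(2)])
  next
    case 3 then show ?thesis by (rule chain_agree_mod3[OF M M' eq(3)])
  qed
qed

text \<open>Matching the representatives of the first vertex uses up the homothety; the sandwich
  argument then fixes the other two lattices.\<close>

lemma chamber_eqD: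
  assumes M: "lattice_chain M" and M': "lattice_chain M'" and eq: "chamber M = chamber M'"
  shows "\<exists>k. M' = shift (3 * k) M"
proof -
  have h: "homothety_class (M 0) = homothety_class (M' 0)" "homothety_class (M 1) = homothety_class (M' 1)"
    "homothety_class (M 2) = homothety_class (M' 2)" using eq by (simp_all add: chamber_def)
  obtain k where k: "M' 0 = M (0 + 3 * k)" using homothety_chainD[OF M h(1)] by blast
  define N where "N = shift (3 * k) M"
  have N: "lattice_chain N" unfolding N_def by (rule shift_chain[OF M])
  have cN: "chamber N = chamber M'" unfolding N_def chamber_shift3[OF M] eq ..
  have 0: "M' 0 = N 0" using k by (simp add: N_def shift_def)
  have 1: "M' (0 + 1) = N (0 + 1)" by (rule chain_sandwich[OF N M' 0]) (use cN in \<open>simp add: chamber_def\<close>)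
  have 2: "M' (1 + 1) = N (1 + 1)" by (rule chain_sandwich[OF N M']) (use cN 1 in \<open>simp_all add: chamber_def\<close>)
  have "M' = N" by (rule chains_eqI[OF N M', of 0]) (use 0 1 2 in simp_all)
  then show ?thesis unfolding N_def by blast
qed

text \<open>Types rise by one modulo 3 along a chain. The type condition thus forces the three
  vertices, in whatever order the chamber lists them, to be consecutive in the chain, and a shift
  moves them to the indices 0, 1, 2.\<close>

lemma type1_eq: "type1_chambers = chamber ` {M :: int \<Rightarrow> ('k::field fls ^ 3) set. lattice_chain M}"
proof (intro equalityI subsetI)
  fix d :: "('k fls ^ 3) set set triple" assume "d \<in> chamber ` {M. lattice_chain M}"
  then obtain M where M: "lattice_chain M" "d = chamber M" by blast
  interpret lattice_chain M by fact
  have "(*s) fls_X ` M 0 \<subset> M 2" "M 2 \<subset> M 1" "M 1 \<subset> M 0"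
    using image_scale[of fls_X 0] by (simp_all add: subset_iff)
  then have "is_chamber {homothety_class (M 0), homothety_class (M 1), homothety_class (M 2)}"
    unfolding is_chamber_def
    by (intro exI[of _ "M 0"] exI[of _ "M 1"] exI[of _ "M 2"] conjI is_lattice_chain[OF M(1)] refl)
  moreover obtain e where "\<And>k. vertex_type (homothety_class (M k)) = (e + k) mod 3"
    using vertex_type_chain[OF M(1)] by blast
  moreover have "[(e + 1) mod 3 - e mod 3 = 1] (mod 3)" "[(e + 2) mod 3 - (e + 1) mod 3 = 1] (mod 3)"
    by (simp_all add: cong_def mod_diff_eq)
  ultimately show "d \<in> type1_chambers"
    unfolding M(2) chamber_def type1_chambers_def pointed_chambers_def by simp
next
  fix d :: "('k fls ^ 3) set set triple" assume d: "d \<in> type1_chambers"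
  obtain v1 v2 v3 where v: "d = (v1, v2, v3)" by (cases d)
  from d have "is_chamber {v1, v2, v3}" and t: "[vertex_type v2 - vertex_type v1 = 1] (mod 3)"
     "[vertex_type v3 - vertex_type v2 = 1] (mod 3)"
    unfolding v type1_chambers_def pointed_chambers_def by simp_all
  then obtain L1 L2 L3 where "is_lattice L1 \<and> is_lattice L2 \<and> is_lattice L3 \<and>
     (*s) fls_X ` L1 \<subset> L3 \<and> L3 \<subset> L2 \<and> L2 \<subset> L1 \<and>
     {v1, v2, v3} = {homothety_class L1, homothety_class L2, homothety_class L3}"
    unfolding is_chamber_def by (elim exE)
  then have L: "is_lattice L1" "is_lattice L2" "is_lattice L3"
     "(*s) fls_X ` L1 \<subset> L3" "L3 \<subset> L2" "L2 \<subset> L1"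
     "{v1, v2, v3} = {homothety_class L1, homothety_class L2, homothety_class L3}"
    by simp_all
  from chain_of_lattices[OF L(1-6)] obtain M where M: "lattice_chain M" "M 0 = L1" "M 1 = L2" "M 2 = L3" by blast
  obtain e where e: "\<And>k. vertex_type (homothety_class (M k)) = (e + k) mod 3"
    using vertex_type_chain[OF M(1)] by blast
  \<comment> \<open>The equality of sets does not tell which vertex belongs to which lattice; the
    indices modulo 3 are recovered from the types.\<close>
  have "\<exists>i. w = homothety_class (M i)" if "w \<in> {v1, v2, v3}" for w
    using that unfolding L(7) M(2-4)[symmetric] by blast
  then have "\<exists>i. v1 = homothety_class (M i)" "\<exists>i. v2 = homothety_class (M i)" "\<exists>i. v3 = homothety_class (M i)"
    by simp_all
  then obtain i1 i2 i3 where i: "v1 = homothety_class (M i1)" "v2 = homothety_class (M i2)" "v3 = homothety_class (M i3)"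
    by (elim exE)
  have arith: "j mod 3 = (i + 1) mod 3" if "[(e + j) mod 3 - (e + i) mod 3 = 1] (mod 3)" for i j e :: int
  proof -
    have "[(e + j) - (e + i) = 1] (mod 3)" using that by (simp add: cong_def mod_diff_eq)
    then have "[j - i + i = 1 + i] (mod 3)" by (intro cong_add) simp_all
    then show ?thesis by (simp add: cong_def add.commute)
  qed
  have i2: "i2 mod 3 = (i1 + 1) mod 3" by (rule arith[OF t(1)[unfolded i e]])
  have "i3 mod 3 = (i2 + 1) mod 3" by (rule arith[OF t(2)[unfolded i e]])
  then have i3: "i3 mod 3 = (i1 + 2) mod 3" using mod_add_cong[OF i2, of 1 1] by (simp add: add.assoc)
  have same: "homothety_class (M m) = homothety_class (M n)" if "m mod 3 = n mod 3" for m n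
  proof -
    have "m - n = 3 * ((m - n) div 3)" using that by (simp add: mod_eq_dvd_iff)
    then have "m = n + 3 * ((m - n) div 3)" by linarith
    then show ?thesis using homothety_chain3[OF M(1), of n "(m - n) div 3"] by simp
  qed
  have "d = chamber (shift i1 M)"
    unfolding v i chamber_def shift_def same[OF i2] same[OF i3] by (simp add: add.commute)
  then show "d \<in> chamber ` {M. lattice_chain M}" using shift_chain[OF M(1)] by blast
qed

text \<open>Scalars are absorbed by homothety, so a projective class acts through any of its
  representatives.\<close>

lemma pgl_act_homothety:
  fixes A :: "'k::field fls ^ 3 ^ 3"
  shows "pgl_act (scalar_class poly_ring_t A) (homothety_class L) = homothety_class ((*v) A ` L)"
proof -
  have mc: "(mat c ** A) *v v = c *s (A *v v)" for c and v :: "'k fls ^ 3"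
    by (simp add: vec_eq_iff forall_3 matrix_vector_mult_def matrix_matrix_mult_def mat_def sum_3 algebra_simps)
  have img: "(*v) (mat c ** A) ` (*s) d ` L = (*s) (c * d) ` (*v) A ` L" for c d
    by (simp add: image_image mc vec.scale vector_smult_assoc)
  show ?thesis
  proof (intro equalityI subsetI)
    fix K assume "K \<in> pgl_act (scalar_class poly_ring_t A) (homothety_class L)"
    then obtain c e d where "c * e = 1" "d \<noteq> 0" "K = (*v) (mat c ** A) ` (*s) d ` L"
      unfolding pgl_act_def scalar_class_def homothety_class_def by auto
    then have "c * d \<noteq> 0" "K = (*s) (c * d) ` (*v) A ` L" unfolding img by auto
    then show "K \<in> homothety_class ((*v) A ` L)" unfolding homothety_class_def by blast
  next
    fix K assume "K \<in> homothety_class ((*v) A ` L)"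
    then obtain d where d: "d \<noteq> 0" "K = (*s) d ` (*v) A ` L" unfolding homothety_class_def by blast
    then have "K = (*v) (mat 1 ** A) ` (*s) d ` L" unfolding img by simp
    moreover have "mat 1 ** A \<in> scalar_class poly_ring_t A"
      unfolding scalar_class_def by (rule CollectI, rule exI[of _ 1]) (use poly_ring_1 in force)
    moreover have "(*s) d ` L \<in> homothety_class L" using d(1) unfolding homothety_class_def by blast
    ultimately show "K \<in> pgl_act (scalar_class poly_ring_t A) (homothety_class L)"
      unfolding pgl_act_def by blast
  qed
qed

section \<open>Orbits and step weights\<close>

lemma chamber_orbit_eq: "chamber_orbit (chamber M) = (\<lambda>A. chamber (act A M)) ` GL3 poly_ring_t"
proof -
  have "chamber_orbit (chamber M) =
    (\<lambda>\<gamma>. (pgl_act \<gamma> (homothety_class (M 0)), pgl_act \<gamma> (homothety_class (M 1)), pgl_act \<gamma> (homothety_class (M 2)))) ` Gamma"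
    unfolding chamber_orbit_def chamber_def by auto
  then show ?thesis
    unfolding Gamma_def PGL3_def image_image pgl_act_homothety chamber_def act_def .
qed

lemma mat1_GL3: "mat 1 \<in> GL3 (poly_ring_t :: 'k::field fls set)"
proof -
  have "\<forall>i j. (mat 1 :: 'k fls ^ 3 ^ 3) $ i $ j \<in> poly_ring_t" by (simp add: mat_def)
  then show ?thesis unfolding GL3_def using matrix_mul_lid by blast
qed

lemma act_mat1: "act (mat 1) M = M"
  by (simp add: act_def)

lemma chamber_mem_orbit: "chamber M \<in> chamber_orbit (chamber M)"
  unfolding chamber_orbit_eq by (rule image_eqI[OF _ mat1_GL3]) (simp add: act_mat1)

lemma act_GL3_chain: "lattice_chain M \<Longrightarrow> A \<in> GL3 poly_ring_t \<Longrightarrow> lattice_chain (act A M)"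
  by (meson GL3E act_chain)

lemma mem_orbit_iff:
  assumes M: "lattice_chain M" and M': "lattice_chain M'"
  shows "chamber M' \<in> chamber_orbit (chamber M) \<longleftrightarrow> st M' = st M"
proof
  assume "chamber M' \<in> chamber_orbit (chamber M)"
  then obtain A where A: "A \<in> GL3 poly_ring_t" "chamber M' = chamber (act A M)"
    unfolding chamber_orbit_eq by blast
  obtain k where "act A M = shift (3 * k) M'"
    using chamber_eqD[OF M' act_GL3_chain[OF M A(1)] A(2)] by blast
  then show "st M' = st M" using st_act[OF M A(1)] st_shift3[OF M', of k] by simp
next
  assume "st M' = st M"
  then obtain A k where A: "A \<in> GL3 poly_ring_t" "act A M = shift (3 * k) M'"
    using st_eq_imp[OF M M'] by metis
  then have "chamber M' = chamber (act A M)" using chamber_shift3[OF M', of k] by simp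
  then show "chamber M' \<in> chamber_orbit (chamber M)" unfolding chamber_orbit_eq using A(1) by blast
qed

lemma orbit_chain:
  assumes "lattice_chain M" "d \<in> chamber_orbit (chamber M)"
  shows "\<exists>M'. lattice_chain M' \<and> d = chamber M' \<and> st M' = st M"
  using assms act_GL3_chain[OF assms(1)] st_act[OF assms(1)] unfolding chamber_orbit_eq by blast

lemma orbit_eq_iff:
  assumes M: "lattice_chain M" and M': "lattice_chain M'"
  shows "chamber_orbit (chamber M') = chamber_orbit (chamber M) \<longleftrightarrow> st M' = st M"
proof
  assume "chamber_orbit (chamber M') = chamber_orbit (chamber M)"
  then show "st M' = st M" using chamber_mem_orbit[of M'] mem_orbit_iff[OF M M'] by simp
next
  assume eq: "st M' = st M"
  show "chamber_orbit (chamber M') = chamber_orbit (chamber M)"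
  proof (intro equalityI subsetI)
    fix d assume "d \<in> chamber_orbit (chamber M')"
    then obtain N where "lattice_chain N" "d = chamber N" "st N = st M'" using orbit_chain[OF M'] by blast
    then show "d \<in> chamber_orbit (chamber M)" using mem_orbit_iff[OF M] eq by simp
  next
    fix d assume "d \<in> chamber_orbit (chamber M)"
    then obtain N where "lattice_chain N" "d = chamber N" "st N = st M" using orbit_chain[OF M] by blast
    then show "d \<in> chamber_orbit (chamber M')" using mem_orbit_iff[OF M'] eq by simp
  qed
qed

definition rep :: "int \<times> int \<Rightarrow> int \<Rightarrow> ('k::field fls ^ 3) set" where
  "rep y = (SOME M. lattice_chain M \<and> st M = y)"

definition orb :: "int \<times> int \<Rightarrow> ('k::field fls ^ 3) set set triple set" where
  "orb y = chamber_orbit (chamber (rep y))"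

lemma rep_props: "lattice_chain (rep y :: int \<Rightarrow> ('k::field fls ^ 3) set) \<and> st (rep y :: int \<Rightarrow> ('k fls ^ 3) set) = y"
proof -
  have "\<exists>M :: int \<Rightarrow> ('k fls ^ 3) set. lattice_chain M \<and> st M = y"
    using st_surj[of "fst y" "snd y", where 'k = 'k] by simp
  from someI_ex[OF this] show ?thesis unfolding rep_def .
qed

lemmas rep = rep_props[THEN conjunct1] rep_props[THEN conjunct2]

lemma orb_st: "lattice_chain M \<Longrightarrow> chamber_orbit (chamber M) = orb (st M)"
  unfolding orb_def by (subst orbit_eq_iff) (simp_all add: rep)

lemma orb_inj: "inj orb"
  by (rule injI) (simp add: orb_def orbit_eq_iff rep)

lemma orb_range: "X_type1_chambers = range orb"
proof (intro equalityI subsetI)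
  fix c :: "('a fls ^ 3) set set triple set" assume "c \<in> X_type1_chambers"
  then obtain M where "lattice_chain M" "c = chamber_orbit (chamber M)"
    unfolding X_type1_chambers_def type1_eq by blast
  then show "c \<in> range orb" using orb_st by blast
next
  fix c :: "('a fls ^ 3) set set triple set" assume "c \<in> range orb"
  then show "c \<in> X_type1_chambers"
    unfolding X_type1_chambers_def type1_eq orb_def using rep(1) by blast
qed

abbreviation tailless_steps :: "('k::field fls ^ 3) set set triple \<Rightarrow> ('k fls ^ 3) set set triple set" where
  "tailless_steps d \<equiv> {d' \<in> type1_chambers. edge_adjacent d d' \<and> tailless d d'}"

text \<open>A neighbour chain is still indexed from the old base point; \<open>shift 1\<close> makes
  it start at the first vertex of the next chamber.\<close>

lemma tailless_steps_eq:
  assumes M: "lattice_chain M"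
  shows "tailless_steps (chamber M) = (\<lambda>N. chamber (shift 1 N)) ` nbrs M"
proof (intro equalityI subsetI)
  fix d' assume "d' \<in> tailless_steps (chamber M)"
  then obtain M' where M': "lattice_chain M'" "d' = chamber M'"
    and h: "homothety_class (M' 0) = homothety_class (M 1)" "homothety_class (M' 1) = homothety_class (M 2)"
      "homothety_class (M' 2) \<noteq> homothety_class (M 0)"
    unfolding type1_eq by (auto simp: chamber_def)
  obtain k where k: "M 1 = M' (0 + 3 * k)" using homothety_chainD[OF M'(1) h(1)] by blast
  \<comment> \<open>The shift by \<open>3 * k\<close> matches representatives, and the correction by
    1 places the first vertex of \<open>M'\<close> at index 1, where \<open>N\<close> can be
    compared with \<open>M\<close>.\<close>
  define N where "N = shift (3 * k - 1) M'"
  have N: "lattice_chain N" unfolding N_def by (rule shift_chain[OF M'(1)])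
  have s1: "shift 1 N = shift (3 * k) M'" by (simp add: N_def shift_def)
  have d': "d' = chamber (shift 1 N)" unfolding s1 M'(2) by (rule chamber_shift3[OF M'(1), symmetric])
  have cls: "homothety_class (N (m + 1)) = homothety_class (M' m)" for m
    using homothety_chain3[OF M'(1), of m k] by (simp add: N_def shift_def algebra_simps)
  have 1: "N 1 = M 1" using k by (simp add: N_def shift_def)
  have 2: "N (1 + 1) = M (1 + 1)"
    by (rule chain_sandwich[OF M N 1]) (use cls[of 1] h(2) in simp)
  have "N 3 \<noteq> M 3"
  proof
    assume "N 3 = M 3"
    then have "homothety_class (M' 2) = homothety_class (M 3)" using cls[of 2] by simp
    then show False using h(3) homothety_chain3[OF M, of 0 1] by simp
  qed
  then have "N \<in> nbrs M" using N 1 2 by (simp add: nbrs_def)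
  then show "d' \<in> (\<lambda>N. chamber (shift 1 N)) ` nbrs M" using d' by blast
next
  fix d' assume "d' \<in> (\<lambda>N. chamber (shift 1 N)) ` nbrs M"
  then obtain N where N: "lattice_chain N" "N 1 = M 1" "N 2 = M 2" "N 3 \<noteq> M 3" "d' = chamber (shift 1 N)"
    unfolding nbrs_def by blast
  have "homothety_class (N 3) \<noteq> homothety_class (M 0)"
  proof
    assume "homothety_class (N 3) = homothety_class (M 0)"
    then have "homothety_class (N (2 + 1)) = homothety_class (M (2 + 1))" using homothety_chain3[OF M, of 0 1] by simp
    then have "N (2 + 1) = M (2 + 1)" by (rule chain_sandwich[OF M N(1) N(3)])
    then show False using N(4) by simp
  qed
  moreover have "d' \<in> type1_chambers" unfolding type1_eq N(5) using shift_chain[OF N(1)] by blast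
  ultimately show "d' \<in> tailless_steps (chamber M)"
    using N by (simp add: chamber_def shift_def)
qed

lemma nbrs_chamber_inj:
  assumes M: "lattice_chain M"
  shows "inj_on (\<lambda>N. chamber (shift 1 N)) (nbrs M)"
proof (rule inj_onI)
  fix N N' assume N: "N \<in> nbrs M" and N': "N' \<in> nbrs M" and eq: "chamber (shift 1 N) = chamber (shift 1 N')"
  have c: "lattice_chain N" "lattice_chain N'" and e: "N' 1 = N 1" "N' 2 = N 2" using N N' by (auto simp: nbrs_def)
  have "homothety_class (N' (2 + 1)) = homothety_class (N (2 + 1))" using eq by (simp add: chamber_def shift_def)
  then have "N' (2 + 1) = N (2 + 1)" by (rule chain_sandwich[OF c e(2)])
  then have "N' = N" by (intro chains_eqI[OF c, of 1]) (use e in simp_all)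
  then show "N = N'" ..
qed

lemma card_steps:
  fixes M :: "int \<Rightarrow> ('k::{field,finite} fls ^ 3) set"
  assumes M: "lattice_chain M"
  shows "card {d' \<in> tailless_steps (chamber M). chamber_orbit d' = orb z} = wt CARD('k) (st M) z"
    and "finite (tailless_steps (chamber M))"
proof -
  obtain a b c where f: "pframe M a b c" using lattice_chain.ex_pframe[OF M] by blast
  interpret pframed_chain M a b c by (intro pframed_chain.intro M pframed_chain_axioms.intro f)
  have "chamber_orbit (chamber (shift 1 N)) = orb z \<longleftrightarrow> st (shift 1 N) = z" if "N \<in> nbrs M" for N
  proof -
    have "lattice_chain N" using that by (simp add: nbrs_def)
    then show ?thesis unfolding orb_st[OF shift_chain[OF \<open>lattice_chain N\<close>]] by (simp only: inj_eq[OF orb_inj])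
  qed
  then have "{d' \<in> tailless_steps (chamber M). chamber_orbit d' = orb z} =
      (\<lambda>N. chamber (shift 1 N)) ` {N \<in> nbrs M. st (shift 1 N) = z}"
    unfolding tailless_steps_eq[OF M] by blast
  then have "card {d' \<in> tailless_steps (chamber M). chamber_orbit d' = orb z} = card {N \<in> nbrs M. st (shift 1 N) = z}"
    using card_image[OF inj_on_subset[OF nbrs_chamber_inj[OF M]]] by simp
  then show "card {d' \<in> tailless_steps (chamber M). chamber_orbit d' = orb z} = wt CARD('k) (st M) z"
    using card_nbrs[of z] by simp
  show "finite (tailless_steps (chamber M))" unfolding tailless_steps_eq[OF M] nbrs_eq by simp
qed

lemma type1E:
  assumes "d \<in> type1_chambers"
  obtains M where "lattice_chain M" "d = chamber M"
  using assms unfolding type1_eq by blast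

text \<open>\<open>step_weight\<close> counts from a lift picked by \<open>SOME\<close>; every lift
  has invariant \<open>y\<close>, and the count depends on the invariant alone.\<close>

lemma step_weight_orb:
  "step_weight (orb y) (orb z :: ('k::{field,finite} fls ^ 3) set set triple set) = wt CARD('k) y z"
proof -
  define d where "d = (SOME d. d \<in> (orb y :: ('k fls ^ 3) set set triple set))"
  have "d \<in> orb y"
    unfolding d_def by (rule someI[of _ "chamber (rep y)"]) (simp add: orb_def chamber_mem_orbit)
  then obtain M where M: "lattice_chain M" "d = chamber M" "st M = y"
    unfolding orb_def using orbit_chain[OF rep(1)] rep(2) by metis
  have "step_weight (orb y) (orb z :: ('k fls ^ 3) set set triple set) =
      card {d' \<in> type1_chambers. edge_adjacent d d' \<and> chamber_orbit d' = orb z \<and> tailless d d'}"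
    unfolding step_weight_def Let_def d_def ..
  also have "{d' \<in> type1_chambers. edge_adjacent d d' \<and> chamber_orbit d' = orb z \<and> tailless d d'} =
      {d' \<in> tailless_steps (chamber M). chamber_orbit d' = orb z}"
    unfolding M(2) by auto
  finally have "step_weight (orb y) (orb z :: ('k fls ^ 3) set set triple set) = card {d' \<in> tailless_steps (chamber M). chamber_orbit d' = orb z}" .
  then show ?thesis using card_steps(1)[OF M(1), of z] M(3) by simp
qed

text \<open>With \<open>step_weight_lift\<close> this makes positivity of the weight equivalent to
  the existence of a tailless step above it, starting from any lift of the source. Finiteness
  matters, since \<open>card\<close> of an infinite set would be 0.\<close>

lemma step_weight_pos:
  fixes d d' :: "('k::{field,finite} fls ^ 3) set set triple"
  assumes "d \<in> type1_chambers" "d' \<in> type1_chambers" "edge_adjacent d d'" "tailless d d'"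
  shows "0 < step_weight (chamber_orbit d) (chamber_orbit d')"
proof -
  obtain M where M: "lattice_chain M" "d = chamber M" using assms(1) by (rule type1E)
  obtain M' where M': "lattice_chain M'" "d' = chamber M'" using assms(2) by (rule type1E)
  have "d' \<in> {d' \<in> tailless_steps (chamber M). chamber_orbit d' = orb (st M')}"
    using assms M M' orb_st by simp
  moreover have "finite {d' \<in> tailless_steps (chamber M). chamber_orbit d' = orb (st M')}"
    by (rule finite_subset[OF _ card_steps(2)[OF M(1)]]) blast
  ultimately have "0 < card {d' \<in> tailless_steps (chamber M). chamber_orbit d' = orb (st M')}"
    unfolding card_gt_0_iff by blast
  then show ?thesis
    unfolding M(2) M'(2) orb_st[OF M(1)] orb_st[OF M'(1)] step_weight_orb using card_steps(1)[OF M(1)] by simp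
qed

lemma step_weight_lift:
  fixes d :: "('k::{field,finite} fls ^ 3) set set triple"
  assumes "d \<in> type1_chambers" "0 < step_weight (chamber_orbit d) c'" "c' \<in> X_type1_chambers"
  obtains d' where "d' \<in> type1_chambers" "edge_adjacent d d'" "tailless d d'" "chamber_orbit d' = c'"
proof -
  obtain M where M: "lattice_chain M" "d = chamber M" using assms(1) by (rule type1E)
  obtain z where z: "c' = orb z" using assms(3) unfolding orb_range by blast
  have "0 < card {d' \<in> tailless_steps (chamber M). chamber_orbit d' = orb z}"
    using assms(2) unfolding M(2) z orb_st[OF M(1)] step_weight_orb card_steps(1)[OF M(1)] .
  then have "{d' \<in> tailless_steps (chamber M). chamber_orbit d' = orb z} \<noteq> {}" by (metis (no_types, lifting) card.empty less_irrefl)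
  then obtain d' where "d' \<in> {d' \<in> tailless_steps (chamber M). chamber_orbit d' = orb z}" by blast
  then show ?thesis using that[of d'] unfolding M(2) z by simp
qed

section \<open>Nonnegative kernels and their logarithmic determinants\<close>

text \<open>Sums against counting measure with values in \<open>ennreal\<close> may be interchanged
  over any index types without summability conditions; the whole determinant calculus relies on
  this.\<close>

abbreviation nsum :: "('a \<Rightarrow> ennreal) \<Rightarrow> ennreal" where
  "nsum f \<equiv> \<integral>\<^sup>+ x. f x \<partial>count_space UNIV"

lemma nsum_swap: "nsum (\<lambda>x. nsum (\<lambda>y. f x y)) = nsum (\<lambda>y. nsum (\<lambda>x. f x y))"
  using nn_integral_fst_count_space[of "\<lambda>(x, y). f x y"] nn_integral_snd_count_space[of "\<lambda>(x, y). f x y"]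
  by simp

lemma nsum_pair: "nsum (\<lambda>p. f (fst p) (snd p)) = nsum (\<lambda>x. nsum (\<lambda>y. f x y))"
  using nn_integral_fst_count_space[of "\<lambda>p. f (fst p) (snd p)"] by simp

lemma nsum_add: "nsum (\<lambda>x. f x + g x) = nsum f + nsum g"
  by (simp add: nn_integral_add)

lemma nsum_cmult: "nsum (\<lambda>x. c * f x) = c * nsum f"
  by (simp add: nn_integral_cmult)

lemma nsum_multc: "nsum (\<lambda>x. f x * c) = nsum f * c"
  by (simp add: nn_integral_multc)

lemma nsum_single: "(\<And>x. x \<noteq> a \<Longrightarrow> f x = 0) \<Longrightarrow> nsum f = f a"
  by (subst nn_integral_count_space'[where A = "{a}"]) auto

lemma nsum_delta [simp]: "nsum (\<lambda>x. of_bool (x = a) * f x) = f a" "nsum (\<lambda>x. of_bool (a = x) * f x) = f a"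
  "nsum (\<lambda>x. f x * of_bool (x = a)) = f a" "nsum (\<lambda>x. f x * of_bool (a = x)) = f a"
  by (subst nsum_single[of a]; simp)+

lemma nsum_finite:
  assumes "finite A" "\<And>x. x \<notin> A \<Longrightarrow> f x = 0"
  shows "nsum f = sum f A"
proof -
  have "nsum f = nn_integral (count_space A) f"
    using assms(2) by (intro nn_integral_count_space_eq) auto
  then show ?thesis using assms(1) by (simp add: nn_integral_count_space_finite)
qed

lemma nsum_sum: "nsum (\<lambda>x. \<Sum>i\<in>A. f i x) = (\<Sum>i\<in>A. nsum (f i))"
  by (simp add: nn_integral_sum)

lemma nsum_split: "nsum f = nsum (\<lambda>n. nsum (\<lambda>w. of_bool (h w = n) * f w))"
  by (subst nsum_swap) (simp add: nsum_multc)

lemma nsum_reindex: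
  assumes "inj g" "\<And>y. y \<notin> range g \<Longrightarrow> f y = 0"
  shows "nsum f = nsum (\<lambda>x. f (g x))"
proof -
  have "nsum f = nn_integral (count_space (range g)) f"
    using assms(2) by (intro nn_integral_count_space_eq) auto
  also have "\<dots> = nsum (\<lambda>x. f (g x))"
    using assms(1) by (intro nn_integral_bij_count_space[symmetric]) (simp add: bij_betw_def)
  finally show ?thesis .
qed

lemma nsum_cong: "(\<And>x. f x = g x) \<Longrightarrow> nsum f = nsum g"
  by (rule nn_integral_cong) simp

type_synonym 'v kernel = "'v \<Rightarrow> 'v \<Rightarrow> ennreal"

definition kc :: "'v kernel \<Rightarrow> 'v kernel \<Rightarrow> 'v kernel" (infixl "\<odot>" 70) where
  "(K \<odot> M) x z = nsum (\<lambda>y. K x y * M y z)"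

definition kone :: "'v kernel" where "kone x y = of_bool (x = y)"

definition kadd :: "'v kernel \<Rightarrow> 'v kernel \<Rightarrow> 'v kernel" (infixl "\<oplus>" 65) where
  "(K \<oplus> M) x y = K x y + M x y"

primrec kpow :: "'v kernel \<Rightarrow> nat \<Rightarrow> 'v kernel" where
  "kpow K 0 = kone" | "kpow K (Suc n) = K \<odot> kpow K n"

text \<open>The Neumann series for the inverse of \<open>1 - K\<close>; entries may be
  infinite.\<close>

definition kstar :: "'v kernel \<Rightarrow> 'v kernel" where
  "kstar K x y = nsum (\<lambda>n. kpow K n x y)"

definition ktr :: "'v kernel \<Rightarrow> ennreal" where "ktr K = nsum (\<lambda>x. K x x)"

text \<open>\<open>klog K\<close> stands for \<open>- log det (1 - K)\<close>.\<close>

definition klog :: "'v kernel \<Rightarrow> ennreal" where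
  "klog K = nsum (\<lambda>n. inverse (of_nat (Suc n)) * ktr (kpow K (Suc n)))"

lemma kc_assoc: "(K \<odot> M) \<odot> N = K \<odot> (M \<odot> N)"
proof (intro ext)
  fix x z
  have "((K \<odot> M) \<odot> N) x z = nsum (\<lambda>y. nsum (\<lambda>w. K x w * M w y * N y z))"
    by (simp add: kc_def nsum_multc)
  also have "\<dots> = nsum (\<lambda>w. nsum (\<lambda>y. K x w * (M w y * N y z)))"
    by (subst nsum_swap) (simp add: mult.assoc)
  finally show "((K \<odot> M) \<odot> N) x z = (K \<odot> (M \<odot> N)) x z" by (simp add: kc_def nsum_cmult)
qed

lemma kone_left [simp]: "kone \<odot> K = K" and kone_right [simp]: "K \<odot> kone = K"
  by (intro ext, simp add: kc_def kone_def)+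

lemma ktr_comm: "ktr (K \<odot> M) = ktr (M \<odot> K)"
  unfolding ktr_def kc_def by (subst nsum_swap) (simp add: mult.commute)

lemma kpow_comm_Suc: "kpow (K \<odot> M) (Suc n) = K \<odot> kpow (M \<odot> K) n \<odot> M"
  by (induction n) (simp_all add: kc_assoc)

text \<open>The identity det (1 - K M) = det (1 - M K): powers of the two products are conjugate up
  to one factor, and the trace is cyclic.\<close>

lemma klog_comm: "klog (K \<odot> M) = klog (M \<odot> K)"
proof -
  have "ktr (kpow (K \<odot> M) (Suc n)) = ktr (kpow (M \<odot> K) (Suc n))" for n
    unfolding kpow_comm_Suc[of K M] by (subst ktr_comm) (simp only: kc_assoc[symmetric] kpow.simps(2))
  then show ?thesis by (simp only: klog_def)
qed

definition kdiag :: "'v set \<Rightarrow> 'v kernel" where "kdiag D x y = of_bool (x = y \<and> x \<in> D)"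

lemma kdiag_left: "(kdiag D \<odot> K) x y = of_bool (x \<in> D) * K x y"
  and kdiag_right: "(K \<odot> kdiag D) x y = K x y * of_bool (y \<in> D)"
  unfolding kc_def kdiag_def by (subst nsum_single[of x]; simp) (subst nsum_single[of y]; simp)

text \<open>A closed walk never visits a vertex without outgoing weight, so entries leading to such
  a vertex can be erased.\<close>

lemma klog_restrict_rows:
  assumes "\<And>x y. x \<notin> D \<Longrightarrow> K x y = 0"
  shows "klog K = klog (\<lambda>x y. K x y * of_bool (y \<in> D))"
proof -
  have "K = kdiag D \<odot> K" using assms by (intro ext) (auto simp: kdiag_left)
  then have "klog K = klog (K \<odot> kdiag D)" using klog_comm by metis
  then show ?thesis by (simp only: kdiag_right[abs_def])
qed

lemma klog_restrict_cols:
  assumes "\<And>x y. y \<notin> D \<Longrightarrow> K x y = 0"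
  shows "klog K = klog (\<lambda>x y. of_bool (x \<in> D) * K x y)"
proof -
  have "K = K \<odot> kdiag D" using assms by (intro ext) (auto simp: kdiag_right)
  then have "klog K = klog (kdiag D \<odot> K)" using klog_comm by metis
  then show ?thesis by (simp only: kdiag_left[abs_def])
qed

text \<open>A nonzero diagonal entry of a power would come from a closed walk and put a pair
  \<open>(x, x)\<close> into the transitive relation \<open>r\<close>.\<close>

lemma klog_acyclic:
  assumes "\<And>x y. K x y \<noteq> 0 \<Longrightarrow> (x, y) \<in> r" "trans r" "irrefl r"
  shows "klog K = 0"
proof -
  have "kpow K (Suc n) x y \<noteq> 0 \<Longrightarrow> (x, y) \<in> r" for n x y
  proof (induction n arbitrary: x)
    case 0 then show ?case using assms(1) by simp
  next
    case (Suc n)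
    have "\<exists>z. K x z * kpow K (Suc n) z y \<noteq> 0"
    proof (rule ccontr)
      assume "\<nexists>z. K x z * kpow K (Suc n) z y \<noteq> 0"
      then have "(\<lambda>z. K x z * kpow K (Suc n) z y) = (\<lambda>_. 0)" by blast
      then have "kpow K (Suc (Suc n)) x y = 0"
        unfolding kpow.simps(2)[of K "Suc n"] kc_def by (simp only: nn_integral_const mult_zero_left)
      then show False using Suc.prems by simp
    qed
    then obtain z where "K x z \<noteq> 0" "kpow K (Suc n) z y \<noteq> 0" by auto
    then show ?case using Suc.IH assms(1,2) by (meson transD)
  qed
  then have "kpow K (Suc n) x x = 0" for n x using assms(3) by (meson irreflD)
  then show ?thesis by (simp add: klog_def ktr_def del: kpow.simps)
qed

text \<open>Powers of a rank one kernel are multiples of it. The result is the series of - log (1 -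
  c), where c is the sum of \<open>g x * f x\<close>.\<close>

lemma klog_rank1:
  "klog (\<lambda>x y. f x * g y) = nsum (\<lambda>n. inverse (of_nat (Suc n)) * nsum (\<lambda>x. g x * f x) ^ Suc n)"
proof -
  let ?K = "\<lambda>x y. f x * g y" and ?c = "nsum (\<lambda>x. g x * f x)"
  have "kpow ?K (Suc n) x y = ?c ^ n * (f x * g y)" for n x y
  proof (induction n arbitrary: x)
    case (Suc n)
    have "kpow ?K (Suc (Suc n)) x y = nsum (\<lambda>z. (f x * g z) * (?c ^ n * (f z * g y)))"
      unfolding kpow.simps(2)[of ?K "Suc n"] kc_def Suc.IH ..
    also have "\<dots> = nsum (\<lambda>z. (?c ^ n * (f x * g y)) * (g z * f z))" by (intro nsum_cong) (simp only: ac_simps)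
    also have "\<dots> = (?c ^ n * (f x * g y)) * ?c" by (rule nsum_cmult)
    finally show ?case by (simp only: power_Suc ac_simps)
  qed simp
  then have "ktr (kpow ?K (Suc n)) = nsum (\<lambda>x. ?c ^ n * (g x * f x))" for n
    unfolding ktr_def by (intro nsum_cong) (simp only: mult.commute[of "g _"])
  then have "ktr (kpow ?K (Suc n)) = ?c ^ Suc n" for n
    unfolding nsum_cmult power_Suc2 .
  then show ?thesis by (simp only: klog_def)
qed

section \<open>Words in two kernels and the determinant of a sum\<close>

context
  fixes X Y :: "'v kernel"
begin

text \<open>Noncommutative monomials: \<open>True\<close> stands for the letter \<open>Y\<close> and
  \<open>False\<close> for \<open>X\<close>.\<close>

primrec wk :: "bool list \<Rightarrow> 'v kernel" where
  "wk [] = kone" | "wk (b # w) = (if b then Y else X) \<odot> wk w"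

lemma wk_append: "wk (u @ w) = wk u \<odot> wk w"
  by (induction u) (simp_all add: kc_assoc)

lemma wk_replicate: "wk (replicate n False) = kpow X n"
  by (induction n) simp_all

lemma ktr_wk_rotate1: "ktr (wk (rotate1 w)) = ktr (wk w)"
proof (cases w)
  case (Cons b u)
  then show ?thesis using ktr_comm[of "wk u" "wk [b]"] wk_append[of u "[b]"] wk_append[of "[b]" u] by simp
qed simp

lemma ktr_wk_rotate: "ktr (wk (rotate m w)) = ktr (wk w)"
  by (induction m) (simp_all add: ktr_wk_rotate1)

lemma finite_len: "finite {w :: bool list. length w = n}"
  using finite_lists_length_eq[of "UNIV :: bool set" n] by simp

lemma kpow_add: "kpow (X \<oplus> Y) n x z = (\<Sum>w | length w = n. wk w x z)"
proof (induction n arbitrary: x)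
  case 0
  have "{w :: bool list. length w = 0} = {[]}" by auto
  then show ?case by simp
next
  case (Suc n)
  let ?A = "{w :: bool list. length w = n}"
  have "{w :: bool list. length w = Suc n} = (#) True ` ?A \<union> (#) False ` ?A"
    by (auto simp: length_Suc_conv image_iff)
  moreover have "(#) True ` ?A \<inter> (#) False ` ?A = {}" by auto
  ultimately have "(\<Sum>w | length w = Suc n. wk w x z) = (\<Sum>w\<in>(#) True ` ?A. wk w x z) + (\<Sum>w\<in>(#) False ` ?A. wk w x z)"
    using finite_len by (simp add: sum.union_disjoint)
  also have "\<dots> = (\<Sum>w\<in>?A. (Y \<odot> wk w) x z) + (\<Sum>w\<in>?A. (X \<odot> wk w) x z)"
    by (simp add: sum.reindex)
  also have "\<dots> = (\<Sum>w\<in>?A. nsum (\<lambda>y. (X \<oplus> Y) x y * wk w y z))"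
    by (simp add: kc_def kadd_def distrib_right nsum_add sum.distrib add.commute)
  also have "\<dots> = nsum (\<lambda>y. (X \<oplus> Y) x y * (\<Sum>w\<in>?A. wk w y z))"
    by (simp add: nsum_sum[symmetric] sum_distrib_left)
  finally show ?case using Suc.IH by (simp add: kc_def)
qed

definition cnt :: "bool list \<Rightarrow> nat" where "cnt w = length (filter id w)"

text \<open>These words factor uniquely into blocks consisting of \<open>Y\<close> and a run of
  \<open>X\<close>, one block for each of the \<open>j\<close> letters \<open>Y\<close>.\<close>

definition return_words :: "nat \<Rightarrow> bool list set" where "return_words j = {w. cnt w = j \<and> (w = [] \<or> hd w)}"

lemma cnt_simps [simp]: "cnt [] = 0" "cnt (b # w) = of_bool b + cnt w" "cnt (u @ w) = cnt u + cnt w"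
  "cnt (replicate i False) = 0" "cnt (rotate m w) = cnt w"
proof -
  have "cnt (rotate1 w) = cnt w" for w by (cases w) (auto simp: cnt_def)
  then show "cnt (rotate m w) = cnt w" by (induction m) simp_all
qed (auto simp: cnt_def)

definition blk :: "nat \<times> bool list \<Rightarrow> bool list" where
  "blk p = True # replicate (fst p) False @ snd p"

text \<open>A return word does not begin with \<open>X\<close>, so the run of \<open>X\<close> after
  the first letter is recovered by \<open>takeWhile\<close>.\<close>

lemma blk_inj: "fst p \<noteq> fst p' \<or> snd p \<noteq> snd p' \<Longrightarrow> snd p \<in> return_words j \<Longrightarrow> snd p' \<in> return_words j' \<Longrightarrow> blk p \<noteq> blk p'"
proof -
  have *: "takeWhile Not (replicate i False @ w) = replicate i False" "dropWhile Not (replicate i False @ w) = w"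
    if "w \<in> return_words j" for i w j
  proof -
    have w: "takeWhile Not w = []" "dropWhile Not w = w" using that by (cases w; simp add: return_words_def)+
    show "takeWhile Not (replicate i False @ w) = replicate i False" by (induction i) (simp_all add: w)
    show "dropWhile Not (replicate i False @ w) = w" by (induction i) (simp_all add: w)
  qed
  assume a: "fst p \<noteq> fst p' \<or> snd p \<noteq> snd p'" "snd p \<in> return_words j" "snd p' \<in> return_words j'"
  show ?thesis
  proof
    assume "blk p = blk p'"
    then have eq: "replicate (fst p) False @ snd p = replicate (fst p') False @ snd p'" by (simp add: blk_def)
    have "replicate (fst p) False = replicate (fst p') False"
      using arg_cong[OF eq, of "takeWhile Not"] unfolding *(1)[OF a(2)] *(1)[OF a(3)] .
    moreover have "snd p = snd p'"
      using arg_cong[OF eq, of "dropWhile Not"] unfolding *(2)[OF a(2)] *(2)[OF a(3)] .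
    ultimately show False using a(1) by simp
  qed
qed

lemma return_words_Suc: "return_words (Suc j) = blk ` (UNIV \<times> return_words j)"
proof (intro equalityI subsetI)
  fix w assume w: "w \<in> return_words (Suc j)"
  then obtain v where v: "w = True # v" "cnt v = j" by (cases w) (auto simp: return_words_def)
  have 1: "takeWhile Not v = replicate (length (takeWhile Not v)) False"
    by (metis (full_types) replicate_length_same set_takeWhileD)
  define u where "u = dropWhile Not v"
  have "v = takeWhile Not v @ u" by (simp add: u_def)
  then have v': "v = replicate (length (takeWhile Not v)) False @ u" using 1 by metis
  have "cnt u = j" using v(2) v' cnt_simps(3,4) by (metis add_0)
  moreover have "u = [] \<or> hd u" unfolding u_def using hd_dropWhile[of Not v] by auto
  ultimately have "u \<in> return_words j" by (simp add: return_words_def)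
  moreover have "w = blk (length (takeWhile Not v), u)" unfolding blk_def using v(1) v' by simp
  ultimately show "w \<in> blk ` (UNIV \<times> return_words j)" by blast
next
  fix w assume "w \<in> blk ` (UNIV \<times> return_words j)"
  then show "w \<in> return_words (Suc j)" by (auto simp: blk_def return_words_def)
qed

text \<open>Expanding every factor \<open>kstar X\<close> into powers of \<open>X\<close> produces
  one word for each choice of block lengths.\<close>

lemma kpow_return: "kpow (Y \<odot> kstar X) j x z = nsum (\<lambda>w. of_bool (w \<in> return_words j) * wk w x z)"
proof (induction j arbitrary: x)
  case 0
  have "return_words 0 = {[]}"
  proof -
    have "w = []" if "w \<in> return_words 0" for w using that by (cases w) (auto simp: return_words_def)
    then show ?thesis by (auto simp: return_words_def)
  qed
  then show ?case by simp
next
  case (Suc j)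
  have blk_wk: "wk (blk p) = Y \<odot> (kpow X (fst p) \<odot> wk (snd p))" for p
    by (simp add: blk_def wk_append wk_replicate kc_assoc)
  have "nsum (\<lambda>w. of_bool (w \<in> return_words (Suc j)) * wk w x z) = (\<integral>\<^sup>+w. wk w x z \<partial>count_space (return_words (Suc j)))"
    by (subst nn_integral_count_space_indicator) (auto simp: indicator_def ac_simps intro!: nn_integral_cong)
  also have "\<dots> = (\<integral>\<^sup>+p. wk (blk p) x z \<partial>count_space (UNIV \<times> return_words j))"
  proof (rule nn_integral_bij_count_space[symmetric])
    have "inj_on blk (UNIV \<times> return_words j)"
    proof (rule inj_onI, rule ccontr)
      fix p p' assume "p \<in> UNIV \<times> return_words j" "p' \<in> UNIV \<times> return_words j" "blk p = blk p'" "p \<noteq> p'"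
      then show False using blk_inj[of p p' j j] by (auto simp: prod_eq_iff)
    qed
    then show "bij_betw blk (UNIV \<times> return_words j) (return_words (Suc j))" unfolding bij_betw_def return_words_Suc by simp
  qed
  also have "\<dots> = nsum (\<lambda>p. of_bool (snd p \<in> return_words j) * wk (blk p) x z)"
    by (subst nn_integral_count_space_indicator) (auto simp: indicator_def mem_Times_iff ac_simps intro!: nn_integral_cong)
  also have "\<dots> = nsum (\<lambda>i. nsum (\<lambda>w. of_bool (w \<in> return_words j) * (Y \<odot> (kpow X i \<odot> wk w)) x z))"
    unfolding blk_wk by (rule nsum_pair)
  also have "\<dots> = nsum (\<lambda>i. nsum (\<lambda>w. nsum (\<lambda>y. (Y \<odot> kpow X i) x y * (of_bool (w \<in> return_words j) * wk w y z))))"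
    unfolding kc_assoc[symmetric] by (simp add: kc_def[of "Y \<odot> kpow X _"] nsum_cmult[symmetric] ac_simps)
  also have "\<dots> = nsum (\<lambda>i. nsum (\<lambda>y. (Y \<odot> kpow X i) x y * nsum (\<lambda>w. of_bool (w \<in> return_words j) * wk w y z)))"
    by (subst nsum_swap) (simp add: nsum_cmult)
  also have "\<dots> = nsum (\<lambda>i. nsum (\<lambda>y. (Y \<odot> kpow X i) x y * kpow (Y \<odot> kstar X) j y z))"
    by (simp only: Suc.IH)
  also have "\<dots> = nsum (\<lambda>y. nsum (\<lambda>i. (Y \<odot> kpow X i) x y) * kpow (Y \<odot> kstar X) j y z)"
    by (subst nsum_swap) (simp add: nsum_multc)
  also have "(\<lambda>y. nsum (\<lambda>i. (Y \<odot> kpow X i) x y)) = (\<lambda>y. (Y \<odot> kstar X) x y)"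
    unfolding kc_def kstar_def by (subst nsum_swap) (simp add: nsum_cmult)
  finally show ?case by (simp add: kc_def)
qed

end

context
  fixes X Y :: "'v kernel"
begin

private abbreviation "T w \<equiv> ktr (wk X Y w)"
private abbreviation "A n \<equiv> {w :: bool list. length w = n}"

definition "word_sum n j = (\<Sum>w\<in>A n. of_bool (cnt w = j) * T w)"
definition "return_sum n j = (\<Sum>w\<in>A n. of_bool (w \<in> return_words j) * T w)"

lemma rotate_bij: "i < n \<Longrightarrow> bij_betw (rotate i) (A n) (A n)"
  by (rule bij_betw_byWitness[where f' = "rotate (n - i)"]) (auto simp: rotate_rotate)

lemma cnt_sum: "of_nat (cnt w) = (\<Sum>i<length w. of_bool (w ! i) :: ennreal)"
  by (induction w) (simp_all add: sum.lessThan_Suc_shift del: sum.lessThan_Suc)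

text \<open>Double counting of pairs of a cyclic word and a marked letter \<open>Y\<close> in it.\<close>

lemma double_count: "of_nat j * word_sum n j = of_nat n * return_sum n j"
proof (cases n)
  case 0
  then show ?thesis by (auto simp: word_sum_def)
next
  case (Suc m)
  have "of_nat j * word_sum n j = (\<Sum>w\<in>A n. of_bool (cnt w = j) * T w * of_nat (cnt w))"
    unfolding word_sum_def sum_distrib_left by (intro sum.cong refl) (auto simp: mult.commute)
  also have "\<dots> = (\<Sum>w\<in>A n. \<Sum>i<n. of_bool (cnt w = j \<and> w ! i) * T w)"
  proof (rule sum.cong[OF refl])
    fix w assume w: "w \<in> A n"
    have "of_bool (cnt w = j) * T w * of_nat (cnt w) = (\<Sum>i<n. of_bool (cnt w = j) * T w * of_bool (w ! i))"
      using w unfolding cnt_sum sum_distrib_left by simp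
    also have "\<dots> = (\<Sum>i<n. of_bool (cnt w = j \<and> w ! i) * T w)"
      by (intro sum.cong refl) (cases "cnt w = j"; simp add: mult.commute)
    finally show "of_bool (cnt w = j) * T w * of_nat (cnt w) = (\<Sum>i<n. of_bool (cnt w = j \<and> w ! i) * T w)" .
  qed
  also have "\<dots> = (\<Sum>i<n. \<Sum>w\<in>A n. of_bool (cnt w = j \<and> w ! i) * T w)" by (rule sum.swap)
  \<comment> \<open>Rotation by \<open>i\<close> brings the marked letter to the front without
    changing the trace, so each position contributes the same sum.\<close>
  also have "\<dots> = (\<Sum>i<n. return_sum n j)"
  proof (rule sum.cong[OF refl])
    fix i assume i: "i \<in> {..<n}"
    have "return_sum n j = (\<Sum>w\<in>A n. of_bool (rotate i w \<in> return_words j) * T (rotate i w))"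
      unfolding return_sum_def by (rule sum.reindex_bij_betw[symmetric, OF rotate_bij]) (use i in simp)
    also have "\<dots> = (\<Sum>w\<in>A n. of_bool (cnt w = j \<and> w ! i) * T w)"
    proof (rule sum.cong[OF refl])
      fix w assume w: "w \<in> A n"
      then have ne: "w \<noteq> []" using Suc by auto
      have "hd (rotate i w) = w ! i" using hd_rotate_conv_nth[OF ne, of i] i w by simp
      then have "rotate i w \<in> return_words j \<longleftrightarrow> cnt w = j \<and> w ! i" using ne by (simp add: return_words_def)
      then show "of_bool (rotate i w \<in> return_words j) * T (rotate i w) = of_bool (cnt w = j \<and> w ! i) * T w"
        by (simp add: ktr_wk_rotate)
    qed
    finally show "(\<Sum>w\<in>A n. of_bool (cnt w = j \<and> w ! i) * T w) = return_sum n j" ..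
  qed
  finally show ?thesis by simp
qed

text \<open>Turns the weight 1 / length of a word into 1 / (number of its letters \<open>Y\<close>);
  the latter is the weight that \<open>klog\<close> attaches to a product of that many
  blocks.\<close>

lemma S_F: "inverse (of_nat (Suc n)) * word_sum (Suc n) (Suc j) = inverse (of_nat (Suc j)) * return_sum (Suc n) (Suc j)"
proof -
  have inv: "inverse (of_nat (Suc k)) * (of_nat (Suc k) * x) = x" for k and x :: ennreal
  proof -
    have "inverse (of_nat (Suc k)) * of_nat (Suc k) = (1 :: ennreal)"
      unfolding mult.commute[of "inverse _"] divide_ennreal_def[symmetric]
      by (rule ennreal_divide_self[OF _ of_nat_less_top]) (simp del: of_nat_Suc)
    then show ?thesis by (simp only: mult.assoc[symmetric] mult_1_left)
  qed
  have "inverse (of_nat (Suc n)) * word_sum (Suc n) (Suc j)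
      = inverse (of_nat (Suc n)) * (inverse (of_nat (Suc j)) * (of_nat (Suc j) * word_sum (Suc n) (Suc j)))"
    by (simp only: inv)
  also have "\<dots> = inverse (of_nat (Suc j)) * (inverse (of_nat (Suc n)) * (of_nat (Suc n) * return_sum (Suc n) (Suc j)))"
    by (simp only: double_count mult.left_commute)
  finally show ?thesis by (simp only: inv)
qed

lemma sum_T: "(\<Sum>w\<in>A n. T w) = word_sum n 0 + nsum (\<lambda>j. word_sum n (Suc j))"
proof -
  have "of_bool (cnt w = 0) * T w + nsum (\<lambda>j. of_bool (cnt w = Suc j) * T w) = T w" for w
  proof (cases "cnt w")
    case 0 then show ?thesis by simp
  next
    case (Suc k) then show ?thesis by simp
  qed
  then have "(\<Sum>w\<in>A n. T w) = (\<Sum>w\<in>A n. of_bool (cnt w = 0) * T w + nsum (\<lambda>j. of_bool (cnt w = Suc j) * T w))" by simp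
  also have "\<dots> = word_sum n 0 + nsum (\<lambda>j. word_sum n (Suc j))" by (simp only: sum.distrib word_sum_def nsum_sum)
  finally show ?thesis .
qed

lemma S_zero: "word_sum n 0 = ktr (kpow X n)"
proof -
  have "cnt w = 0 \<longleftrightarrow> w = replicate (length w) False" for w
    by (induction w) auto
  then have "word_sum n 0 = (\<Sum>w\<in>A n. of_bool (w = replicate n False) * T w)" unfolding word_sum_def by (intro sum.cong) auto
  also have "\<dots> = (\<Sum>w\<in>{replicate n False}. T w)"
    using finite_len[of n] by (intro sum.mono_neutral_cong_right) auto
  finally show ?thesis by (simp add: wk_replicate)
qed

lemma sum_F: "nsum (\<lambda>n. return_sum (Suc n) (Suc j)) = ktr (kpow (Y \<odot> kstar X) (Suc j))"
proof -
  have F_ns: "return_sum n j = nsum (\<lambda>w. of_bool (length w = n) * (of_bool (w \<in> return_words j) * T w))" for n j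
    unfolding return_sum_def by (subst nsum_finite[OF finite_len[of n]]) auto
  \<comment> \<open>A word containing \<open>Y\<close> is not empty, so the sum over all lengths may
    start at length 1.\<close>
  have F0: "return_sum 0 (Suc j) = 0" by (auto simp: return_sum_def return_words_def intro!: sum.neutral)
  have "nsum (\<lambda>n. return_sum (Suc n) (Suc j)) = nsum (\<lambda>n. return_sum n (Suc j))"
    by (rule nsum_reindex[symmetric]) (use F0 in \<open>auto simp: image_iff gr0_conv_Suc intro: ccontr\<close>, metis not0_implies_Suc)
  also have "\<dots> = nsum (\<lambda>w. of_bool (w \<in> return_words (Suc j)) * T w)"
    unfolding F_ns by (rule nsum_split[symmetric])
  also have "\<dots> = ktr (kpow (Y \<odot> kstar X) (Suc j))"
    unfolding ktr_def kpow_return nsum_cmult[symmetric] by (rule nsum_swap)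
  finally show ?thesis .
qed

text \<open>Closed words without \<open>Y\<close> give \<open>klog X\<close>. All others can be
  rotated to begin with \<open>Y\<close>, and cutting before each \<open>Y\<close> makes them closed
  words in the blocks of \<open>Y \<odot> kstar X\<close>.\<close>

theorem klog_add: "klog (X \<oplus> Y) = klog X + klog (Y \<odot> kstar X)"
proof -
  have "ktr (kpow (X \<oplus> Y) n) = (\<Sum>w\<in>A n. T w)" for n
    unfolding ktr_def kpow_add nsum_sum ..
  then have "klog (X \<oplus> Y) = nsum (\<lambda>n. inverse (of_nat (Suc n)) * ktr (kpow X (Suc n)) +
      nsum (\<lambda>j. inverse (of_nat (Suc j)) * return_sum (Suc n) (Suc j)))"
    unfolding klog_def by (simp only: sum_T S_zero distrib_left nsum_cmult[symmetric] S_F)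
  also have "\<dots> = klog X + nsum (\<lambda>n. nsum (\<lambda>j. inverse (of_nat (Suc j)) * return_sum (Suc n) (Suc j)))"
    unfolding klog_def by (rule nsum_add)
  also have "nsum (\<lambda>n. nsum (\<lambda>j. inverse (of_nat (Suc j)) * return_sum (Suc n) (Suc j))) = klog (Y \<odot> kstar X)"
    unfolding klog_def sum_F[symmetric] nsum_cmult[symmetric] by (rule nsum_swap)
  finally show ?thesis .
qed

end

lemma nsum_nat_Suc: "nsum f = f 0 + nsum (\<lambda>n. f (Suc n))"
proof -
  have "nsum f = nsum (\<lambda>n. of_bool (n = 0) * f n + of_bool (n \<noteq> 0) * f n)" by (rule nsum_cong) simp
  also have "\<dots> = f 0 + nsum (\<lambda>n. of_bool (n \<noteq> 0) * f n)" by (simp only: nsum_add nsum_delta)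
  also have "nsum (\<lambda>n. of_bool (n \<noteq> 0) * f n) = nsum (\<lambda>n. of_bool (Suc n \<noteq> 0) * f (Suc n))"
    by (rule nsum_reindex) (auto simp: image_iff gr0_conv_Suc)
  finally show ?thesis by simp
qed

lemma kstar_left: "kstar X = kone \<oplus> (X \<odot> kstar X)"
proof (intro ext)
  fix x z
  have "kstar X x z = kpow X 0 x z + nsum (\<lambda>n. kpow X (Suc n) x z)"
    unfolding kstar_def by (rule nsum_nat_Suc)
  also have "nsum (\<lambda>n. kpow X (Suc n) x z) = (X \<odot> kstar X) x z"
    unfolding kstar_def kc_def kpow.simps nsum_cmult[symmetric] by (rule nsum_swap)
  finally show "kstar X x z = (kone \<oplus> (X \<odot> kstar X)) x z" by (simp add: kadd_def)
qed

lemma kstar_right: "kstar X = kone \<oplus> (kstar X \<odot> X)"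
proof -
  have comm: "X \<odot> kpow X n = kpow X n \<odot> X" for n
  proof (induction n)
    case (Suc n)
    have "X \<odot> (X \<odot> kpow X n) = X \<odot> (kpow X n \<odot> X)" by (simp only: Suc.IH)
    then show ?case by (simp only: kpow.simps kc_assoc)
  qed simp
  have "X \<odot> kstar X = kstar X \<odot> X"
  proof (intro ext)
    fix x z
    have "(X \<odot> kstar X) x z = nsum (\<lambda>n. (X \<odot> kpow X n) x z)"
      unfolding kstar_def kc_def nsum_cmult[symmetric] by (rule nsum_swap)
    also have "\<dots> = (kstar X \<odot> X) x z"
      unfolding comm by (simp only: kstar_def kc_def nsum_multc[symmetric]) (rule nsum_swap)
    finally show "(X \<odot> kstar X) x z = (kstar X \<odot> X) x z" .
  qed
  then show ?thesis using kstar_left by metis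
qed

section \<open>The weighted quotient graph\<close>

text \<open>The quadrants of the plane of invariants: both coordinates positive, only the first,
  only the second, none. Arguments are distances from the axes in coordinate order, so
  \<open>VU x s\<close> and \<open>VD s x\<close> are mirror images.\<close>

datatype vx = VP nat nat | VU nat nat | VD nat nat | VN nat nat

text \<open>Intended values are u for \<open>e\<close>, q u for \<open>Q\<close> and (q - 1) u for
  \<open>R\<close>. The relation \<open>eRQ\<close> says that every vertex has total outgoing weight
  \<open>Q\<close>, and it is what makes the later recursions geometric.\<close>

locale strip_graph =
  fixes e Q R :: ennreal
  assumes eRQ: "e + R = Q"
begin

fun step :: "vx kernel" where
  "step (VP 0 b) v = Q * of_bool (v = VU b 0)"
| "step (VP (Suc a) b) v = Q * of_bool (v = VP b a)"
| "step (VU 0 s) v = Q * of_bool (v = VN s 0)"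
| "step (VU (Suc x) s) v = Q * of_bool (v = VD s x)"
| "step (VD s x) v = e * of_bool (v = VU x (Suc s)) + R * of_bool (v = VP (x + s + 1) s)"
| "step (VN a b) v = e * of_bool (v = VN b (Suc a)) +
     R * of_bool (v = (if b \<le> a then VP (a - b) a else VD (b - a - 1) a))"

definition isP :: "vx \<Rightarrow> bool" where "isP v \<longleftrightarrow> (\<exists>a b. v = VP a b)"

lemma isP_simps [simp]: "isP (VP a b)" "\<not> isP (VU x s)" "\<not> isP (VD s x)" "\<not> isP (VN a b)"
  by (auto simp: isP_def)

section \<open>Elimination of the positive quadrant\<close>

definition X0 :: "vx kernel" where "X0 v v' = of_bool (isP v) * step v v'"
definition Y0 :: "vx kernel" where "Y0 v v' = of_bool (\<not> isP v) * step v v'"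

text \<open>Inside the positive quadrant each step lowers the sum of the parameters, and a walk that
  has left it has no further \<open>X0\<close> weight.\<close>

lemma klog_X0: "klog X0 = 0"
proof (rule klog_acyclic)
  define m where "m v = (case v of VP a b \<Rightarrow> Suc (a + b) | _ \<Rightarrow> 0)" for v
  show "trans {(v, v'). m v' < m v}" "irrefl {(v, v'). m v' < m v}"
    by (auto simp: trans_def irrefl_def)
  fix v v' assume "X0 v v' \<noteq> 0"
  then obtain a b where v: "v = VP a b" and s: "step (VP a b) v' \<noteq> 0" by (auto simp: X0_def isP_def)
  then show "(v, v') \<in> {(v, v'). m v' < m v}" by (cases a) (auto simp: m_def split: if_splits)
qed

lemma star_X0_nonP: "\<not> isP v \<Longrightarrow> kstar X0 v v' = of_bool (v = v')"
  by (subst kstar_left) (simp add: kadd_def kone_def kc_def X0_def)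

text \<open>The walk from \<open>VP a b\<close> is forced. Two steps lower both parameters by 1, so
  it leaves through an axis at the difference of the parameters; the exponent of \<open>Q\<close>
  counts the steps.\<close>

lemma star_X0_P:
  assumes "\<not> isP v"
  shows "kstar X0 (VP a b) v =
    (if a \<le> b then Q ^ (2 * a + 1) * of_bool (v = VU (b - a) 0) else Q ^ (2 * b + 2) * of_bool (v = VU (a - b - 1) 0))"
proof (induction "a + b" arbitrary: a b rule: less_induct)
  case less
  have ne: "VP a b \<noteq> v" using assms by auto
  show ?case
  proof (cases a)
    case 0
    have "(X0 \<odot> kstar X0) (VP 0 b) v = nsum (\<lambda>y. of_bool (y = VU b 0) * (Q * kstar X0 y v))"
      unfolding kc_def by (intro nsum_cong) (simp add: X0_def)
    also have "\<dots> = Q * kstar X0 (VU b 0) v" by (rule nsum_delta)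
    finally show ?thesis using ne 0
      by (subst kstar_left) (auto simp: kadd_def kone_def star_X0_nonP)
  next
    case (Suc a')
    have "(X0 \<odot> kstar X0) (VP a b) v = nsum (\<lambda>y. of_bool (y = VP b a') * (Q * kstar X0 y v))"
      unfolding kc_def Suc by (intro nsum_cong) (simp add: X0_def)
    also have "\<dots> = Q * kstar X0 (VP b a') v" by (rule nsum_delta)
    finally have "kstar X0 (VP a b) v = Q * kstar X0 (VP b a') v"
      using ne by (subst kstar_left) (simp add: kadd_def kone_def)
    also have "kstar X0 (VP b a') v = (if b \<le> a' then Q ^ (2 * b + 1) * of_bool (v = VU (a' - b) 0)
        else Q ^ (2 * a' + 2) * of_bool (v = VU (b - a' - 1) 0))"
      by (rule less) (simp add: Suc)
    finally show ?thesis by (simp add: Suc mult.assoc[symmetric])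
  qed
qed

text \<open>\<open>X1\<close> keeps the direct steps outside the positive quadrant, while
  \<open>Y1\<close> replaces each excursion into it by its exit computed in
  \<open>star_X0_P\<close>. Every excursion ends in some \<open>VU x 0\<close>; these vertices are
  the ones that survive the next elimination.\<close>

fun X1 :: "vx kernel" where
  "X1 (VP a b) v = 0"
| "X1 (VU 0 s) v = Q * of_bool (v = VN s 0)"
| "X1 (VU (Suc x) s) v = Q * of_bool (v = VD s x)"
| "X1 (VD s x) v = e * of_bool (v = VU x (Suc s))"
| "X1 (VN a b) v = e * of_bool (v = VN b (Suc a)) + R * of_bool (a < b \<and> v = VD (b - a - 1) a)"

fun Y1 :: "vx kernel" where
  "Y1 (VD s x) v = R * Q ^ (2 * s + 2) * of_bool (v = VU x 0)"
| "Y1 (VN a b) v = R * Q ^ (2 * (a - b) + 1) * of_bool (b \<le> a \<and> v = VU b 0)"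
| "Y1 (VU x s) v = 0"
| "Y1 (VP a b) v = 0"

lemma Y0_star: "(Y0 \<odot> kstar X0) v v' * of_bool (\<not> isP v') = (X1 \<oplus> Y1) v v'"
proof (cases "isP v'")
  case True
  have "X1 v v' = 0" by (cases "(v, v')" rule: X1.cases) (use True in auto)
  moreover have "Y1 v v' = 0" by (cases "(v, v')" rule: Y1.cases) (use True in auto)
  ultimately show ?thesis using True by (simp add: kadd_def)
next
  case False
  note star = star_X0_nonP star_X0_P[OF False]
  have dl: "nsum (\<lambda>y. c * of_bool (y = a) * f y) = c * f a" for c a and f :: "vx \<Rightarrow> ennreal"
    by (subst nsum_single[of a]) auto
  show ?thesis
  proof (cases "(v, v')" rule: step.cases)
    case (5 s x w)
    have "(Y0 \<odot> kstar X0) v v' = e * kstar X0 (VU x (Suc s)) v' + R * kstar X0 (VP (x + s + 1) s) v'"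
      using 5 by (simp add: kc_def Y0_def distrib_right nsum_add dl)
    then show ?thesis using 5 False by (auto simp: star kadd_def)
  next
    case (6 a b w)
    let ?t = "if b \<le> a then VP (a - b) a else VD (b - a - 1) a"
    have "(Y0 \<odot> kstar X0) v v' = e * kstar X0 (VN b (Suc a)) v' + R * kstar X0 ?t v'"
      using 6 by (simp only: kc_def Y0_def prod.inject) (simp add: distrib_right nsum_add dl)
    moreover have "b \<le> a \<Longrightarrow> kstar X0 (VP (a - b) a) v' = Q ^ (2 * (a - b) + 1) * of_bool (v' = VU b 0)"
      by (simp add: star(2))
    ultimately show ?thesis using 6 False
      by (cases "b \<le> a") (simp_all add: star(1) kadd_def mult.assoc[symmetric])
  qed (use False in \<open>auto simp: kc_def Y0_def dl star kadd_def\<close>)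
qed

lemma klog_step: "klog step = klog (X1 \<oplus> Y1)"
proof -
  have "step = X0 \<oplus> Y0" by (intro ext) (simp add: kadd_def X0_def Y0_def)
  then have "klog step = klog (Y0 \<odot> kstar X0)" by (simp add: klog_add klog_X0)
  also have "\<dots> = klog (\<lambda>v v'. (Y0 \<odot> kstar X0) v v' * of_bool (v' \<in> {v. \<not> isP v}))"
    by (rule klog_restrict_rows) (simp add: kc_def Y0_def)
  finally show ?thesis by (simp add: Y0_star)
qed

text \<open>The first component of the rank is the number of a strip. Within a strip a walk goes
  from \<open>VU\<close>, possibly through \<open>VN\<close> where the third component counts its
  position, towards \<open>VD\<close>; only the step from \<open>VD\<close> to \<open>VU\<close>
  changes the strip, and it raises the number.\<close>

lemma klog_X1: "klog X1 = 0"
proof (rule klog_acyclic)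
  define m where "m v = (case v of VU x s \<Rightarrow> (s, 0::nat, 0) | VD s x \<Rightarrow> (s, 2, 0) | VP a b \<Rightarrow> (0, 0, 0)
    | VN a b \<Rightarrow> if b \<le> a then (a - b, 1, 2 * b) else (b - a - 1, 1, 2 * a + 1))" for v
  define r where "r = inv_image (less_than <*lex*> less_than <*lex*> less_than) m"
  show "trans r" unfolding r_def by (intro trans_inv_image trans_lex_prod trans_less_than)
  have "wf r" unfolding r_def by (intro wf_inv_image wf_lex_prod wf_less_than)
  then show "irrefl r" by (simp add: irrefl_def)
  fix v v' assume "X1 v v' \<noteq> 0"
  then show "(v, v') \<in> r"
    by (cases "(v, v')" rule: X1.cases) (auto simp: r_def m_def split: if_splits)
qed

section \<open>Weights of walks through the strips\<close>

definition \<rho> :: "nat \<Rightarrow> vx \<Rightarrow> ennreal" where "\<rho> b v = kstar X1 (VU b 0) v"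

text \<open>Decomposition by the last step; the lemmas that follow list the edges entering each kind
  of vertex.\<close>

lemma rho_rec: "\<rho> b v = of_bool (v = VU b 0) + nsum (\<lambda>y. \<rho> b y * X1 y v)"
  unfolding \<rho>_def by (subst kstar_right) (auto simp: kadd_def kone_def kc_def)

lemma rho_U0: "\<rho> b (VU x 0) = of_bool (x = b)"
proof -
  have "X1 y (VU x 0) = 0" for y by (cases "(y, VU x 0)" rule: X1.cases) auto
  then show ?thesis by (subst rho_rec) simp
qed

lemma rho_USuc: "\<rho> b (VU x (Suc s)) = e * \<rho> b (VD s x)"
proof -
  have "X1 y (VU x (Suc s)) = e * of_bool (y = VD s x)" for y
    by (cases "(y, VU x (Suc s))" rule: X1.cases) auto
  then show ?thesis by (subst rho_rec) (simp add: mult.left_commute[of _ e] nsum_cmult)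
qed

lemma rho_D: "\<rho> b (VD s x) = Q * \<rho> b (VU (Suc x) s) + R * \<rho> b (VN x (x + s + 1))"
proof -
  have "X1 y (VD s x) = Q * of_bool (y = VU (Suc x) s) + R * of_bool (y = VN x (x + s + 1))" for y
    by (cases "(y, VD s x)" rule: X1.cases) auto
  then show ?thesis
    by (subst rho_rec) (simp add: distrib_left nsum_add mult.left_commute[of _ Q] mult.left_commute[of _ R] nsum_cmult)
qed

lemma rho_N0: "\<rho> b (VN a 0) = Q * \<rho> b (VU 0 a)"
proof -
  have "X1 y (VN a 0) = Q * of_bool (y = VU 0 a)" for y
    by (cases "(y, VN a 0)" rule: X1.cases) auto
  then show ?thesis by (subst rho_rec) (simp add: mult.left_commute[of _ Q] nsum_cmult)
qed

lemma rho_NSuc: "\<rho> b (VN a (Suc c)) = e * \<rho> b (VN c a)"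
proof -
  have "X1 y (VN a (Suc c)) = e * of_bool (y = VN c a)" for y
    by (cases "(y, VN a (Suc c))" rule: X1.cases) auto
  then show ?thesis by (subst rho_rec) (simp add: mult.left_commute[of _ e] nsum_cmult)
qed

lemma rho_N: "\<rho> b (VN (s + i) i) = e ^ (2 * i) * \<rho> b (VN s 0)"
  and rho_N': "\<rho> b (VN i (i + s + 1)) = e ^ (2 * i + 1) * \<rho> b (VN s 0)"
proof -
  show *: "\<rho> b (VN (s + i) i) = e ^ (2 * i) * \<rho> b (VN s 0)" for i
  proof (induction i)
    case (Suc i)
    have "\<rho> b (VN (s + Suc i) (Suc i)) = e * (e * \<rho> b (VN (s + i) i))"
      using rho_NSuc[of b "s + Suc i" i] rho_NSuc[of b i "s + i"] by simp
    then show ?case by (simp add: Suc.IH mult.assoc)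
  qed simp
  show "\<rho> b (VN i (i + s + 1)) = e ^ (2 * i + 1) * \<rho> b (VN s 0)"
    using rho_NSuc[of b i "s + i"] *[of i] by (simp add: ac_simps)
qed

lemma rho_U_rec:
  "\<rho> b (VU x (Suc s)) = e * (Q * \<rho> b (VU (Suc x) s) + R * (e ^ (2 * x + 1) * (Q * \<rho> b (VU 0 s))))"
  unfolding rho_USuc rho_D rho_N' rho_N0 ..

text \<open>Up to the corner \<open>VU 0 b\<close> only one walk exists, along the diagonal
  \<open>x + s = b\<close>, and each strip costs \<open>e * Q\<close>.\<close>

lemma rho_U_low: "s \<le> b \<Longrightarrow> \<rho> b (VU x s) = of_bool (x + s = b) * (e * Q) ^ s"
  by (induction s arbitrary: x) (auto simp: rho_U0 rho_U_rec ac_simps)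

text \<open>Behind the corner the weights have the profile \<open>e ^ (2 * x)\<close> along a strip.
  The recursion preserves this profile and multiplies it by
  \<open>e ^ 2 * Q * (e + R) = e ^ 2 * Q ^ 2\<close>.\<close>

lemma rho_U_high: "\<rho> b (VU x (Suc b + i)) = e ^ (2 * x) * (R * Q * e ^ 2 * (e * Q) ^ b * (e ^ 2 * Q ^ 2) ^ i)"
proof (induction i arbitrary: x)
  case 0
  show ?case by (simp add: rho_U_rec rho_U_low power2_eq_square ac_simps)
next
  case (Suc i)
  let ?\<mu> = "R * Q * e ^ 2 * (e * Q) ^ b * (e ^ 2 * Q ^ 2) ^ i"
  have "\<rho> b (VU x (Suc b + Suc i)) = e * (Q * (e ^ (2 * Suc x) * ?\<mu>) + R * (e ^ (2 * x + 1) * (Q * (e ^ (2 * 0) * ?\<mu>))))"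
    using rho_U_rec[of b x "Suc b + i"] unfolding Suc.IH by simp
  also have "\<dots> = e ^ (2 * x) * (e ^ 2 * Q * (e + R) * ?\<mu>)"
    by (simp add: power2_eq_square algebra_simps)
  finally show ?case unfolding eRQ by (simp add: power2_eq_square ac_simps)
qed

text \<open>The ratio combines the factor \<open>e ^ 2 * Q ^ 2\<close> for passing a strip with the
  factor \<open>Q ^ 2\<close> by which the excursion back gets longer. In closed form it is 1 / (1 -
  q^4 u^6).\<close>

definition G :: ennreal where "G = nsum (\<lambda>i. (e ^ 2 * Q ^ 4) ^ i)"

lemma nsum_nat_split: "nsum f = (\<Sum>i<n. f i) + nsum (\<lambda>i. f (n + i))" for n :: nat
proof (induction n)
  case (Suc n)
  have "nsum (\<lambda>i. f (n + i)) = f n + nsum (\<lambda>i. f (Suc n + i))"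
    by (subst nsum_nat_Suc) simp
  then show ?case using Suc.IH by (simp add: add.assoc)
qed simp

lemma sum_low: "(\<Sum>s<Suc b. f s * \<rho> b (VU x s)) = of_bool (x \<le> b) * (f (b - x) * (e * Q) ^ (b - x))"
proof -
  have "(\<Sum>s<Suc b. f s * \<rho> b (VU x s)) = (\<Sum>s<Suc b. if s = b - x then of_bool (x \<le> b) * (f s * (e * Q) ^ s) else 0)"
    by (rule sum.cong) (auto simp: rho_U_low)
  also have "\<dots> = of_bool (x \<le> b) * (f (b - x) * (e * Q) ^ (b - x))"
    by (simp only: sum.delta finite_lessThan) auto
  finally show ?thesis .
qed

text \<open>The constant remaining in \<open>K2_eq\<close> after \<open>(e * Q ^ 3) ^ b\<close> and
  \<open>e ^ (2 * c)\<close> are taken out. The first summand collects returns from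
  \<open>VD\<close> entered from \<open>VU\<close>; in the second, the factor
  \<open>1 + Q * R * e\<close> stands for returning from \<open>VN\<close> directly or by way of
  \<open>VD\<close>.\<close>

definition \<kappa> :: ennreal where
  "\<kappa> = R ^ 2 * Q ^ 6 * e ^ 4 * G + R * (1 + Q * R * e) * Q ^ 2 * (1 + R * Q ^ 3 * e ^ 2 * G)"

text \<open>Among the strips up to \<open>b\<close> only the one on the diagonal contributes; those
  beyond \<open>b\<close> form a geometric series.\<close>

lemma sum_U: "nsum (\<lambda>s. Q ^ (2 * s + k) * \<rho> b (VU x s)) =
    of_bool (x \<le> b) * (Q ^ (2 * (b - x) + k) * (e * Q) ^ (b - x)) +
    e ^ (2 * x) * (e * Q ^ 3) ^ b * (Q ^ k * R * Q ^ 3 * e ^ 2 * G)"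
proof -
  have 1: "Q ^ (2 * (Suc b + i) + k) * \<rho> b (VU x (Suc b + i)) =
     (e ^ (2 * x) * (e * Q ^ 3) ^ b * (Q ^ k * R * Q ^ 3 * e ^ 2)) * (e ^ 2 * Q ^ 4) ^ i" for i
  proof -
    have q: "Q ^ (2 * (Suc b + i) + k) = Q ^ 2 * (Q ^ 2) ^ b * (Q ^ 2) ^ i * Q ^ k"
      by (simp add: power_add power_mult algebra_simps power2_eq_square)
    have 3: "e * Q ^ 3 = (e * Q) * Q ^ 2" "e ^ 2 * Q ^ 4 = (e ^ 2 * Q ^ 2) * Q ^ 2" "Q ^ 3 = Q ^ 2 * Q"
      by (simp_all add: power2_eq_square power3_eq_cube power4_eq_xxxx ac_simps)
    show ?thesis unfolding rho_U_high q 3(1,2)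
      unfolding power_mult_distrib[of "e * Q" "Q ^ 2"] power_mult_distrib[of "e ^ 2 * Q ^ 2" "Q ^ 2"]
      unfolding 3(3) by (simp only: ac_simps)
  qed
  have "nsum (\<lambda>s. Q ^ (2 * s + k) * \<rho> b (VU x s)) = (\<Sum>s<Suc b. Q ^ (2 * s + k) * \<rho> b (VU x s)) +
      nsum (\<lambda>i. Q ^ (2 * (Suc b + i) + k) * \<rho> b (VU x (Suc b + i)))"
    by (rule nsum_nat_split)
  then show ?thesis unfolding sum_low 1 nsum_cmult G_def by (simp only: mult.assoc)
qed

definition K2 :: "vx kernel" where "K2 = kstar X1 \<odot> Y1"

lemma klog_step2: "klog step = klog K2"
  unfolding klog_step klog_add klog_X1 K2_def by (subst klog_comm) simp

text \<open>The triangular term comes from walks that jump back from \<open>VD\<close> before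
  reaching the corner \<open>VU 0 b\<close>. All others pass that corner, and what follows depends
  on \<open>b\<close> only through the factor \<open>Q ^ (2 * b)\<close>; hence their total is a
  function of \<open>b\<close> times a function of \<open>c\<close>.\<close>

lemma K2_eq: "K2 (VU b 0) (VU c 0) = of_bool (c < b) * (R * Q ^ 3 * (e * Q ^ 3) ^ (b - c - 1)) + (e * Q ^ 3) ^ b * (\<kappa> * e ^ (2 * c))"
proof -
  \<comment> \<open>The entries into \<open>VU c 0\<close> are sorted by the strip \<open>s\<close>
    from which the return starts.\<close>
  have Y: "Y1 v (VU c 0) = nsum (\<lambda>s. R * Q ^ (2 * s + 2) * of_bool (v = VD s c)) +
      nsum (\<lambda>s. R * Q ^ (2 * s + 1) * of_bool (v = VN (c + s) c))" for v
  proof (cases "(v, VU c 0)" rule: Y1.cases)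
    case (1 s x w)
    have "nsum (\<lambda>s'. R * Q ^ (2 * s' + 2) * of_bool (v = VD s' c)) = R * Q ^ (2 * s + 2) * of_bool (v = VD s c)"
      by (rule nsum_single) (use 1 in auto)
    then show ?thesis using 1 by auto
  next
    case (2 a b' w)
    have "nsum (\<lambda>s. R * Q ^ (2 * s + 1) * of_bool (v = VN (c + s) c)) =
        R * Q ^ (2 * (a - c) + 1) * of_bool (v = VN (c + (a - c)) c)"
      by (rule nsum_single) (use 2 in auto)
    then show ?thesis using 2 by auto
  qed auto
  have "K2 (VU b 0) (VU c 0) = nsum (\<lambda>v. \<rho> b v * Y1 v (VU c 0))"
    by (simp add: K2_def kc_def \<rho>_def)
  also have "\<dots> = nsum (\<lambda>s. nsum (\<lambda>v. (\<rho> b v * (R * Q ^ (2 * s + 2))) * of_bool (v = VD s c))) +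
      nsum (\<lambda>s. nsum (\<lambda>v. (\<rho> b v * (R * Q ^ (2 * s + 1))) * of_bool (v = VN (c + s) c)))"
    unfolding Y distrib_left nsum_add nsum_cmult[symmetric] mult.assoc[symmetric]
    by (intro arg_cong2[of _ _ _ _ "(+)"] nsum_swap)
  also have "\<dots> = nsum (\<lambda>s. \<rho> b (VD s c) * (R * Q ^ (2 * s + 2))) + nsum (\<lambda>s. \<rho> b (VN (c + s) c) * (R * Q ^ (2 * s + 1)))"
    by (simp only: nsum_delta)
  also have "\<dots> = nsum (\<lambda>s. R * (Q ^ (2 * s + 3) * \<rho> b (VU (Suc c) s)) +
      e ^ (2 * c) * (R * (1 + Q * R * e)) * (Q ^ (2 * s + 2) * \<rho> b (VU 0 s)))"
    unfolding nsum_add[symmetric]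
  proof (rule nsum_cong)
    fix s
    have "\<rho> b (VN (c + s) c) = e ^ (2 * c) * (Q * \<rho> b (VU 0 s))" using rho_N[of b s c] rho_N0 by (simp add: add.commute)
    moreover have "\<rho> b (VD s c) = Q * \<rho> b (VU (Suc c) s) + R * (e ^ (2 * c + 1) * (Q * \<rho> b (VU 0 s)))"
      unfolding rho_D rho_N' rho_N0 ..
    moreover have "Q ^ (2 * s + 3) = Q * Q ^ (2 * s + 2)"
      using power_Suc[of Q "2 * s + 2"] by (simp del: power_Suc add: numeral_3_eq_3)
    moreover have "Q ^ (2 * s + 2) = Q * Q ^ (2 * s + 1)" "e ^ (2 * c + 1) = e * e ^ (2 * c)"
      by simp_all
    ultimately show "\<rho> b (VD s c) * (R * Q ^ (2 * s + 2)) + \<rho> b (VN (c + s) c) * (R * Q ^ (2 * s + 1)) =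
      R * (Q ^ (2 * s + 3) * \<rho> b (VU (Suc c) s)) + e ^ (2 * c) * (R * (1 + Q * R * e)) * (Q ^ (2 * s + 2) * \<rho> b (VU 0 s))"
      by (simp only: distrib_left distrib_right mult_1_left mult_1_right ac_simps)
  qed
  also have "\<dots> = R * nsum (\<lambda>s. Q ^ (2 * s + 3) * \<rho> b (VU (Suc c) s)) +
      e ^ (2 * c) * (R * (1 + Q * R * e)) * nsum (\<lambda>s. Q ^ (2 * s + 2) * \<rho> b (VU 0 s))"
    by (simp only: nsum_add nsum_cmult)
  also have "\<dots> = R * (of_bool (Suc c \<le> b) * (Q ^ (2 * (b - Suc c) + 3) * (e * Q) ^ (b - Suc c))) +
     (R * (e ^ (2 * Suc c) * (e * Q ^ 3) ^ b * (Q ^ 3 * R * Q ^ 3 * e ^ 2 * G)) +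
      e ^ (2 * c) * (R * (1 + Q * R * e)) * (Q ^ (2 * b + 2) * (e * Q) ^ b + (e * Q ^ 3) ^ b * (Q ^ 2 * R * Q ^ 3 * e ^ 2 * G)))"
    unfolding sum_U by (simp add: distrib_left add.assoc)
  also have "R * (of_bool (Suc c \<le> b) * (Q ^ (2 * (b - Suc c) + 3) * (e * Q) ^ (b - Suc c))) =
      of_bool (c < b) * (R * Q ^ 3 * (e * Q ^ 3) ^ (b - c - 1))"
    by (simp add: power_add power_mult power_mult_distrib power3_eq_cube power2_eq_square Suc_le_eq ac_simps)
  also have "R * (e ^ (2 * Suc c) * (e * Q ^ 3) ^ b * (Q ^ 3 * R * Q ^ 3 * e ^ 2 * G)) +
      e ^ (2 * c) * (R * (1 + Q * R * e)) * (Q ^ (2 * b + 2) * (e * Q) ^ b + (e * Q ^ 3) ^ b * (Q ^ 2 * R * Q ^ 3 * e ^ 2 * G)) =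
      (e * Q ^ 3) ^ b * (\<kappa> * e ^ (2 * c))"
  proof -
    have p: "Q ^ (2 * b + 2) * (e * Q) ^ b = (e * Q ^ 3) ^ b * Q ^ 2"
      by (simp add: power_add power_mult power_mult_distrib power3_eq_cube power2_eq_square ac_simps)
    have e2: "e ^ (2 * Suc c) = e ^ 2 * e ^ (2 * c)" by (simp add: power2_eq_square ac_simps)
    have p6: "Q ^ 6 = Q ^ 3 * Q ^ 3" "e ^ 4 = e ^ 2 * e ^ 2" "R ^ 2 = R * R"
      by (simp_all add: power2_eq_square power4_eq_xxxx mult.assoc flip: power_add)
    show ?thesis unfolding p e2 \<kappa>_def p6 by (simp only: distrib_left distrib_right mult_1_left mult_1_right ac_simps)
  qed
  finally show ?thesis .
qed

section \<open>Separating the triangular part from rank one\<close>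

definition A :: "vx kernel" where
  "A v v' = (case v of VU b s \<Rightarrow> (case v' of VU c s' \<Rightarrow>
     of_bool (s = 0 \<and> s' = 0 \<and> c < b) * (R * Q ^ 3 * (e * Q ^ 3) ^ (b - c - 1)) | _ \<Rightarrow> 0) | _ \<Rightarrow> 0)"

definition H :: "vx \<Rightarrow> ennreal" where
  "H v = (case v of VU b s \<Rightarrow> of_bool (s = 0) * (e * Q ^ 3) ^ b | _ \<Rightarrow> 0)"

definition H' :: "vx \<Rightarrow> ennreal" where
  "H' v = (case v of VU c s \<Rightarrow> of_bool (s = 0) * (\<kappa> * e ^ (2 * c)) | _ \<Rightarrow> 0)"

lemma klog_A: "klog A = 0"
proof (rule klog_acyclic)
  define m where "m v = (case v of VU b s \<Rightarrow> b | _ \<Rightarrow> 0)" for v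
  show "trans {(v, v'). m v' < m v}" "irrefl {(v, v'). m v' < m v}"
    by (auto simp: trans_def irrefl_def)
  show "A v v' \<noteq> 0 \<Longrightarrow> (v, v') \<in> {(v, v'). m v' < m v}" for v v'
    by (cases v; cases v') (auto simp: A_def m_def)
qed

lemma nsum_U0:
  assumes "\<And>v. v \<notin> range (\<lambda>b. VU b 0) \<Longrightarrow> f v = 0"
  shows "nsum f = nsum (\<lambda>b. f (VU b 0))"
  by (rule nsum_reindex) (use assms in \<open>auto simp: inj_def\<close>)

text \<open>Applying the inverse of \<open>1 - A\<close> to \<open>H\<close> replaces the growth
  rate \<open>e * Q ^ 3\<close> by \<open>(e + R) * Q ^ 3 = Q ^ 4\<close>: the recursion for
  \<open>Suc b\<close> is \<open>e * Q ^ 3\<close> times that for \<open>b\<close> plus one new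
  term.\<close>

lemma star_A_H: "nsum (\<lambda>v. kstar A (VU b 0) v * H v) = (Q ^ 4) ^ b"
proof -
  define \<zeta> where "\<zeta> b = nsum (\<lambda>v. kstar A (VU b 0) v * H v)" for b
  have rec: "\<zeta> b = (e * Q ^ 3) ^ b + (\<Sum>c<b. R * Q ^ 3 * (e * Q ^ 3) ^ (b - c - 1) * \<zeta> c)" for b
  proof -
    have "\<zeta> b = nsum (\<lambda>v. of_bool (v = VU b 0) * H v + nsum (\<lambda>y. A (VU b 0) y * (kstar A y v * H v)))"
      unfolding \<zeta>_def
      by (subst kstar_left) (auto intro!: nsum_cong simp: kadd_def kone_def kc_def distrib_right nsum_multc[symmetric] mult.assoc)
    also have "\<dots> = H (VU b 0) + nsum (\<lambda>v. nsum (\<lambda>y. A (VU b 0) y * (kstar A y v * H v)))"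
      by (simp only: nsum_add nsum_delta)
    also have "nsum (\<lambda>v. nsum (\<lambda>y. A (VU b 0) y * (kstar A y v * H v))) = nsum (\<lambda>y. A (VU b 0) y * nsum (\<lambda>v. kstar A y v * H v))"
      by (subst nsum_swap) (simp only: nsum_cmult)
    also have "\<dots> = nsum (\<lambda>c. A (VU b 0) (VU c 0) * \<zeta> c)"
    proof -
      have "A (VU b 0) v = 0" if "v \<notin> range (\<lambda>c. VU c 0)" for v
        using that by (cases v) (auto simp: A_def)
      then show ?thesis unfolding \<zeta>_def by (intro nsum_U0) simp
    qed
    also have "\<dots> = (\<Sum>c<b. A (VU b 0) (VU c 0) * \<zeta> c)" by (rule nsum_finite) (auto simp: A_def)
    finally show ?thesis by (simp add: H_def A_def)
  qed
  have "\<zeta> b = (Q ^ 4) ^ b" for b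
  proof (induction b)
    case 0 show ?case by (subst rec) simp
  next
    case (Suc b)
    have "\<zeta> (Suc b) = e * Q ^ 3 * ((e * Q ^ 3) ^ b + (\<Sum>c<b. R * Q ^ 3 * (e * Q ^ 3) ^ (b - c - 1) * \<zeta> c)) + R * Q ^ 3 * \<zeta> b"
    proof -
      have "R * Q ^ 3 * (e * Q ^ 3) ^ (Suc b - c - 1) * \<zeta> c = e * Q ^ 3 * (R * Q ^ 3 * (e * Q ^ 3) ^ (b - c - 1) * \<zeta> c)" if "c < b" for c
      proof -
        have "Suc b - c - 1 = Suc (b - c - 1)" using that by simp
        then show ?thesis by (simp only: power_Suc ac_simps)
      qed
      then show ?thesis by (subst rec) (simp add: distrib_left sum_distrib_left add.assoc)
    qed
    also have "\<dots> = Q ^ 3 * (e + R) * \<zeta> b" unfolding rec[of b, symmetric] by (simp only: distrib_left distrib_right ac_simps)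
    finally show ?case unfolding eRQ Suc.IH by (simp add: power4_eq_xxxx power3_eq_cube ac_simps)
  qed
  then show ?thesis by (simp add: \<zeta>_def)
qed

text \<open>After elimination of the acyclic \<open>A\<close> the kernel has rank one. Its scalar
  sums \<open>\<kappa> * e ^ (2 * c) * Q ^ (4 * c)\<close> over \<open>c\<close>, which is again the
  geometric series \<open>G\<close>.\<close>

theorem klog_step_eq: "klog step = nsum (\<lambda>n. inverse (of_nat (Suc n)) * (\<kappa> * G) ^ Suc n)"
proof -
  let ?Z = "range (\<lambda>b. VU b 0)"
  have Ycol: "Y1 y v' = 0" if "v' \<notin> ?Z" for y v'
    by (cases "(y, v')" rule: Y1.cases) (use that in auto)
  have "klog K2 = klog (\<lambda>v v'. of_bool (v \<in> ?Z) * K2 v v')"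
    by (rule klog_restrict_cols) (simp add: K2_def kc_def Ycol)
  also have "(\<lambda>v v'. of_bool (v \<in> ?Z) * K2 v v') = A \<oplus> (\<lambda>v v'. H v * H' v')"
  proof (intro ext)
    fix v v'
    show "of_bool (v \<in> ?Z) * K2 v v' = (A \<oplus> (\<lambda>v v'. H v * H' v')) v v'"
    proof (cases "v \<in> ?Z \<and> v' \<in> ?Z")
      case True
      then obtain b c where "v = VU b 0" "v' = VU c 0" by blast
      then show ?thesis by (simp add: K2_eq kadd_def A_def H_def H'_def)
    next
      case False
      then have "of_bool (v \<in> ?Z) * K2 v v' = 0" using Ycol by (auto simp: K2_def kc_def)
      moreover have Z: "VU b s \<in> ?Z \<longleftrightarrow> s = 0" for b s by auto
      have "A v v' = 0" by (cases v; cases v') (use False in \<open>auto simp: A_def Z\<close>)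
      moreover have "H v * H' v' = 0" by (cases v; cases v') (use False in \<open>auto simp: H_def H'_def Z\<close>)
      ultimately show ?thesis by (simp add: kadd_def)
    qed
  qed
  also have "klog \<dots> = klog (kstar A \<odot> (\<lambda>v v'. H v * H' v'))"
    unfolding klog_add klog_A by (subst klog_comm) simp
  also have "kstar A \<odot> (\<lambda>v v'. H v * H' v') = (\<lambda>v v'. nsum (\<lambda>y. kstar A v y * H y) * H' v')"
    by (intro ext) (simp only: kc_def nsum_multc[symmetric] mult.assoc)
  also have "klog \<dots> = nsum (\<lambda>n. inverse (of_nat (Suc n)) * nsum (\<lambda>v. H' v * nsum (\<lambda>y. kstar A v y * H y)) ^ Suc n)"
    by (rule klog_rank1)
  also have "nsum (\<lambda>v. H' v * nsum (\<lambda>y. kstar A v y * H y)) = nsum (\<lambda>c. H' (VU c 0) * (Q ^ 4) ^ c)"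
  proof -
    have "H' v = 0" if "v \<notin> ?Z" for v using that by (cases v) (auto simp: H'_def)
    then show ?thesis unfolding star_A_H[symmetric] by (intro nsum_U0) simp
  qed
  also have "\<dots> = nsum (\<lambda>c. \<kappa> * (e ^ 2 * Q ^ 4) ^ c)"
    by (intro nsum_cong) (simp add: H'_def power_mult_distrib power_mult mult.assoc)
  also have "\<dots> = \<kappa> * G" unfolding G_def by (rule nsum_cmult)
  finally show ?thesis unfolding klog_step2 .
qed

end

section \<open>Evaluation for positive real u\<close>

definition zeta_closed :: "nat \<Rightarrow> 'a::field \<Rightarrow> 'a" where
  "zeta_closed q u = ((1 - of_nat q ^ 4 * u ^ 6) * (1 - of_nat q ^ 2 * u ^ 3)) /
     ((1 - of_nat q ^ 3 * u ^ 6) * (1 - of_nat q ^ 3 * u ^ 3))"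

context
  fixes q :: nat and u :: real
  assumes q: "1 \<le> q" and u: "0 < u" "real q * u < 1"
begin

private abbreviation (input) "e \<equiv> ennreal u"
private abbreviation (input) "Q \<equiv> ennreal (real q * u)"
private abbreviation (input) "R \<equiv> ennreal ((real q - 1) * u)"

lemma eRQ: "e + R = Q"
  using q u by (subst ennreal_plus[symmetric]) (auto simp: algebra_simps)

interpretation strip_graph e Q R by standard (rule eRQ)

text \<open>Taking out the power of q u with exponent \<open>a\<close> leaves
  \<open>u ^ (b - a)\<close>, and both bases are below 1.\<close>

lemma powers_less_1: "real q ^ a * u ^ b < 1" if "a \<le> b" "0 < b" for a b
proof -
  have "u < 1" using q u by (smt (verit) mult_le_cancel_right1 of_nat_1 of_nat_mono)
  have "real q ^ a * u ^ b \<le> real q ^ a * u ^ a * u ^ (b - a)"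
    using that by (simp add: mult.assoc flip: power_add)
  also have "\<dots> = (real q * u) ^ a * u ^ (b - a)" by (simp add: power_mult_distrib)
  also have "\<dots> < 1"
  proof (cases "a = 0")
    case True
    then show ?thesis using that u \<open>u < 1\<close> by (simp add: power_less_one_iff)
  next
    case False
    have "(real q * u) ^ a < 1" using False u q by (simp add: power_less_one_iff)
    moreover have "u ^ (b - a) \<le> 1" using u \<open>u < 1\<close> by (simp add: power_le_one)
    ultimately show ?thesis using u by (smt (verit) mult_left_le zero_le_power mult_nonneg_nonneg of_nat_0_le_iff)
  qed
  finally show ?thesis .
qed

lemma G_eq: "G = ennreal (1 / (1 - real q ^ 4 * u ^ 6))"
proof -
  let ?r = "real q ^ 4 * u ^ 6"
  have r: "0 \<le> ?r" "?r < 1" using powers_less_1[of 4 6] u by simp_all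
  have "e ^ 2 = ennreal (u ^ 2)" "Q ^ 4 = ennreal ((real q * u) ^ 4)"
    using u by (auto intro: ennreal_power)
  then have "e ^ 2 * Q ^ 4 = ennreal (u ^ 2 * (real q * u) ^ 4)" by (simp add: ennreal_mult)
  also have "u ^ 2 * (real q * u) ^ 4 = ?r" by algebra
  finally have "e ^ 2 * Q ^ 4 = ennreal ?r" .
  then have "(e ^ 2 * Q ^ 4) ^ i = ennreal (?r ^ i)" for i
    using ennreal_power[OF r(1), of i] by (simp only:)
  then have "G = (\<Sum>i. ennreal (?r ^ i))"
    unfolding G_def by (simp only: nn_integral_count_space_nat)
  also have "\<dots> = ennreal (1 / (1 - ?r))"
    using r by (intro suminf_ennreal_eq geometric_sums) auto
  finally show ?thesis .
qed

text \<open>Defined from the claimed value of the zeta function; that the graph produces it is the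
  content of \<open>\<kappa> * G = ennreal loop_weight\<close>.\<close>

definition loop_weight :: real where "loop_weight = 1 - 1 / zeta_closed q u"

lemma loop_weight: "0 \<le> loop_weight" "loop_weight < 1" "\<kappa> * G = ennreal loop_weight"
proof -
  define a where "a = real q ^ 2 * u ^ 3"
  define y where "y = u ^ 3"
  have a1: "real q ^ 4 * u ^ 6 < 1" and a2: "real q ^ 2 * u ^ 3 < 1" and a3: "real q ^ 3 * u ^ 6 < 1" and a4: "real q ^ 3 * u ^ 3 < 1"
    by (rule powers_less_1; simp)+
  define g where "g = 1 / (1 - real q ^ 4 * u ^ 6)"
  have g: "0 \<le> g" unfolding g_def using a1 by simp
  define r where "r = (real q - 1) * u"
  have r: "0 \<le> r" using q u by (simp add: r_def)
  define s where "s = real q * u"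
  have s: "0 \<le> s" using u by (simp add: s_def)
  define k where "k = r ^ 2 * s ^ 6 * u ^ 4 * g + r * (1 + s * r * u) * s ^ 2 * (1 + r * s ^ 3 * u ^ 2 * g)"
  have "\<kappa> = ennreal k"
    unfolding \<kappa>_def
    unfolding G_eq g_def[symmetric]
    unfolding r_def[symmetric] s_def[symmetric] k_def
    using u r s g by (simp add: ennreal_power ennreal_mult ennreal_plus)
  then have kG: "\<kappa> * G = ennreal (k * g)"
    unfolding G_eq g_def[symmetric] using g u r s by (simp add: ennreal_mult' k_def)
  have "k * g = loop_weight"
  proof -
    \<comment> \<open>\<open>g\<close> is the inverse of \<open>d\<close>. Multiplication by
      \<open>d * d\<close> clears both occurrences of \<open>g\<close> in \<open>k * g\<close> and
      leaves a polynomial identity.\<close>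
    define d where "d = 1 - real q ^ 4 * u ^ 6"
    have d: "d \<noteq> 0" "g * d = 1" using a1 by (auto simp: d_def g_def)
    have nz: "1 - real q ^ 2 * u ^ 3 \<noteq> 0" using a2 by simp
    have l: "loop_weight * (d * (1 - real q ^ 2 * u ^ 3)) =
        d * (1 - real q ^ 2 * u ^ 3) - (1 - real q ^ 3 * u ^ 6) * (1 - real q ^ 3 * u ^ 3)"
      unfolding loop_weight_def zeta_closed_def d_def[symmetric] using d(1) nz a3 a4 by (simp add: field_simps)
    have "k * g * (d * d * (1 - real q ^ 2 * u ^ 3)) =
      (r ^ 2 * s ^ 6 * u ^ 4 * (g * d) + r * (1 + s * r * u) * s ^ 2 * (d + r * s ^ 3 * u ^ 2 * (g * d))) * (g * d) * (1 - real q ^ 2 * u ^ 3)"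
      unfolding k_def by (simp add: algebra_simps)
    also have "\<dots> = (r ^ 2 * s ^ 6 * u ^ 4 + r * (1 + s * r * u) * s ^ 2 * (d + r * s ^ 3 * u ^ 2)) * (1 - real q ^ 2 * u ^ 3)"
      unfolding d(2) by simp
    also have "\<dots> = (d * (1 - real q ^ 2 * u ^ 3) - (1 - real q ^ 3 * u ^ 6) * (1 - real q ^ 3 * u ^ 3)) * d"
      unfolding d_def r_def s_def by algebra
    also have "\<dots> = loop_weight * (d * d * (1 - real q ^ 2 * u ^ 3))" unfolding l[symmetric] by simp
    finally show ?thesis using d(1) nz by simp
  qed
  then show "\<kappa> * G = ennreal loop_weight" using kG by simp
  show "0 \<le> loop_weight" unfolding \<open>k * g = loop_weight\<close>[symmetric] k_def using g u r s by simp
  show "loop_weight < 1" unfolding loop_weight_def zeta_closed_def using a1 a2 a3 a4 by simp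
qed

lemma klog_step_value: "klog step = ennreal (ln (zeta_closed q u))"
proof -
  have s: "(\<lambda>n. loop_weight ^ Suc n / Suc n) sums (- ln (1 - loop_weight))"
  proof -
    have "(\<lambda>n. - ((- (- loop_weight)) ^ n) / of_nat n) sums ln (1 + (- loop_weight))"
      by (rule ln_series') (use loop_weight in simp)
    then have "(\<lambda>n. - (- (loop_weight ^ n) / of_nat n)) sums - ln (1 - loop_weight)"
      using sums_minus by fastforce
    \<comment> \<open>The term of index 0 is a division by 0 and hence 0; adding it in this form
      allows reindexing from 1.\<close>
    then have "(\<lambda>n. loop_weight ^ n / of_nat n) sums (- ln (1 - loop_weight) + (loop_weight ^ 0 / of_nat 0))" by simp
    then show ?thesis by (subst (asm) sums_Suc_iff[symmetric]) simp
  qed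
  have "klog step = (\<Sum>n. ennreal (loop_weight ^ Suc n / Suc n))"
    unfolding klog_step_eq loop_weight(3) nn_integral_count_space_nat
    using loop_weight(1) by (intro arg_cong[of _ _ suminf] ext)
      (simp add: ennreal_power ennreal_of_nat_eq_real_of_nat inverse_ennreal ennreal_mult[symmetric] divide_inverse mult.commute del: of_nat_Suc power_Suc)
  also have "\<dots> = ennreal (- ln (1 - loop_weight))"
    using s loop_weight(1) by (intro suminf_ennreal_eq) auto
  also have "- ln (1 - loop_weight) = ln (zeta_closed q u)"
    unfolding loop_weight_def by (simp add: ln_div ln_inverse inverse_eq_divide[symmetric])
  finally show ?thesis .
qed

end

section \<open>Cyclic words\<close>

primrec pw :: "('a \<Rightarrow> 'a \<Rightarrow> 'b::comm_monoid_mult) \<Rightarrow> 'a \<Rightarrow> 'a list \<Rightarrow> 'b" where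
  "pw w x [] = 1" | "pw w x (y # ys) = w x y * pw w y ys"

text \<open>The list records the vertex after each step; starting from its last entry closes the
  walk without repeating a letter.\<close>

definition cw :: "('a \<Rightarrow> 'a \<Rightarrow> 'b::comm_monoid_mult) \<Rightarrow> 'a list \<Rightarrow> 'b" where
  "cw w ys = pw w (last ys) ys"

lemma pw_append: "pw w x (as @ bs) = pw w x as * pw w (last (x # as)) bs"
  by (induction as arbitrary: x) (simp_all add: mult.assoc)

lemma cw_rotate1: "cw w (rotate1 ys) = cw w ys"
  by (cases ys) (auto simp: cw_def pw_append mult.commute)

lemma cw_rotate: "cw w (rotate m ys) = cw w ys"
  by (induction m) (simp_all add: cw_rotate1)

lemma pw_nth: "pw w x ys = (\<Prod>j<length ys. w ((x # ys) ! j) ((x # ys) ! Suc j))"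
  by (induction ys arbitrary: x) (simp_all add: prod.lessThan_Suc_shift del: prod.lessThan_Suc)

abbreviation lpow :: "nat \<Rightarrow> 'a list \<Rightarrow> 'a list" where "lpow k zs \<equiv> concat (replicate k zs)"

lemma length_lpow [simp]: "length (lpow k zs) = k * length zs"
  by (induction k) simp_all

lemma lpow_mult: "lpow j (lpow k zs) = lpow (j * k) zs"
  by (induction j) (simp_all add: replicate_add)

lemma lpow_Nil_iff: "lpow k zs = [] \<longleftrightarrow> k = 0 \<or> zs = []"
  by (induction k) auto

lemma set_lpow: "0 < k \<Longrightarrow> set (lpow k zs) = set zs"
  by (cases k) (auto simp: in_set_replicate)

lemma pw_lpow: "pw w (last ys) (lpow k ys) = pw w (last ys) ys ^ k"
proof (induction k)
  case (Suc k)
  have "last (last ys # ys) = last ys" by simp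
  then show ?case using Suc.IH by (simp add: pw_append)
qed simp

lemma last_lpow: "0 < k \<Longrightarrow> last (lpow k ys) = last ys"
proof (induction k)
  case (Suc k)
  then show ?case by (cases "k = 0") (auto simp: last_append lpow_Nil_iff)
qed simp

lemma cw_lpow: "0 < k \<Longrightarrow> cw w (lpow k ys) = cw w ys ^ k"
  by (simp add: cw_def last_lpow pw_lpow)

lemma rotate1_lpow: "rotate1 (lpow k zs) = lpow k (rotate1 zs)"
proof (cases zs)
  case (Cons a t)
  have *: "lpow k (t @ [a]) @ t = t @ lpow k (a # t)" for k by (induction k) simp_all
  show ?thesis
  proof (cases k)
    case (Suc j)
    have "lpow (Suc j) (t @ [a]) = lpow j (t @ [a]) @ t @ [a]"
      by (metis append_Nil2 concat.simps(1,2) concat_append replicate_Suc replicate_append_same)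
    then show ?thesis using *[of j] by (simp add: Cons Suc)
  qed simp
qed simp

lemma rotate_lpow: "rotate m (lpow k zs) = lpow k (rotate m zs)"
  by (induction m) (simp_all add: rotate1_lpow)

lemma rotate_inverse: "m \<le> length xs \<Longrightarrow> rotate (length xs - m) (rotate m xs) = xs"
  by (simp add: rotate_rotate)

section \<open>Primitive words and their roots\<close>

definition prim :: "'a list \<Rightarrow> bool" where
  "prim xs \<longleftrightarrow> xs \<noteq> [] \<and> (\<forall>zs k. xs = lpow k zs \<longrightarrow> k < 2)"

lemma prim_rotate: "prim xs \<Longrightarrow> prim (rotate m xs)"
proof -
  have "rotate m xs = rotate (m mod length xs) xs" by (simp add: rotate_conv_mod[symmetric])
  moreover have "prim (rotate m xs)" if p: "prim xs" and m: "m \<le> length xs" for m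
    unfolding prim_def
  proof (intro conjI allI impI)
    show "rotate m xs \<noteq> []" using p by (simp add: prim_def)
    fix zs k assume "rotate m xs = lpow k zs"
    then have "xs = lpow k (rotate (length xs - m) zs)"
      using rotate_inverse[OF m] by (simp add: rotate_lpow)
    then show "k < 2" using p unfolding prim_def by blast
  qed
  ultimately show "prim xs \<Longrightarrow> prim (rotate m xs)"
    by (metis length_greater_0_conv less_imp_le mod_less_divisor prim_def)
qed

lemma ex_prim_root: "xs \<noteq> [] \<Longrightarrow> \<exists>zs k. 0 < k \<and> prim zs \<and> xs = lpow k zs"
proof (induction "length xs" arbitrary: xs rule: less_induct)
  case less
  show ?case
  proof (cases "prim xs")
    case True
    then show ?thesis by (intro exI[of _ xs] exI[of _ 1]) simp
  next
    case False
    then obtain zs k where zs: "xs = lpow k zs" "2 \<le> k" using less.prems by (auto simp: prim_def)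
    then have "zs \<noteq> []" using less.prems by (auto simp: lpow_Nil_iff)
    then have "length zs < length xs" using zs by simp
    from less.hyps[OF this \<open>zs \<noteq> []\<close>] obtain ys j where "0 < j" "prim ys" "zs = lpow j ys" by blast
    then show ?thesis using zs by (intro exI[of _ ys] exI[of _ "k * j"]) (simp add: lpow_mult)
  qed
qed

lemma rotate_mult: "rotate a W = W \<Longrightarrow> rotate (a * s) W = W"
  by (induction s) (simp_all add: rotate_rotate[symmetric])

text \<open>By Bezout the greatest common divisor is a difference of multiples of the two rotation
  amounts.\<close>

lemma rotate_gcd:
  assumes "rotate a W = W" "rotate b W = W" "a \<noteq> 0"
  shows "rotate (gcd a b) W = W"
proof -
  obtain s t where "a * s = b * t + gcd a b" using bezout_nat[OF assms(3)] by blast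
  then have "rotate (gcd a b + b * t) W = W" using rotate_mult[OF assms(1), of s] by (simp add: add.commute)
  then show ?thesis unfolding rotate_rotate[symmetric] rotate_mult[OF assms(2)] .
qed

lemma nth_lpow: "i < k * length A \<Longrightarrow> lpow k A ! i = A ! (i mod length A)"
proof (induction k arbitrary: i)
  case (Suc k)
  then show ?case by (auto simp: nth_append le_mod_geq)
qed simp

text \<open>Invariance under rotation by \<open>g\<close> makes \<open>W\<close> periodic with
  period \<open>g\<close>, so a prefix whose length is a multiple of \<open>g\<close> is a
  power.\<close>

lemma rotate_period:
  assumes "rotate g W = W" "0 < g" "l \<le> length W" "g dvd l" "0 < l"
  shows "take l W = lpow (l div g) (take g W)"
proof -
  have g: "g \<le> l" using assms by (simp add: dvd_imp_le)
  have per: "W ! i = W ! (i mod g)" if "i < length W" for i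
    using that
  proof (induction i rule: less_induct)
    case (less i)
    show ?case
    proof (cases "i < g")
      case False
      have "rotate g W ! (i - g) = W ! ((g + (i - g)) mod length W)"
        by (rule nth_rotate) (use less.prems in simp)
      then have "W ! i = W ! (i - g)" using False less.prems assms(1) by simp
      also have "\<dots> = W ! ((i - g) mod g)" using less.IH[of "i - g"] False less.prems assms(2) by simp
      finally show ?thesis using False by (simp add: le_mod_geq)
    qed simp
  qed
  have mg: "length (take g W) = g" using g assms(3) by simp
  have len: "l div g * length (take g W) = l" unfolding mg using assms(4) by simp
  show ?thesis
  proof (rule nth_equalityI)
    show "length (take l W) = length (lpow (l div g) (take g W))" unfolding length_lpow len using assms(3) by simp
    fix i assume "i < length (take l W)"
    then have i: "i < l" "i < length W" by auto
    have "lpow (l div g) (take g W) ! i = take g W ! (i mod length (take g W))"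
      by (rule nth_lpow) (simp only: len i(1))
    also have "\<dots> = W ! (i mod g)" unfolding mg using assms(2) by simp
    finally show "take l W ! i = lpow (l div g) (take g W) ! i" using per[OF i(2)] i by simp
  qed
qed

lemma prim_period:
  assumes "prim x" "x = take (length x) W" "rotate g W = W" "0 < g" "g dvd length x" "length x \<le> length W"
  shows "length x = g"
proof -
  have "0 < length x" using assms(1) by (simp add: prim_def)
  then have "x = lpow (length x div g) (take g W)"
    using rotate_period[OF assms(3,4,6,5)] assms(2) by simp
  then have "length x div g < 2" using assms(1) unfolding prim_def by blast
  moreover have "length x div g \<noteq> 0"
    using dvd_div_mult_self[OF assms(5)] \<open>0 < length x\<close> by (intro notI) simp
  ultimately have "length x div g = 1" by linarith
  then show ?thesis using dvd_div_mult_self[OF assms(5)] by simp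
qed

lemma rotate_length_lpow: "rotate (length x) (lpow k x) = lpow k x"
  by (simp add: rotate_lpow)

text \<open>The common power is fixed by rotation by either length, hence by their greatest common
  divisor. Primitivity then forces both lengths to equal that divisor.\<close>

lemma prim_root_unique:
  assumes "prim x" "prim y" "0 < i" "0 < j" "lpow i x = lpow j y"
  shows "x = y \<and> i = j"
proof -
  define W where "W = lpow i x"
  have W': "W = lpow j y" using assms(5) by (simp add: W_def)
  have pos: "0 < length x" "0 < length y" using assms by (auto simp: prim_def)
  obtain i' j' where ij: "i = Suc i'" "j = Suc j'" using assms(3,4) by (auto simp: gr0_conv_Suc)
  have x: "x = take (length x) W" and lx: "length x \<le> length W" unfolding W_def ij(1) by simp_all
  have y: "y = take (length y) W" and ly: "length y \<le> length W" unfolding W' ij(2) by simp_all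
  define g where "g = gcd (length x) (length y)"
  have g: "rotate g W = W" unfolding g_def
    by (rule rotate_gcd) (use rotate_length_lpow[of x i] rotate_length_lpow[of y j] pos in \<open>auto simp: W_def[symmetric] W'[symmetric]\<close>)
  have "0 < g" using pos by (simp add: g_def)
  moreover have "g dvd length x" "g dvd length y" by (simp_all add: g_def)
  ultimately have "length x = g" "length y = g"
    using prim_period[OF assms(1) x g _ _ lx] prim_period[OF assms(2) y g _ _ ly] by blast+
  then have "x = y" using x y by simp
  moreover have "i * g = j * g" using arg_cong[OF assms(5), of length] \<open>length x = g\<close> \<open>length y = g\<close> by simp
  ultimately show ?thesis using \<open>length x = g\<close> pos by simp
qed

text \<open>Two equal rotations make the word invariant under a shorter rotation, which would
  exhibit it as a proper power.\<close>

lemma prim_rotate_inj: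
  assumes "prim xs" "i < length xs" "j < length xs" "rotate i xs = rotate j xs"
  shows "i = j"
proof -
  have False if ij: "i < j" "j < length xs" "rotate i xs = rotate j xs" for i j
  proof -
    define W where "W = rotate i xs"
    have pW: "prim W" unfolding W_def by (rule prim_rotate[OF assms(1)])
    have "rotate (j - i) W = rotate (j - i + i) xs" unfolding W_def rotate_rotate ..
    then have "rotate (j - i) W = W" using ij by (simp add: W_def)
    moreover have "rotate (length W) W = W" by simp
    ultimately have g: "rotate (gcd (j - i) (length W)) W = W" by (rule rotate_gcd) (use ij in simp)
    have "length W = gcd (j - i) (length W)"
      by (rule prim_period[OF pW _ g]) (use ij in \<open>auto simp: gcd_pos_nat\<close>)
    moreover have "gcd (j - i) (length W) \<le> j - i" by (rule gcd_le1_nat) (use ij in simp)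
    ultimately show False using ij by (simp add: W_def)
  qed
  then show ?thesis using assms(2-4) by (metis linorder_neqE_nat)
qed

text \<open>This count cancels the factor 1 / length in the logarithm when the rotations of a
  primitive word are summed.\<close>

lemma card_rotations: "prim xs \<Longrightarrow> card {rotate m xs | m. True} = length xs"
proof -
  assume p: "prim xs"
  have "{rotate m xs | m. True} = (\<lambda>m. rotate m xs) ` {..<length xs}"
  proof (intro equalityI subsetI)
    fix y assume "y \<in> {rotate m xs | m. True}"
    then obtain m where "y = rotate (m mod length xs) xs" by (auto simp: rotate_conv_mod[symmetric])
    then show "y \<in> (\<lambda>m. rotate m xs) ` {..<length xs}" using p by (simp add: prim_def)
  qed auto
  then show ?thesis using prim_rotate_inj[OF p] by (simp add: card_image inj_on_def)
qed

section \<open>The logarithmic determinant as a sum over closed words\<close>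

lemma kpow_pw: "kpow K n x z = nsum (\<lambda>ys. of_bool (length ys = n \<and> last (x # ys) = z) * pw K x ys)"
proof (induction n arbitrary: x)
  case 0
  have "nsum (\<lambda>ys. of_bool (length ys = 0 \<and> last (x # ys) = z) * pw K x ys) = of_bool (x = z)"
    by (subst nsum_single[of "[]"]) auto
  then show ?case by (simp add: kone_def)
next
  case (Suc n)
  let ?f = "\<lambda>ys. of_bool (length ys = Suc n \<and> last (x # ys) = z) * pw K x ys"
  have "nsum ?f = nsum (\<lambda>p. ?f (fst p # snd p))"
    by (rule nsum_reindex) (auto simp: inj_def image_iff prod_eq_iff, metis length_Suc_conv fst_conv snd_conv)
  also have "\<dots> = nsum (\<lambda>y. nsum (\<lambda>ys. ?f (y # ys)))" by (rule nsum_pair)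
  also have "\<dots> = nsum (\<lambda>y. K x y * kpow K n y z)"
    unfolding Suc.IH nsum_cmult[symmetric] by (intro nsum_cong) (simp add: mult.left_commute)
  finally show ?case by (simp add: kc_def)
qed

lemma klog_cw: "klog K = nsum (\<lambda>ys. of_bool (ys \<noteq> []) * inverse (of_nat (length ys)) * cw K ys)"
proof -
  have "ktr (kpow K (Suc n)) = nsum (\<lambda>ys. of_bool (length ys = Suc n) * cw K ys)" for n
  proof -
    have "ktr (kpow K (Suc n)) = nsum (\<lambda>ys. nsum (\<lambda>x. of_bool (length ys = Suc n \<and> last (x # ys) = x) * pw K x ys))"
      unfolding ktr_def kpow_pw by (rule nsum_swap)
    also have "\<dots> = nsum (\<lambda>ys. of_bool (length ys = Suc n) * cw K ys)"
    proof (rule nsum_cong)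
      fix ys :: "'a list"
      show "nsum (\<lambda>x. of_bool (length ys = Suc n \<and> last (x # ys) = x) * pw K x ys) = of_bool (length ys = Suc n) * cw K ys"
        by (cases ys) (auto simp: cw_def intro!: nsum_single[THEN trans])
    qed
    finally show ?thesis .
  qed
  then have "klog K = nsum (\<lambda>n. nsum (\<lambda>ys. inverse (of_nat (Suc n)) * (of_bool (length ys = Suc n) * cw K ys)))"
    unfolding klog_def by (simp only: nsum_cmult)
  also have "\<dots> = nsum (\<lambda>ys. nsum (\<lambda>n. inverse (of_nat (Suc n)) * (of_bool (length ys = Suc n) * cw K ys)))"
    by (rule nsum_swap)
  also have "\<dots> = nsum (\<lambda>ys. of_bool (ys \<noteq> []) * inverse (of_nat (length ys)) * cw K ys)"
  proof (rule nsum_cong)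
    fix ys :: "'a list"
    show "nsum (\<lambda>n. inverse (of_nat (Suc n)) * (of_bool (length ys = Suc n) * cw K ys)) =
      of_bool (ys \<noteq> []) * inverse (of_nat (length ys)) * cw K ys"
    proof (cases ys)
      case (Cons a zs)
      then show ?thesis by (subst nsum_single[of "length zs"]) auto
    qed simp
  qed
  finally show ?thesis .
qed

section \<open>Galleries in the quotient\<close>

type_synonym 'k orbit = "('k fls ^ 3) set set triple set"

definition gal :: "'c list \<Rightarrow> 'c list" where "gal ys = last ys # ys"

text \<open>Positive weight encodes admissibility: a step of orbits lifts to a tailless step from
  any lift of its source exactly when its weight is positive.\<close>

definition words :: "('k::field orbit) list set" where
  "words = {ys. ys \<noteq> [] \<and> set ys \<subseteq> X_type1_chambers \<and> 0 < cw step_weight ys}"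

lemma tl_gal [simp]: "tl (gal ys) = ys"
  by (simp add: gal_def)

lemma gallery_weight_gal: "gallery_weight (gal ys) = cw step_weight ys"
  by (simp add: gallery_weight_def gallery_length_def gal_def cw_def pw_nth)

lemma pw_pos_iff: "0 < pw w x (y # ys) \<longleftrightarrow> 0 < w x y \<and> 0 < pw w y ys" for w :: "'a \<Rightarrow> 'a \<Rightarrow> nat"
  by simp

lemma chain_nth_Cons:
  "(\<forall>j < gallery_length (x # y # ys). R ((x # y # ys) ! j) ((x # y # ys) ! Suc j)) \<longleftrightarrow>
     R x y \<and> (\<forall>j < gallery_length (y # ys). R ((y # ys) ! j) ((y # ys) ! Suc j))"
  by (simp add: gallery_length_def All_less_Suc2)

lemma tailless_gallery_Cons:
  "tailless_gallery (d # d' # ds) \<longleftrightarrow> d \<in> type1_chambers \<and> edge_adjacent d d' \<and> tailless d d' \<and> tailless_gallery (d' # ds)"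
  unfolding tailless_gallery_def chain_nth_Cons[of d d' ds "\<lambda>d d'. edge_adjacent d d' \<and> tailless d d'"] by auto

lemma X_gallery_Cons:
  "X_gallery (c # c' # cs) \<longleftrightarrow> c \<in> X_type1_chambers \<and> X_edge_adjacent c c' \<and> X_gallery (c' # cs)"
  unfolding X_gallery_def chain_nth_Cons[of c c' cs X_edge_adjacent] by auto

lemma tailless_gallery_weight:
  fixes d :: "('k::{field,finite} fls ^ 3) set set triple"
  assumes "tailless_gallery (d # ds)"
  shows "0 < pw step_weight (chamber_orbit d) (map chamber_orbit ds)"
  using assms
proof (induction ds arbitrary: d)
  case (Cons d' ds)
  then have "d' \<in> type1_chambers" by (simp add: tailless_gallery_def)
  then show ?case using Cons step_weight_pos[of d d'] by (simp add: tailless_gallery_Cons)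
qed simp

text \<open>Positivity allows the next step above whichever lift has been reached, so the stepwise
  lifting never gets stuck.\<close>

lemma lift_gallery:
  fixes d :: "('k::{field,finite} fls ^ 3) set set triple"
  assumes "d \<in> type1_chambers" "set ys \<subseteq> X_type1_chambers" "0 < pw step_weight (chamber_orbit d) ys"
  shows "\<exists>ds. tailless_gallery (d # ds) \<and> map chamber_orbit ds = ys"
  using assms
proof (induction ys arbitrary: d)
  case Nil
  then show ?case by (simp add: tailless_gallery_def gallery_length_def)
next
  case (Cons y ys)
  then have w: "0 < step_weight (chamber_orbit d) y" "0 < pw step_weight y ys" "y \<in> X_type1_chambers"
    unfolding pw_pos_iff by auto
  obtain d' where d': "d' \<in> type1_chambers" "edge_adjacent d d'" "tailless d d'" "chamber_orbit d' = y"
    by (rule step_weight_lift[OF Cons.prems(1) w(1) w(3)])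
  obtain ds where "tailless_gallery (d' # ds)" "map chamber_orbit ds = ys"
    using Cons.IH[OF d'(1)] Cons.prems(2) w(2) d'(4) by auto
  then show ?case using Cons.prems(1) d' by (intro exI[of _ "d' # ds"]) (simp add: tailless_gallery_Cons)
qed

lemma orbit_lift: "c \<in> X_type1_chambers \<Longrightarrow> \<exists>d\<in>type1_chambers. c = chamber_orbit d"
  unfolding X_type1_chambers_def by blast

lemma mem_chamber_orbit: "d \<in> type1_chambers \<Longrightarrow> d \<in> chamber_orbit d"
  by (elim type1E) (simp add: chamber_mem_orbit)

lemma X_gallery_of_weight:
  fixes x :: "'k::{field,finite} orbit"
  assumes "x \<in> X_type1_chambers" "set ys \<subseteq> X_type1_chambers" "0 < pw step_weight x ys"
  shows "X_gallery (x # ys)"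
  using assms
proof (induction ys arbitrary: x)
  case Nil
  then show ?case by (simp add: X_gallery_def gallery_length_def)
next
  case (Cons y ys)
  obtain d where d: "d \<in> type1_chambers" "x = chamber_orbit d" using orbit_lift[OF Cons.prems(1)] by blast
  have w: "0 < step_weight (chamber_orbit d) y" "0 < pw step_weight y ys" "y \<in> X_type1_chambers"
    using Cons.prems(2,3) unfolding pw_pos_iff d(2) by auto
  obtain d' where d': "d' \<in> type1_chambers" "edge_adjacent d d'" "chamber_orbit d' = y"
    by (rule step_weight_lift[OF d(1) w(1) w(3)])
  have "X_edge_adjacent x y"
    unfolding X_edge_adjacent_def using d d' mem_chamber_orbit by blast
  then show ?case using Cons.prems(1,2) Cons.IH[OF w(3) _ w(2)] by (simp add: X_gallery_Cons)
qed

lemma closed_gal: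
  fixes ys :: "'k::{field,finite} orbit list"
  assumes "ys \<in> words"
  shows "closed_gallery (gal ys)" "admissible (gal ys)"
proof -
  have ys: "ys \<noteq> []" "set ys \<subseteq> X_type1_chambers" "0 < pw step_weight (last ys) ys"
    using assms by (auto simp: words_def cw_def)
  then have l: "last ys \<in> X_type1_chambers" by auto
  show "closed_gallery (gal ys)"
    using X_gallery_of_weight[OF l ys(2,3)] ys(1) by (simp add: closed_gallery_def gal_def gallery_length_def Suc_le_eq)
  obtain d where d: "d \<in> type1_chambers" "last ys = chamber_orbit d" using orbit_lift[OF l] by blast
  obtain ds where "tailless_gallery (d # ds)" "map chamber_orbit ds = ys"
    using lift_gallery[OF d(1) ys(2)] ys(3) d(2) by auto
  then show "admissible (gal ys)" unfolding admissible_def gal_def using d(2) by (intro exI[of _ "d # ds"]) simp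
qed

lemma closed_admissible_word:
  fixes cs :: "'k::{field,finite} orbit list"
  assumes "closed_gallery cs" "admissible cs"
  shows "tl cs \<in> words" "cs = gal (tl cs)"
proof -
  have cs: "set cs \<subseteq> X_type1_chambers" "1 \<le> length cs - 1" "last cs = hd cs"
    using assms(1) by (auto simp: closed_gallery_def X_gallery_def gallery_length_def)
  from cs(2) obtain x ys where xs: "cs = x # ys" "ys \<noteq> []" by (cases cs) fastforce+
  then have x: "x = last ys" using cs(3) by simp
  then show "cs = gal (tl cs)" by (simp add: xs gal_def)
  obtain ds where ds: "tailless_gallery ds" "map chamber_orbit ds = cs" using assms(2) by (auto simp: admissible_def)
  then obtain d ds' where d: "ds = d # ds'" "x = chamber_orbit d" "ys = map chamber_orbit ds'" using xs by (cases ds) auto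
  have "0 < pw step_weight x ys" using tailless_gallery_weight ds(1) unfolding d by blast
  then show "tl cs \<in> words" using cs(1) xs x by (simp add: words_def cw_def)
qed

section \<open>Gallery classes as rotation classes\<close>

definition rotations :: "'a list \<Rightarrow> 'a list set" where "rotations xs = {rotate m xs | m. True}"

lemma cyclic_shift_gal: "ys \<noteq> [] \<Longrightarrow> cyclic_shift (gal ys) = gal (rotate1 ys)"
  by (cases ys) (auto simp: cyclic_shift_def gal_def)

lemma gallery_class_gal:
  assumes "ys \<noteq> []"
  shows "gallery_class (gal ys) = gal ` rotations ys"
proof -
  have "(cyclic_shift ^^ m) (gal ys) = gal (rotate m ys)" for m
    by (induction m) (use assms in \<open>simp_all add: cyclic_shift_gal\<close>)
  then show ?thesis by (auto simp: gallery_class_def rotations_def)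
qed

lemma tl_gallery_class: "ys \<noteq> [] \<Longrightarrow> tl ` gallery_class (gal ys) = rotations ys"
  by (simp add: gallery_class_gal image_image)

lemma rotations_self: "xs \<in> rotations xs"
  unfolding rotations_def by (rule CollectI, rule exI[of _ 0]) simp

lemma rotations_eq:
  assumes "ys \<in> rotations xs" "xs \<noteq> []"
  shows "rotations ys = rotations xs"
proof -
  obtain m where m: "ys = rotate m xs" using assms(1) by (auto simp: rotations_def)
  define i where "i = m mod length xs"
  have i: "ys = rotate i xs" "i \<le> length xs" using assms(2) m by (simp_all add: i_def rotate_conv_mod[symmetric] less_imp_le)
  then have "xs = rotate (length xs - i) ys" using rotate_inverse by metis
  then have "rotate n xs = rotate (n + (length xs - i)) ys" for n by (metis rotate_rotate)
  moreover have "rotate n ys = rotate (n + i) xs" for n by (simp add: i(1) rotate_rotate)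
  ultimately show ?thesis unfolding rotations_def by blast
qed

lemma words_rotations: "xs \<in> words \<Longrightarrow> ys \<in> rotations xs \<Longrightarrow> ys \<in> words"
  by (auto simp: words_def rotations_def cw_rotate)

lemma words_lpow:
  assumes "0 < k"
  shows "lpow k zs \<in> words \<longleftrightarrow> zs \<in> words"
  using assms by (auto simp: words_def cw_lpow set_lpow lpow_Nil_iff simp del: set_concat)

lemma traverse_gal: "traverse k (gal ys) = last ys # lpow k ys"
  by (simp add: traverse_def gal_def)

text \<open>A root in the sense of \<open>primitive_class\<close> only has to be closed. The root of
  a positive word is itself positive, hence gives a closed gallery; conversely any traversed gallery
  in the class exhibits a rotation of \<open>ys\<close> as a proper power.\<close>

lemma primitive_class_iff:
  fixes ys :: "'k::{field,finite} orbit list"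
  assumes "ys \<in> words"
  shows "primitive_class (gallery_class (gal ys)) \<longleftrightarrow> prim ys"
proof
  have ne: "ys \<noteq> []" using assms by (simp add: words_def)
  show "prim ys" if p: "primitive_class (gallery_class (gal ys))"
  proof (rule ccontr)
    assume "\<not> prim ys"
    then obtain zs k where zs: "ys = lpow k zs" "2 \<le> k" using ne by (auto simp: prim_def)
    then have "zs \<in> words" using words_lpow[of k zs] assms by simp
    then have "closed_gallery (gal zs)" by (rule closed_gal)
    moreover have "traverse k (gal zs) = gal ys"
      unfolding traverse_gal unfolding gal_def zs(1) using zs(2) by (subst last_lpow) simp_all
    moreover have "gal ys \<in> gallery_class (gal ys)" using gallery_class_gal[OF ne] rotations_self by blast
    ultimately show False using p zs(2) unfolding primitive_class_def by metis
  qed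
  show "primitive_class (gallery_class (gal ys))" if p: "prim ys"
    unfolding primitive_class_def
  proof (intro notI, elim exE conjE)
    fix cs k assume k: "2 \<le> k" and t: "traverse k cs \<in> gallery_class (gal ys)"
    then have "tl (traverse k cs) \<in> rotations ys" using tl_gallery_class[OF ne] by blast
    then obtain m where "lpow k (tl cs) = rotate m ys" by (auto simp: rotations_def traverse_def)
    then have "prim (lpow k (tl cs))" using prim_rotate[OF p] by simp
    then show False using k unfolding prim_def by (metis not_less)
  qed
qed

lemma prime_classes_eq:
  "prime_classes = (\<lambda>ys. gallery_class (gal ys)) ` {ys :: 'k::{field,finite} orbit list. ys \<in> words \<and> prim ys}"
proof (intro equalityI subsetI)
  fix C :: "'k orbit list set" assume "C \<in> prime_classes"
  then obtain cs where cs: "primitive_class C" "closed_gallery cs" "admissible cs" "C = gallery_class cs"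
    unfolding prime_classes_def by blast
  note w = closed_admissible_word[OF cs(2,3)]
  have C: "C = gallery_class (gal (tl cs))" unfolding cs(4) using w(2) by simp
  then have "prim (tl cs)" using primitive_class_iff[OF w(1)] cs(1) by simp
  then show "C \<in> (\<lambda>ys. gallery_class (gal ys)) ` {ys. ys \<in> words \<and> prim ys}" using C w(1) by blast
next
  fix C :: "'k orbit list set" assume "C \<in> (\<lambda>ys. gallery_class (gal ys)) ` {ys. ys \<in> words \<and> prim ys}"
  then obtain ys where "ys \<in> words" "prim ys" "C = gallery_class (gal ys)" by blast
  then show "C \<in> prime_classes"
    unfolding prime_classes_def using primitive_class_iff closed_gal by blast
qed

text \<open>Length and weight are read from a \<open>SOME\<close> representative, but all
  representatives come from rotations of \<open>ys\<close>.\<close>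

lemma class_values:
  assumes "ys \<noteq> []"
  shows "class_length (gallery_class (gal ys)) = length ys" "class_weight (gallery_class (gal ys)) = cw step_weight ys"
proof -
  define cs where "cs = (SOME cs. cs \<in> gallery_class (gal ys))"
  have "gal ys \<in> gallery_class (gal ys)" using gallery_class_gal[OF assms] rotations_self by blast
  then have "cs \<in> gallery_class (gal ys)" unfolding cs_def by (rule someI)
  then obtain m where "cs = gal (rotate m ys)" unfolding gallery_class_gal[OF assms] by (auto simp: rotations_def)
  then show "class_length (gallery_class (gal ys)) = length ys" "class_weight (gallery_class (gal ys)) = cw step_weight ys"
    unfolding class_length_def class_weight_def cs_def[symmetric]
    by (simp_all add: gallery_weight_gal cw_rotate) (simp add: gal_def gallery_length_def)
qed

section \<open>The Euler product\<close>

text \<open>Quadrant parameters start at 0, so a positive coordinate is offset by 1 while a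
  nonpositive one only changes sign.\<close>

fun vertex_coords :: "vx \<Rightarrow> int \<times> int" where
  "vertex_coords (VP a b) = (int a + 1, int b + 1)"
| "vertex_coords (VU x s) = (int x + 1, - int s)"
| "vertex_coords (VD s x) = (- int s, int x + 1)"
| "vertex_coords (VN a b) = (- int a, - int b)"

lemma vertex_coords_inj: "inj vertex_coords"
proof (rule injI)
  fix v v' assume "vertex_coords v = vertex_coords v'"
  then show "v = v'" by (cases v; cases v') auto
qed

lemma vertex_coords_surj: "range vertex_coords = UNIV"
proof -
  have "z \<in> range vertex_coords" for z
  proof (cases z)
    case (Pair p r)
    consider "0 < p" "0 < r" | "0 < p" "r \<le> 0" | "p \<le> 0" "0 < r" | "p \<le> 0" "r \<le> 0" by linarith
    then show ?thesis
    proof cases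
      case 1 then show ?thesis unfolding Pair by (intro image_eqI[of _ _ "VP (nat (p - 1)) (nat (r - 1))"]) auto
    next
      case 2 then show ?thesis unfolding Pair by (intro image_eqI[of _ _ "VU (nat (p - 1)) (nat (- r))"]) auto
    next
      case 3 then show ?thesis unfolding Pair by (intro image_eqI[of _ _ "VD (nat (- p)) (nat (r - 1))"]) auto
    next
      case 4 then show ?thesis unfolding Pair by (intro image_eqI[of _ _ "VN (nat (- p)) (nat (- r))"]) auto
    qed
  qed
  then show ?thesis by blast
qed

lemma wt_coords:
  "wt q (vertex_coords (VP 0 b)) z = (if z = vertex_coords (VU b 0) then q else 0)"
  "wt q (vertex_coords (VP (Suc a) b)) z = (if z = vertex_coords (VP b a) then q else 0)"
  "wt q (vertex_coords (VU 0 s)) z = (if z = vertex_coords (VN s 0) then q else 0)"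
  "wt q (vertex_coords (VU (Suc x) s)) z = (if z = vertex_coords (VD s x) then q else 0)"
  "wt q (vertex_coords (VD s x)) z = (if z = vertex_coords (VU x (Suc s)) then 1
     else if z = vertex_coords (VP (x + s + 1) s) then q - 1 else 0)"
  "wt q (vertex_coords (VN a b)) z = (if z = vertex_coords (VN b (Suc a)) then 1
     else if z = vertex_coords (if b \<le> a then VP (a - b) a else VD (b - a - 1) a) then q - 1 else 0)"
  by (auto simp: wt_def of_nat_diff)

abbreviation (input) orbit_of :: "vx \<Rightarrow> 'k::field orbit" where "orbit_of v \<equiv> orb (vertex_coords v)"

lemma orbit_of_inj: "inj orbit_of"
  using inj_compose[OF orb_inj vertex_coords_inj] by (simp add: o_def)

lemma orbit_of_range: "range orbit_of = X_type1_chambers"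
  unfolding orb_range using vertex_coords_surj by (metis image_image)

context
  fixes q :: nat and u :: real
  assumes q: "1 \<le> q" and u: "0 < u" "real q * u < 1"
begin

interpretation strip_graph "ennreal u" "ennreal (real q * u)" "ennreal ((real q - 1) * u)"
  by standard (rule eRQ[OF q u])

lemma step_wt: "step v v' = ennreal (u * real (wt q (vertex_coords v) (vertex_coords v')))"
proof -
  note inj = inj_eq[OF vertex_coords_inj]
  have q1: "real (q - Suc 0) = real q - 1" using q by simp
  show ?thesis
    by (cases "(v, v')" rule: step.cases;
        simp only: prod.inject step.simps wt_coords inj; auto simp: q1 mult.commute)
qed

lemma pw_step:
  assumes "q = CARD('k::{field,finite})"
  shows "pw step v vs = ennreal (u ^ length vs * real (pw step_weight (orbit_of v :: 'k orbit) (map orbit_of vs)))"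
proof (induction vs arbitrary: v)
  case (Cons v' vs)
  have "ennreal (u * real a) * ennreal (u ^ n * real b) = ennreal (u ^ Suc n * real (a * b))" for a b n
    using u by (simp add: ennreal_mult[symmetric] ac_simps)
  then show ?case
    unfolding pw.simps list.map Cons.IH unfolding step_wt step_weight_orb assms[symmetric] length_Cons .
qed simp

end

text \<open>The contribution of one closed word to the logarithm of the zeta function.\<close>

definition word_term :: "'a::real_normed_field \<Rightarrow> 'k::field orbit list \<Rightarrow> 'a" where
  "word_term u ys = of_nat (cw step_weight ys) * u ^ length ys / of_nat (length ys)"

text \<open>Finiteness of \<open>klog step\<close> turns the \<open>ennreal\<close> identity into
  genuine summability, and the bijection between \<open>vx\<close> and the orbits carries it over to
  words of orbits.\<close>

lemma word_term_real_has_sum: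
  fixes q :: nat and u :: real
  assumes q: "q = CARD('k::{field,finite})" and u: "0 < u" "real q * u < 1"
  shows "(word_term u has_sum ln (zeta_closed q u)) (words :: 'k orbit list set)"
proof -
  have q1: "1 \<le> q" unfolding q by (simp add: Suc_le_eq)
  interpret strip_graph "ennreal u" "ennreal (real q * u)" "ennreal ((real q - 1) * u)"
    by standard (rule eRQ[OF q1 u])
  let ?\<beta> = "orbit_of :: vx \<Rightarrow> 'k orbit"
  define h where "h zs = (if zs = [] then 0 else word_term u (map ?\<beta> zs))" for zs
  have h0: "0 \<le> h zs" for zs using u by (simp add: h_def word_term_def)
  have summand: "of_bool (zs \<noteq> []) * inverse (of_nat (length zs)) * cw step zs = ennreal (h zs)" for zs
  proof (cases "zs = []")
    case False
    have "inverse (of_nat (length zs)) = ennreal (inverse (real (length zs)))"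
      using False by (simp add: ennreal_of_nat_eq_real_of_nat inverse_ennreal)
    moreover have "cw step zs = ennreal (u ^ length zs * real (cw step_weight (map ?\<beta> zs)))"
      unfolding cw_def pw_step[OF q1 u q] using False by (simp add: last_map)
    ultimately show ?thesis
      using False u by (simp add: h_def word_term_def ennreal_mult[symmetric] divide_inverse ac_simps)
  qed (simp add: h_def)
  have "(\<integral>\<^sup>+zs. ennreal (h zs) \<partial>count_space UNIV) = ennreal (ln (zeta_closed q u))"
    using klog_step_value[OF q1 u] unfolding klog_cw summand .
  \<comment> \<open>Needed because \<open>ennreal\<close> sends negative reals to 0.\<close>
  moreover have ge1: "0 \<le> ln (zeta_closed q u)"
  proof -
    have "zeta_closed q u = 1 / (1 - loop_weight q u)" by (simp add: loop_weight_def[OF q1 u])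
    moreover have "0 \<le> loop_weight q u" "loop_weight q u < 1" using loop_weight[OF q1 u] by auto
    ultimately show ?thesis by simp
  qed
  ultimately have "integrable (count_space UNIV) h \<and> integral\<^sup>L (count_space UNIV) h = ln (zeta_closed q u)"
    using h0 by (subst (asm) nn_integral_eq_integrable) auto
  then have h: "Infinite_Set_Sum.abs_summable_on h UNIV" "infsetsum h UNIV = ln (zeta_closed q u)"
    by (simp_all add: Infinite_Set_Sum.abs_summable_on_def infsetsum_def)
  have "(\<lambda>zs. norm (h zs)) summable_on UNIV" unfolding abs_summable_equivalent by (rule h(1))
  then have "h summable_on UNIV" by (rule abs_summable_summable)
  then have "(h has_sum ln (zeta_closed q u)) UNIV"
    unfolding h(2)[symmetric] infsetsum_infsum[OF h(1)] by (rule has_sum_infsum)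
  then have "((\<lambda>ys. if ys = [] then 0 else word_term u ys) has_sum ln (zeta_closed q u)) (range (map ?\<beta>))"
    unfolding h_def using orbit_of_inj by (subst has_sum_reindex) (simp_all add: o_def)
  moreover have "range (map ?\<beta>) = {ys. set ys \<subseteq> X_type1_chambers}"
    unfolding orbit_of_range[symmetric] by (metis lists_UNIV lists_eq_set lists_image)
  ultimately have "((\<lambda>ys. if ys = [] then 0 else word_term u ys) has_sum ln (zeta_closed q u)) {ys :: 'k orbit list. set ys \<subseteq> X_type1_chambers}"
    by simp
  \<comment> \<open>Lists of orbits outside \<open>words\<close> are empty or have weight 0 and add
    nothing.\<close>
  then show ?thesis
    by (rule has_sum_cong_neutral[THEN iffD1, rotated -1]) (auto simp: words_def word_term_def)
qed

section \<open>Complex u and the Euler product\<close>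

context
  fixes q :: nat
  assumes q: "q = CARD('k::{field,finite})"
begin

definition log_zeta :: "complex \<Rightarrow> complex" where
  "log_zeta u = infsum (word_term u) (words :: 'k orbit list set)"

lemma q_pos: "0 < q"
  unfolding q by simp

text \<open>The norms of the terms at \<open>u\<close> are the terms at the positive real
  \<open>norm u\<close>, so absolute convergence is inherited; \<open>u = 0\<close> is apart because
  the real statement needs a positive argument.\<close>

lemma word_term_has_sum:
  assumes "norm u < 1 / q"
  shows "(word_term u has_sum log_zeta u) (words :: 'k orbit list set)"
proof (cases "u = 0")
  case True
  have "(word_term u has_sum 0) (words :: 'k orbit list set)"
    by (rule has_sum_0) (simp add: True word_term_def words_def)
  then show ?thesis unfolding log_zeta_def by (simp add: infsumI)
next
  case False
  have "real q * norm u < 1" using assms q_pos by (simp add: field_simps)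
  then have "(word_term (norm u) has_sum ln (zeta_closed q (norm u))) (words :: 'k orbit list set)"
    using False by (intro word_term_real_has_sum[OF q]) simp_all
  then have sum: "word_term (norm u) summable_on (words :: 'k orbit list set)" by (rule has_sum_imp_summable)
  have eq: "word_term (norm u) = (\<lambda>ys :: 'k orbit list. norm (word_term u ys))"
    by (intro ext) (simp add: word_term_def norm_mult norm_divide norm_power)
  have "(\<lambda>ys. norm (word_term u ys)) summable_on (words :: 'k orbit list set)"
    using sum unfolding eq .
  then have "word_term u summable_on (words :: 'k orbit list set)" by (rule abs_summable_summable)
  then show ?thesis unfolding log_zeta_def by (rule has_sum_infsum)
qed

lemma log_zeta_real:
  assumes "0 < x" "real q * x < 1"
  shows "log_zeta (of_real x) = of_real (ln (zeta_closed q x))"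
proof -
  have "((\<lambda>ys. of_real (word_term x ys)) has_sum (of_real (ln (zeta_closed q x)) :: complex)) (words :: 'k orbit list set)"
    by (rule has_sum_of_real) (rule word_term_real_has_sum[OF q assms])
  moreover have "(\<lambda>ys. of_real (word_term x ys)) = (word_term (of_real x) :: 'k orbit list \<Rightarrow> complex)"
    by (intro ext) (simp add: word_term_def)
  ultimately show ?thesis unfolding log_zeta_def by (simp add: infsumI)
qed

lemma wt_le: "1 \<le> q \<Longrightarrow> wt q y z \<le> q"
  by (auto simp: wt_def split: prod.split)

text \<open>This crude bound makes \<open>norm u < 1 / q\<close> sufficient for the logarithm series
  of every single Euler factor.\<close>

lemma cw_le:
  assumes "ys \<in> (words :: 'k orbit list set)"
  shows "cw step_weight ys \<le> q ^ length ys"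
proof -
  have sw: "step_weight c c' \<le> q" if c: "c \<in> X_type1_chambers" and c': "c' \<in> X_type1_chambers" for c c' :: "'k orbit"
  proof -
    obtain y where y: "c = orb y" using c unfolding orb_range by (rule rangeE)
    obtain z where z: "c' = orb z" using c' unfolding orb_range by (rule rangeE)
    show ?thesis using wt_le[of y z] q_pos unfolding y z step_weight_orb q[symmetric] by simp
  qed
  have "pw step_weight x ys \<le> q ^ length ys" if "x \<in> X_type1_chambers" "set ys \<subseteq> X_type1_chambers" for x :: "'k orbit" and ys
    using that
  proof (induction ys arbitrary: x)
    case (Cons y ys)
    then show ?case using sw[of x y] by (auto intro!: mult_mono)
  qed simp
  moreover have "last ys \<in> X_type1_chambers" using assms by (auto simp: words_def)
  ultimately show ?thesis using assms by (simp add: words_def cw_def)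
qed

lemma power_log_has_sum:
  fixes z :: complex
  assumes "norm z < 1"
  shows "((\<lambda>k. z ^ Suc k / of_nat (Suc k)) has_sum (- Ln (1 - z))) UNIV"
proof (rule norm_summable_imp_has_sum)
  show "summable (\<lambda>k. norm (z ^ Suc k / of_nat (Suc k)))"
  proof (rule summable_comparison_test')
    show "summable (\<lambda>k. norm z ^ k)" using assms by (simp add: summable_geometric)
    fix k :: nat
    have "norm z ^ Suc k / real (Suc k) \<le> norm z ^ Suc k / 1" by (intro divide_left_mono) auto
    also have "\<dots> \<le> norm z ^ k" using assms by (simp add: mult_left_le_one_le)
    finally show "norm (norm (z ^ Suc k / of_nat (Suc k))) \<le> norm z ^ k"
      by (simp add: norm_divide norm_power norm_mult del: of_nat_Suc)
  qed
  have "(\<lambda>n. - ((- (- z)) ^ n) / of_nat n) sums ln (1 + (- z))"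
    by (rule Ln_series') (use assms in simp)
  then have "(\<lambda>n. - (- (z ^ n) / of_nat n)) sums - ln (1 - z)"
    using sums_minus by fastforce
  \<comment> \<open>The term of index 0 is again a division by 0, added so that the series can start
    at 1.\<close>
  then have "(\<lambda>n. z ^ n / of_nat n) sums (- ln (1 - z) + (z ^ 0 / of_nat 0))" by simp
  then show "(\<lambda>k. z ^ Suc k / of_nat (Suc k)) sums - Ln (1 - z)"
    by (subst (asm) sums_Suc_iff[symmetric]) simp
qed

definition class_base :: "complex \<Rightarrow> 'k orbit list set \<Rightarrow> complex" where
  "class_base u C = of_nat (class_weight C) * u ^ class_length C"

lemma prime_classE:
  assumes "C \<in> (prime_classes :: 'k orbit list set set)"
  obtains xs where "xs \<in> words" "prim xs" "xs \<noteq> []" "C = gallery_class (gal xs)"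
  using assms unfolding prime_classes_eq by (auto simp: prim_def)

lemma norm_class_base:
  assumes "norm u < 1 / q" "C \<in> prime_classes"
  shows "norm (class_base u C) < 1"
proof -
  obtain xs where xs: "xs \<in> words" "xs \<noteq> []" "C = gallery_class (gal xs)" using assms(2) by (rule prime_classE)
  have "norm (class_base u C) = real (cw step_weight xs) * norm u ^ length xs"
    unfolding class_base_def xs(3) class_values[OF xs(2)] by (simp add: norm_mult norm_power)
  also have "\<dots> \<le> real (q ^ length xs) * norm u ^ length xs"
    using cw_le[OF xs(1)] by (intro mult_right_mono) (simp_all flip: of_nat_power)
  also have "\<dots> = (real q * norm u) ^ length xs" by (simp add: power_mult_distrib)
  also have "\<dots> < 1"
    using assms(1) q_pos xs(2) by (intro power_less_one_iff[THEN iffD2]) (auto simp: field_simps)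
  finally show ?thesis .
qed

text \<open>Every word is a positive power of a unique primitive word, which is one rotation in
  exactly one prime class. The exponent is \<open>Suc k\<close>, so that \<open>k\<close> ranges
  over all naturals.\<close>

lemma word_powers_bij:
  "bij_betw (\<lambda>((C, ys), k). lpow (Suc k) ys)
     (Sigma (Sigma prime_classes (\<lambda>C. tl ` C)) (\<lambda>_. UNIV)) (words :: 'k orbit list set)"
  unfolding bij_betw_def
proof
  let ?f = "\<lambda>((C, ys), k). lpow (Suc k) ys" and ?A = "Sigma (Sigma (prime_classes :: 'k orbit list set set) (\<lambda>C. tl ` C)) (\<lambda>_. UNIV)"
  have mem: "ys \<in> words \<and> prim ys \<and> C = gallery_class (gal ys)"
    if C: "C \<in> prime_classes" and ys: "ys \<in> tl ` C" for C and ys :: "'k orbit list"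
  proof -
    obtain xs where xs: "xs \<in> words" "prim xs" "xs \<noteq> []" "C = gallery_class (gal xs)" using C by (rule prime_classE)
    have r: "ys \<in> rotations xs" using ys unfolding xs(4) tl_gallery_class[OF xs(3)] .
    then have w: "ys \<in> words" using words_rotations[OF xs(1)] by blast
    then have "ys \<noteq> []" by (simp add: words_def)
    then have "gallery_class (gal ys) = gallery_class (gal xs)"
      using gallery_class_gal[of ys] gallery_class_gal[OF xs(3)] rotations_eq[OF r xs(3)] by simp
    moreover have "prim ys" using r prim_rotate[OF xs(2)] by (auto simp: rotations_def)
    ultimately show ?thesis using w xs(4) by simp
  qed
  show "inj_on ?f ?A"
  proof (rule inj_onI)
    fix p p' assume "p \<in> ?A" "p' \<in> ?A" and eq': "?f p = ?f p'"
    then obtain C c k C' c' k' where p: "p = ((C, tl c), k)" "p' = ((C', tl c'), k')"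
      and C: "C \<in> prime_classes" "c \<in> C" and C': "C' \<in> prime_classes" "c' \<in> C'"
      by auto
    have eq: "lpow (Suc k) (tl c) = lpow (Suc k') (tl c')" using eq' unfolding p by (simp only: prod.case)
    have m: "prim (tl c)" "C = gallery_class (gal (tl c))" "prim (tl c')" "C' = gallery_class (gal (tl c'))"
      using mem[OF C(1)] mem[OF C'(1)] C(2) C'(2) by blast+
    have "tl c = tl c' \<and> Suc k = Suc k'" by (rule prim_root_unique[OF m(1,3) _ _ eq]) simp_all
    then show "p = p'" unfolding p using m(2,4) by simp
  qed
  show "?f ` ?A = words"
  proof (intro equalityI subsetI)
    fix W assume "W \<in> ?f ` ?A"
    then obtain C ys k where "C \<in> prime_classes" "ys \<in> tl ` C" "W = lpow (Suc k) ys" by auto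
    then show "W \<in> words" using mem words_lpow[of "Suc k" ys] by blast
  next
    fix W :: "'k orbit list" assume W: "W \<in> words"
    then have "W \<noteq> []" by (simp add: words_def)
    then obtain zs k where zs: "0 < k" "prim zs" "W = lpow k zs" using ex_prim_root by blast
    have w: "zs \<in> words" using W unfolding zs(3) words_lpow[OF zs(1)] .
    then have ne: "zs \<noteq> []" by (simp add: words_def)
    have "gallery_class (gal zs) \<in> prime_classes" unfolding prime_classes_eq using w zs(2) by blast
    moreover have "zs \<in> tl ` gallery_class (gal zs)" unfolding tl_gallery_class[OF ne] by (rule rotations_self)
    moreover obtain k' where "k = Suc k'" using zs(1) gr0_conv_Suc by blast
    ultimately show "W \<in> ?f ` ?A" using zs(3) by (intro image_eqI[of W ?f "((gallery_class (gal zs), zs), k')"]) simp_all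
  qed
qed

text \<open>The absolutely convergent sum over words is regrouped along
  \<open>word_powers_bij\<close>: the powers of one primitive word give a logarithm divided by the
  length, and the rotations of that word cancel the division.\<close>

lemma log_factors_has_sum:
  assumes u: "norm u < 1 / q"
  shows "((\<lambda>C. - Ln (1 - class_base u C)) has_sum log_zeta u) prime_classes"
proof -
  let ?A = "Sigma prime_classes (\<lambda>C :: 'k orbit list set. tl ` C)"
  have "((\<lambda>p. word_term u ((\<lambda>((C, ys), k). lpow (Suc k) ys) p)) has_sum log_zeta u) (Sigma ?A (\<lambda>_. UNIV))"
    using word_term_has_sum[OF u] by (subst has_sum_reindex_bij_betw[OF word_powers_bij])
  \<comment> \<open>Sum over the exponent for a fixed primitive word.\<close>
  then have "((\<lambda>(C, ys). - Ln (1 - class_base u C) / of_nat (class_length C)) has_sum log_zeta u) ?A"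
  proof (rule has_sum_SigmaD)
    fix p assume "p \<in> ?A"
    then obtain C ys where p: "p = (C, ys)" "C \<in> prime_classes" "ys \<in> tl ` C" by auto
    obtain xs where xs: "xs \<in> words" "prim xs" "xs \<noteq> []" "C = gallery_class (gal xs)" using p(2) by (rule prime_classE)
    obtain m where m: "ys = rotate m xs" using p(3) unfolding xs(4) tl_gallery_class[OF xs(3)] by (auto simp: rotations_def)
    have l: "length ys = class_length C" and w: "cw step_weight ys = class_weight C"
      unfolding xs(4) class_values[OF xs(3)] m by (simp_all add: cw_rotate)
    have "((\<lambda>k. class_base u C ^ Suc k / of_nat (Suc k) * inverse (of_nat (class_length C))) has_sum
        (- Ln (1 - class_base u C) * inverse (of_nat (class_length C)))) UNIV"
      by (intro has_sum_cmult_left power_log_has_sum norm_class_base[OF u p(2)])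
    moreover have "word_term u (lpow (Suc k) ys) = class_base u C ^ Suc k / of_nat (Suc k) * inverse (of_nat (class_length C))" for k
      unfolding word_term_def class_base_def length_lpow l w[symmetric] cw_lpow[OF zero_less_Suc]
        of_nat_power of_nat_mult power_mult_distrib power_mult[symmetric] mult.commute[of "Suc k" "class_length C"]
      by (simp add: divide_inverse del: of_nat_Suc power_Suc)
    ultimately have "((\<lambda>k. word_term u (lpow (Suc k) ys)) has_sum
        (- Ln (1 - class_base u C) * inverse (of_nat (class_length C)))) UNIV"
      by (simp only:)
    then show "((\<lambda>k. word_term u ((\<lambda>((C, ys), k). lpow (Suc k) ys) (p, k))) has_sum
        (case p of (C, ys) \<Rightarrow> - Ln (1 - class_base u C) / of_nat (class_length C))) UNIV"
      unfolding p(1) by (simp only: prod.case divide_inverse)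
  qed
  \<comment> \<open>Sum over the rotations in one class, of which there are
    \<open>class_length C\<close>.\<close>
  then show ?thesis
  proof (rule has_sum_SigmaD)
    fix C assume C: "C \<in> (prime_classes :: 'k orbit list set set)"
    obtain xs where xs: "xs \<in> words" "prim xs" "xs \<noteq> []" "C = gallery_class (gal xs)" using C by (rule prime_classE)
    have R: "tl ` C = rotations xs" unfolding xs(4) by (rule tl_gallery_class[OF xs(3)])
    have "class_length C = length xs" unfolding xs(4) class_values[OF xs(3)] ..
    then have c: "card (tl ` C) = class_length C" unfolding R rotations_def card_rotations[OF xs(2)] by simp
    have pos: "0 < class_length C" unfolding xs(4) class_values[OF xs(3)] using xs(3) by simp
    then have "finite (tl ` C)" using c card_gt_0_iff[of "tl ` C"] by simp
    from has_sum_finite[OF this, of "\<lambda>ys. - Ln (1 - class_base u C) / of_nat (class_length C)"]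
    show "((\<lambda>ys. case (C, ys) of (C, ys) \<Rightarrow> - Ln (1 - class_base u C) / of_nat (class_length C)) has_sum
        (- Ln (1 - class_base u C))) (tl ` C)"
      using pos by (simp add: c)
  qed
qed

text \<open>Finite partial products are exponentials of finite partial sums, so convergence passes
  along the filter of finite subsets; an exponential is never 0.\<close>

lemma zeta_has_unordered_prod:
  assumes u: "norm u < 1 / q"
  shows "has_unordered_prod (zeta_factor u) (prime_classes :: 'k orbit list set set) (exp (log_zeta u))"
proof -
  let ?g = "\<lambda>C. - Ln (1 - class_base u C)"
  have fac: "exp (?g C) = zeta_factor u C" if "C \<in> prime_classes" for C :: "'k orbit list set"
  proof -
    have "1 - class_base u C \<noteq> 0" using norm_class_base[OF u that] by auto
    then show ?thesis by (simp add: exp_minus zeta_factor_def class_base_def)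
  qed
  have "((\<lambda>F. exp (sum ?g F)) \<longlongrightarrow> exp (log_zeta u)) (finite_subsets_at_top prime_classes)"
    using log_factors_has_sum[OF u] unfolding has_sum_def by (rule tendsto_exp)
  moreover have "\<forall>\<^sub>F F in finite_subsets_at_top prime_classes. exp (sum ?g F) = prod (zeta_factor u) F"
    by (rule eventually_finite_subsets_at_top_weakI) (auto simp: exp_sum fac intro!: prod.cong)
  ultimately show ?thesis
    unfolding has_unordered_prod_def by (simp cong: tendsto_cong)
qed

text \<open>Grouping words by length turns the unordered sum into a power series.\<close>

lemma log_zeta_holomorphic: "log_zeta holomorphic_on ball 0 (1 / q)"
proof -
  define L where "L n = {ys \<in> (words :: 'k orbit list set). length ys = n}" for n
  define a where "a n = infsum (\<lambda>ys. of_nat (cw step_weight ys) / of_nat n :: complex) (L n)" for n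
  have coeff: "(\<lambda>ys. of_nat (cw step_weight ys) / of_nat n :: complex) summable_on L n" for n
  proof -
    \<comment> \<open>Any nonzero point of the disc will do: summability there gives summability of
      the coefficients of a fixed length after division by the power of \<open>v\<close>.\<close>
    define v where "v = (of_real (1 / (2 * q)) :: complex)"
    have v: "v \<noteq> 0" "norm v < 1 / q" using q_pos by (auto simp: v_def norm_divide norm_mult field_simps)
    have "word_term v summable_on (words :: 'k orbit list set)" using word_term_has_sum[OF v(2)] by (auto simp: summable_on_def)
    then have "word_term v summable_on L n" by (rule summable_on_subset_banach) (auto simp: L_def)
    then have "(\<lambda>ys. word_term v ys * inverse (v ^ n)) summable_on L n" by (rule summable_on_cmult_left)
    then show ?thesis
      by (rule summable_on_cong[THEN iffD1, rotated]) (use v(1) in \<open>simp add: L_def word_term_def\<close>)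
  qed
  have "(\<lambda>n. a n * (u - 0) ^ n) sums log_zeta u" if "u \<in> ball 0 (1 / q)" for u
  proof -
    have u: "norm u < 1 / q" using that by simp
    have bij: "bij_betw snd (Sigma UNIV L) (words :: 'k orbit list set)"
      by (auto simp: bij_betw_def inj_on_def L_def image_iff)
    have "((\<lambda>p. word_term u (snd p)) has_sum log_zeta u) (Sigma UNIV L)"
      using word_term_has_sum[OF u] by (subst has_sum_reindex_bij_betw[OF bij])
    then have "((\<lambda>n. a n * u ^ n) has_sum log_zeta u) UNIV"
    proof (rule has_sum_SigmaD)
      fix n
      have "((\<lambda>ys. of_nat (cw step_weight ys) / of_nat n * u ^ n) has_sum (a n * u ^ n)) (L n)"
        unfolding a_def by (intro has_sum_cmult_left has_sum_infsum coeff)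
      then show "((\<lambda>ys. word_term u (snd (n, ys))) has_sum a n * u ^ n) (L n)"
        by (rule has_sum_cong[THEN iffD1, rotated]) (simp add: L_def word_term_def)
    qed
    then show ?thesis by (simp add: has_sum_imp_sums)
  qed
  then show ?thesis by (rule power_series_holomorphic)
qed

lemma denominators_nonzero:
  fixes u :: complex
  assumes "norm u < 1 / q"
  shows "1 - of_nat q ^ 3 * u ^ 6 \<noteq> 0" "1 - of_nat q ^ 3 * u ^ 3 \<noteq> 0"
proof -
  have qu: "real q * norm u < 1" using assms q_pos by (simp add: field_simps)
  have "norm u \<le> 1" using assms q_pos by (smt (verit) divide_le_eq_1 of_nat_1 of_nat_mono One_nat_def Suc_leI)
  have lt: "(real q * norm u) ^ 3 < 1" using qu by (simp add: power_less_one_iff)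
  have 3: "norm (of_nat q ^ 3 * u ^ 3) < 1" using lt by (simp add: norm_mult norm_power power_mult_distrib)
  have "norm (of_nat q ^ 3 * u ^ 6) = norm (of_nat q ^ 3 * u ^ 3) * norm u ^ 3"
    by (simp add: norm_mult norm_power flip: power_add)
  also have "\<dots> \<le> norm (of_nat q ^ 3 * u ^ 3)" using \<open>norm u \<le> 1\<close> by (intro mult_left_le) (auto simp: power_le_one)
  finally have 6: "norm (of_nat q ^ 3 * u ^ 6) < 1" using 3 by simp
  show "1 - of_nat q ^ 3 * u ^ 6 \<noteq> 0" "1 - of_nat q ^ 3 * u ^ 3 \<noteq> 0" using 3 6 by (metis eq_iff_diff_eq_0 less_irrefl norm_one)+
qed

lemma zeta_closed_holomorphic: "(zeta_closed q :: complex \<Rightarrow> complex) holomorphic_on ball 0 (1 / q)"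
  unfolding zeta_closed_def
  by (intro holomorphic_intros) (use denominators_nonzero in auto)

text \<open>Both sides are holomorphic on the disc and agree on an interval of positive reals, which
  accumulates at the interior point 0.\<close>

lemma exp_log_zeta:
  assumes "norm u < 1 / q"
  shows "exp (log_zeta u) = zeta_closed q u"
proof -
  let ?U = "of_real ` {0<..<1 / q} :: complex set"
  have "(\<lambda>u. exp (log_zeta u) - zeta_closed q u) u = 0"
  proof (rule analytic_continuation[where f = "\<lambda>u. exp (log_zeta u) - zeta_closed q u" and S = "ball 0 (1 / q)" and U = ?U and \<xi> = 0])
    show "(\<lambda>u. exp (log_zeta u) - zeta_closed q u) holomorphic_on ball 0 (1 / q)"
      by (intro holomorphic_intros log_zeta_holomorphic[THEN holomorphic_on_compose[of log_zeta _ exp, unfolded o_def]] zeta_closed_holomorphic)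
    show "?U \<subseteq> ball 0 (1 / q)" by auto
    show "(0::complex) islimpt ?U"
      unfolding islimpt_approachable
    proof (intro allI impI)
      fix e :: real assume "0 < e"
      \<comment> \<open>Half of each bound, so that \<open>x\<close> lies strictly below both
        \<open>e\<close> and \<open>1 / q\<close>.\<close>
      define x where "x = min (e / 2) (1 / (2 * real q))"
      have "0 < x" "x < e" "x < 1 / q" using \<open>0 < e\<close> q_pos by (auto simp: x_def min_def field_simps)
      then show "\<exists>x'\<in>?U. x' \<noteq> 0 \<and> dist x' 0 < e" by (intro bexI[of _ "of_real x"]) auto
    qed
    show "exp (log_zeta z) - zeta_closed q z = 0" if z: "z \<in> ?U" for z
    proof -
      obtain x where x: "z = of_real x" "0 < x" "x < 1 / q" using z by auto
      then have qx: "real q * x < 1" using q_pos by (simp add: field_simps)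
      have q1: "1 \<le> q" using q_pos by simp
      have "0 < 1 / zeta_closed q x"
        using loop_weight(2)[OF q1 x(2) qx] unfolding loop_weight_def[OF q1 x(2) qx] by linarith
      then have "0 < zeta_closed q x" by (simp only: zero_less_divide_1_iff)
      moreover have "zeta_closed q (of_real x :: complex) = of_real (zeta_closed q x)" by (simp add: zeta_closed_def)
      ultimately show ?thesis using log_zeta_real[OF x(2) qx] x(1) by (simp add: exp_of_real)
    qed
  qed (use assms q_pos in auto)
  then show ?thesis by simp
qed

text \<open>Uniqueness of limits along the filter of finite subsets resolves the \<open>THE\<close>
  in \<open>chamber_zeta\<close>.\<close>

lemma chamber_zeta_eq:
  assumes "norm u < 1 / q"
  shows "zeta_converges TYPE('k) u" "chamber_zeta TYPE('k) u = zeta_closed q u"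
proof -
  note prod = zeta_has_unordered_prod[OF assms, unfolded exp_log_zeta[OF assms]]
  show "zeta_converges TYPE('k) u" unfolding zeta_converges_def using prod by blast
  have "z = zeta_closed q u" if "has_unordered_prod (zeta_factor u) (prime_classes :: 'k orbit list set set) z" for z
    using that prod tendsto_unique[OF finite_subsets_at_top_neq_bot] unfolding has_unordered_prod_def by blast
  then show "chamber_zeta TYPE('k) u = zeta_closed q u"
    unfolding chamber_zeta_def using prod by (intro the_equality)
qed

end

text \<open>The radius is \<open>1 / q\<close>, the range in which the total weight
  \<open>q * norm u\<close> leaving a vertex stays below 1.\<close>

theorem theorem1p1:
  fixes q :: nat
  assumes "CARD('k::{field,finite}) = q"
  shows "\<exists>r::real. r > 0 \<and>
    (\<forall>u::complex. norm u < r \<longrightarrow>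
       zeta_converges TYPE('k) u \<and>
       chamber_zeta TYPE('k) u =
         ((1 - of_nat q ^ 4 * u ^ 6) * (1 - of_nat q ^ 2 * u ^ 3)) /
         ((1 - of_nat q ^ 3 * u ^ 6) * (1 - of_nat q ^ 3 * u ^ 3))) \<and>
    (\<exists>A B :: complex poly. B \<noteq> 0 \<and>
       (\<forall>u. norm u < r \<longrightarrow> poly B u \<noteq> 0 \<and> chamber_zeta TYPE('k) u = poly A u / poly B u))"
proof (intro exI[of _ "1 / real q"] conjI)
  note q = assms[symmetric]
  show "1 / real q > 0" using q_pos[OF q] by simp
  show "\<forall>u::complex. norm u < 1 / real q \<longrightarrow> zeta_converges TYPE('k) u \<and> chamber_zeta TYPE('k) u =
         ((1 - of_nat q ^ 4 * u ^ 6) * (1 - of_nat q ^ 2 * u ^ 3)) /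
         ((1 - of_nat q ^ 3 * u ^ 6) * (1 - of_nat q ^ 3 * u ^ 3))"
    using chamber_zeta_eq[OF q] by (simp add: zeta_closed_def)
  define A :: "complex poly" where "A = (1 - monom (of_nat q ^ 4) 6) * (1 - monom (of_nat q ^ 2) 3)"
  define B :: "complex poly" where "B = (1 - monom (of_nat q ^ 3) 6) * (1 - monom (of_nat q ^ 3) 3)"
  have "poly B 0 \<noteq> 0" by (simp add: B_def poly_monom)
  then have "B \<noteq> 0" by auto
  moreover have "poly B u \<noteq> 0 \<and> chamber_zeta TYPE('k) u = poly A u / poly B u" if "norm u < 1 / real q" for u
    using denominators_nonzero[OF q that] chamber_zeta_eq(2)[OF q that]
    by (simp add: A_def B_def poly_monom zeta_closed_def)
  ultimately show "\<exists>A B :: complex poly. B \<noteq> 0 \<and>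
       (\<forall>u. norm u < 1 / real q \<longrightarrow> poly B u \<noteq> 0 \<and> chamber_zeta TYPE('k) u = poly A u / poly B u)"
    by blast
qed

end
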